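(* Let $\mathcal M$ be a compact manifold, and $(X_i)_{i\ge1}$ i.i.d. random elements of $\mathcal M$ distributed according to $\mu$, a probability measure with full support on $\mathcal M$; put $\mathbb X_n=\{X_1,\dots,X_n\}$ and $\mu_n=\frac1n\sum_{i=1}^n\delta_{X_i}$. Let the similarity kernel $\eta\colon\mathcal M\times\mathcal M\to\mathbb R_+$ be symmetric, continuous and strictly positive, and let $k\ge1$, $p\ge1$, $t\ge0$. Assume that the first $k$ eigenvalues $0\le\sigma_1\le\cdots\le\sigma_k\le1$ of the limiting operator $U$ are simple and satisfy $\sigma_k\ne1$. Then the $k$-means procedure performed on the metric measure space $\mathcal X_n=(\mathbb X_n,d_t,\mu_n)$, with $d_t$ the truncated diffusion distance, is consistent: almost surely, for every $\varepsilon>0$ there exists $N\in\mathbb N$ such that for all $n\ge N$ and for every set of $k$-barycenters $S_n\in\mathcal S_{\mathcal X_n}(k)$, $S_n\subset\mathbb X_n$, of $\mathcal X_n$, there exists a set of $k$-barycenters $S\in\mathcal S_{\mathcal X}(k)$, $S\subset\mathcal M$, of $\mathcal X=(\mathcal M,\delta_t,\mu)$ which is $\varepsilon$-close in Hausdorff distance: $$d_H(S_n,S)\le\varepsilon.$$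
   Context: For each $n$ let $\eta$ also denote the $n\times n$ matrix $\eta_{ij}=\eta(X_i,X_j)$, let $D$ be the diagonal matrix with entries $d_i=\sum_{j=1}^n\eta_{ij}$, and let $L=I-D^{-1/2}\eta D^{-1/2}$ be the normalized graph Laplacian. Let $\lambda_1\le\cdots\le\lambda_k$ be the $k$ smallest eigenvalues of $L$ with eigenvectors $u_l=(u_l^1,\dots,u_l^n)\in\mathbb R^n$; all depend on $n$. The truncated diffusion distance is given by $d_t(X_i,X_j)^2=\sum_{l=1}^k(1-\lambda_l)^{2t}(u_l^i-u_l^j)^2$. The limiting operator is $U(f)(x)=f(x)-\mathbb E\left[\frac{\eta(x,X_1)}{\sqrt{\mathsf d(x)\mathsf d(X_1)}}f(X_1)\right]$ with $\mathsf d(x)=\mathbb E[\eta(x,X_1)]$; its first $k$ eigenvalues are the $k$ smallest. The limit distance is $\delta_t(x,y)^2=\sum_{l=1}^k(1-\sigma_l)^{2t}(f_l(x)-f_l(y))^2$, where $f_1,\dots,f_k\colon\mathcal M\to\mathbb R$ are the eigenfunctions of $U$ associated to $\sigma_1,\dots,\sigma_k$ provided by the spectral convergence theorem of von Luxburg, Belkin and Bousquet. That theorem asserts, under the hypotheses of the claim, that almost surely, for $n$ large, $0=\lambda_1\le\cdots\le\lambda_k<1$ with $\lambda_l\to\sigma_l$, and that each eigenvector $u_l$ converges uniformly to an eigenfunction $f_l$ associated to $\sigma_l$, in the sense that $\sup_{1\le j\le n}|u_l^j-f_l(X_j)|\to0$. In general $d_t$ and $\delta_t$ are only pseudo-distances;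 the convention is that points at distance $0$ are identified. For a metric space with probability measure $\mathcal Y=(\mathbb Y,r,\nu)$, $C_k(\mathbb Y)$ is the set of nonempty subsets of $\mathbb Y$ with at most $k$ points, and $\mathcal S_{\mathcal Y}(k)$ (the sets of $k$-means, or $k$-barycenters) is the set of minimizers over $S\in C_k(\mathbb Y)$ of $\int_{\mathbb Y}\min_{x\in S}r(y,x)^p\,\nu(dy)$. The Hausdorff distance is $d_H(A,B)=\max\{\max_{a\in A}r(a,B),\max_{b\in B}r(b,A)\}$ with $r(x,C)=\min_{c\in C}r(x,c)$; in the claim it is taken on $\mathcal M$ with $r=\delta_t$. *)

theory Defs
  imports
    "HOL-Probability.Probability"
    "Jordan_Normal_Form.Char_Poly"
begin

text \<open>
  All families are indexed from \<open>0\<close>: the sample is \<open>X 0, \<dots>, X (n - 1)\<close>, and the eigenvalues and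
  eigenfunctions are \<open>\<sigma> 0, \<dots>, \<sigma> (k - 1)\<close> and \<open>f 0, \<dots>, f (k - 1)\<close>.
\<close>

section \<open>Compact manifolds\<close>

text \<open>
  The manifold is a whole type; the Hausdorff property and second countability are carried by the
  type classes, so that only compactness and local Euclideanness remain to be stated.
  The library's \<open>Euclidean_space d\<close> has a term-level dimension, which includes \<open>d = 0\<close>.
\<close>

definition compact_manifold :: "'m::{t2_space,second_countable_topology} itself \<Rightarrow> bool" where
  "compact_manifold _ \<longleftrightarrow>
     compact (UNIV :: 'm set) \<and>
     (\<exists>d. \<forall>x::'m. \<exists>U V. open U \<and> x \<in> U \<and> openin (Euclidean_space d) V \<and>
        subtopology euclidean U homeomorphic_space subtopology (Euclidean_space d) V)"


section \<open>Barycenters and the Hausdorff distance\<close>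

text \<open>
  A (pseudo-)distance \<open>r\<close> is only looked at on the carrier \<open>Y\<close>.  Identifying points at distance
  \<open>0\<close> amounts to working with representatives: both the cost of a set and the Hausdorff distance
  are unchanged when a point is replaced by one at \<open>r\<close>-distance \<open>0\<close>.
\<close>

definition candidate_sets :: "'m set \<Rightarrow> nat \<Rightarrow> 'm set set" where
  "candidate_sets Y k = {S. S \<subseteq> Y \<and> S \<noteq> {} \<and> finite S \<and> card S \<le> k}"

definition kmeans_cost :: "('m \<Rightarrow> 'm \<Rightarrow> real) \<Rightarrow> 'm measure \<Rightarrow> real \<Rightarrow> 'm set \<Rightarrow> real" where
  "kmeans_cost r \<nu> p S = (\<integral>y. Min ((\<lambda>x. r y x powr p) ` S) \<partial>\<nu>)"

definition barycenters ::
  "'m set \<Rightarrow> ('m \<Rightarrow> 'm \<Rightarrow> real) \<Rightarrow> 'm measure \<Rightarrow> real \<Rightarrow> nat \<Rightarrow> 'm set set" where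
  "barycenters Y r \<nu> p k =
     {S \<in> candidate_sets Y k. \<forall>S' \<in> candidate_sets Y k. kmeans_cost r \<nu> p S \<le> kmeans_cost r \<nu> p S'}"

definition hausdorff_dist :: "('m \<Rightarrow> 'm \<Rightarrow> real) \<Rightarrow> 'm set \<Rightarrow> 'm set \<Rightarrow> real" where
  "hausdorff_dist r A B =
     max (Max ((\<lambda>a. Min ((\<lambda>b. r a b) ` B)) ` A)) (Max ((\<lambda>b. Min ((\<lambda>a. r b a) ` A)) ` B))"


section \<open>The normalized graph Laplacian of a point sequence\<close>

definition similarity_mat :: "('m \<Rightarrow> 'm \<Rightarrow> real) \<Rightarrow> nat \<Rightarrow> (nat \<Rightarrow> 'm) \<Rightarrow> real mat" where
  "similarity_mat \<eta> n x = Matrix.mat n n (\<lambda>(i, j). \<eta> (x i) (x j))"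

definition inv_sqrt_degree_mat :: "('m \<Rightarrow> 'm \<Rightarrow> real) \<Rightarrow> nat \<Rightarrow> (nat \<Rightarrow> 'm) \<Rightarrow> real mat" where
  "inv_sqrt_degree_mat \<eta> n x = mat_diag n (\<lambda>i. 1 / sqrt (\<Sum>j<n. \<eta> (x i) (x j)))"

definition laplacian :: "('m \<Rightarrow> 'm \<Rightarrow> real) \<Rightarrow> nat \<Rightarrow> (nat \<Rightarrow> 'm) \<Rightarrow> real mat" where
  "laplacian \<eta> n x =
     1\<^sub>m n - inv_sqrt_degree_mat \<eta> n x * similarity_mat \<eta> n x * inv_sqrt_degree_mat \<eta> n x"

text \<open>The eigenvalues in increasing order, counted with multiplicity.\<close>

definition laplacian_eigenvalue :: "('m \<Rightarrow> 'm \<Rightarrow> real) \<Rightarrow> nat \<Rightarrow> (nat \<Rightarrow> 'm) \<Rightarrow> nat \<Rightarrow> real" where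
  "laplacian_eigenvalue \<eta> n x l =
     sorted_list_of_multiset (proots (char_poly (laplacian \<eta> n x))) ! l"


section \<open>The limiting operator\<close>

definition mean_degree :: "('m \<Rightarrow> 'm \<Rightarrow> real) \<Rightarrow> 'm measure \<Rightarrow> 'm \<Rightarrow> real" where
  "mean_degree \<eta> \<mu> x = (\<integral>y. \<eta> x y \<partial>\<mu>)"

definition limit_operator ::
  "('m \<Rightarrow> 'm \<Rightarrow> real) \<Rightarrow> 'm measure \<Rightarrow> ('m \<Rightarrow> real) \<Rightarrow> 'm \<Rightarrow> real" where
  "limit_operator \<eta> \<mu> f x =
     f x - (\<integral>y. \<eta> x y / sqrt (mean_degree \<eta> \<mu> x * mean_degree \<eta> \<mu> y) * f y \<partial>\<mu>)"

text \<open>The operator acts on the space of continuous real functions.\<close>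

definition eigenfunction ::
  "(('m::topological_space \<Rightarrow> real) \<Rightarrow> 'm \<Rightarrow> real) \<Rightarrow> ('m \<Rightarrow> real) \<Rightarrow> real \<Rightarrow> bool" where
  "eigenfunction T f s \<longleftrightarrow>
     continuous_on UNIV f \<and> f \<noteq> (\<lambda>x. 0) \<and> T f = (\<lambda>x. s * f x)"

definition simple_eigenvalue ::
  "(('m::topological_space \<Rightarrow> real) \<Rightarrow> 'm \<Rightarrow> real) \<Rightarrow> real \<Rightarrow> bool" where
  "simple_eigenvalue T s \<longleftrightarrow>
     (\<exists>f. eigenfunction T f s \<and> (\<forall>g. eigenfunction T g s \<longrightarrow> (\<exists>c. g = (\<lambda>x. c * f x))))"

text \<open>
  \<open>\<sigma> 0, \<dots>, \<sigma> (k - 1)\<close> list the \<open>k\<close> smallest eigenvalues, and these are simple. As eigenvalues are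
  listed with multiplicity, a list of simple ones is strictly increasing.
\<close>

definition first_eigenvalues_simple ::
  "(('m::topological_space \<Rightarrow> real) \<Rightarrow> 'm \<Rightarrow> real) \<Rightarrow> nat \<Rightarrow> (nat \<Rightarrow> real) \<Rightarrow> bool" where
  "first_eigenvalues_simple T k \<sigma> \<longleftrightarrow>
     strict_mono_on {..<k} \<sigma> \<and>
     (\<forall>l<k. simple_eigenvalue T (\<sigma> l)) \<and>
     (\<forall>f s. eigenfunction T f s \<and> s \<notin> \<sigma> ` {..<k} \<longrightarrow> (\<forall>l<k. \<sigma> l < s))"


section \<open>Diffusion distances\<close>

text \<open>
  The common shape of both distances: \<open>'i\<close> is the type of sample indices for the truncated
  diffusion distance and the manifold for its limit.  The time \<open>t\<close> is real, hence \<open>powr\<close>, which is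
  the usual power as long as \<open>s l < 1\<close>.
\<close>

definition spectral_dist ::
  "nat \<Rightarrow> real \<Rightarrow> (nat \<Rightarrow> real) \<Rightarrow> (nat \<Rightarrow> 'i \<Rightarrow> real) \<Rightarrow> 'i \<Rightarrow> 'i \<Rightarrow> real" where
  "spectral_dist k t s g a b = sqrt (\<Sum>l<k. (1 - s l) powr (2 * t) * (g l a - g l b)\<^sup>2)"

text \<open>
  As a distance between points of the sample, the truncated diffusion distance needs an index for
  every sample point.  The choice is immaterial when the first \<open>k\<close> eigenvalues differ from \<open>1\<close>: the
  eigenvector equation then gives \<open>u l i = u l j\<close> whenever \<open>x i = x j\<close>.
\<close>

definition sample_index :: "nat \<Rightarrow> (nat \<Rightarrow> 'm) \<Rightarrow> 'm \<Rightarrow> nat" where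
  "sample_index n x y = (LEAST i. i < n \<and> x i = y)"

definition diffusion_dist ::
  "('m \<Rightarrow> 'm \<Rightarrow> real) \<Rightarrow> nat \<Rightarrow> (nat \<Rightarrow> 'm) \<Rightarrow> nat \<Rightarrow> real \<Rightarrow> (nat \<Rightarrow> nat \<Rightarrow> real) \<Rightarrow> 'm \<Rightarrow> 'm \<Rightarrow> real"
  where
  "diffusion_dist \<eta> n x k t u y z =
     spectral_dist k t (laplacian_eigenvalue \<eta> n x) u (sample_index n x y) (sample_index n x z)"

definition empirical_measure :: "nat \<Rightarrow> (nat \<Rightarrow> 'm) \<Rightarrow> 'm measure" where
  "empirical_measure n x = measure_pmf (map_pmf x (pmf_of_set {..<n}))"

text \<open>
  Eigenvectors and eigenfunctions are determined only up to scalar factors, on which the distances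
  depend.  Uniform convergence of the eigenvectors \<open>u n l\<close> to the eigenfunctions \<open>f l\<close> presupposes
  that the two are scaled compatibly; this requirement alone, with no assertion of convergence of
  the vectors themselves, is expressed here through the sup norms.  It is met, for instance, when
  all sup norms are \<open>1\<close>.  Signs do not matter, as the distances are invariant under sign changes.
\<close>

definition compatible_scaling ::
  "nat \<Rightarrow> (nat \<Rightarrow> nat \<Rightarrow> nat \<Rightarrow> real) \<Rightarrow> (nat \<Rightarrow> 'm \<Rightarrow> real) \<Rightarrow> bool" where
  "compatible_scaling k u f \<longleftrightarrow>
     (\<forall>l<k. (\<lambda>n. Max ((\<lambda>i. \<bar>u n l i\<bar>) ` {..<n})) \<longlonglongrightarrow> (SUP x. \<bar>f l x\<bar>))"

end

(*
  The spectral convergence theorem of von Luxburg, Belkin and Bousquet is proved along the way.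
  Almost surely the sample is equidistributed: averages of continuous functions converge to their
  integrals, and by equicontinuity averages against the kernel converge uniformly.  Extending the
  eigenvectors to the manifold by means of the kernel makes them equicontinuous, so by Arzela-Ascoli
  every subsequence has a further one along which they converge uniformly to eigenfunctions of the
  limiting operator.  Together with Courant-Fischer this yields the convergence of the first k
  eigenvalues, and simplicity then identifies the limits of the eigenvectors up to sign.
  Hence the diffusion distance converges to the limit distance uniformly on the sample.  By
  compactness, barycenters of the sample subconverge; since the costs converge and every competitor
  in the manifold is approximated by sample points, their limit is a set of barycenters.
*)
theory Submission
  imports Defs
begin

text \<open>Dividing an eigenvector by the square root of the degree makes it a kernel average
  divided by \<open>1 - \<lambda>\<close> times the degree. The right-hand side makes sense on the
  whole manifold: this is the extension by the kernel, and it requires that the limit eigenvalues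
  differ from 1. Its modulus of continuity comes from the kernel alone, so that a bound on the mean
  absolute value of the vector suffices. No distance on the manifold is at hand; uniformity always
  comes from finite covers by neighbourhoods. Two things are not determined: the sign of an
  eigenvector, which may vary with \<open>n\<close> and \<open>l\<close>, and the barycenters, which
  need not be unique. Convergence of eigenvectors is therefore stated up to a sign chosen anew for
  each \<open>n\<close>, and both limit theorems argue by contradiction from a bad subsequence.
  Simplicity leaves an unknown scalar between a limit of eigenvectors and \<open>f l\<close>; the
  agreement of the sup norms forces its modulus to be 1. The remaining sign vanishes since every
  coordinate enters the distance squared.\<close>

no_notation vec_nth (infixl "$" 90)

section \<open>Real symmetric matrices\<close>

text \<open>A complex root is real by hypothesis, so it splits off a real linear factor; the
  quotient inherits the hypothesis because its roots are roots of the product.\<close>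

lemma real_poly_splits:
  fixes p :: "real poly"
  assumes "lead_coeff p = 1"
    and "\<And>z::complex. poly (map_poly of_real p) z = 0 \<Longrightarrow> z \<in> \<real>"
  shows "\<exists>es. p = (\<Prod>e\<leftarrow>es. [:- e, 1:])"
  using assms
proof (induction "degree p" arbitrary: p)
  case 0
  then have "p = 1" by (metis one_pCons degree_eq_zeroE coeff_pCons_0)
  then show ?case by (intro exI[of _ "[]"]) simp
next
  case (Suc n)
  interpret of_real_poly: map_poly_comm_ring_hom complex_of_real ..
  have "degree (map_poly complex_of_real p) = Suc n"
    using Suc by (simp add: degree_map_poly)
  then obtain z where z: "poly (map_poly complex_of_real p) z = 0"
    using fundamental_theorem_of_algebra_alt[of "map_poly complex_of_real p"]
    by (metis degree_pCons_0 nat.distinct(1))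
  then obtain r where r: "z = of_real r" using Suc.prems(2) by (auto elim: Reals_cases)
  have "poly p r = 0" using z unfolding r by simp
  then obtain q where q: "p = [:- r, 1:] * q" using poly_eq_0_iff_dvd by blast
  have q0: "q \<noteq> 0" using Suc q by auto
  have "lead_coeff q = 1" using Suc.prems(1) unfolding q lead_coeff_mult by simp
  moreover have "n = degree q" using Suc.hyps(2) q0 unfolding q by (subst (asm) degree_mult_eq) auto
  moreover have "w \<in> \<real>" if "poly (map_poly complex_of_real q) w = 0" for w
  proof (rule Suc.prems(2))
    have "map_poly complex_of_real p = map_poly complex_of_real [:- r, 1:] * map_poly complex_of_real q"
      unfolding q by (rule of_real_poly.hom_mult)
    then show "poly (map_poly complex_of_real p) w = 0" using that by simp
  qed
  ultimately obtain es where "q = (\<Prod>e\<leftarrow>es. [:- e, 1:])" using Suc.hyps(1) by blast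
  then show ?case unfolding q by (intro exI[of _ "r # es"]) simp
qed

text \<open>The Hermitian form \<open>q\<close> of an eigenvector is \<open>z\<close> times its
  squared norm \<open>N\<close>. Exchanging the two summations shows that \<open>q\<close> is its
  own conjugate, and \<open>N\<close> is real and nonzero.\<close>

lemma complex_eigenvalue_symmetric_real:
  fixes A :: "real mat"
  assumes A: "A \<in> carrier_mat n n" and sym: "\<And>i j. i < n \<Longrightarrow> j < n \<Longrightarrow> A $$ (i, j) = A $$ (j, i)"
    and z: "eigenvalue (map_mat complex_of_real A) z"
  shows "z \<in> \<real>"
proof -
  obtain v where v: "v \<in> carrier_vec n" "v \<noteq> 0\<^sub>v n"
    and ev: "map_mat complex_of_real A *\<^sub>v v = z \<cdot>\<^sub>v v"
    using z A unfolding eigenvalue_def eigenvector_def by auto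
  have e: "(\<Sum>j<n. complex_of_real (A $$ (i, j)) * v $ j) = z * v $ i" if "i < n" for i
  proof -
    have "(map_mat complex_of_real A *\<^sub>v v) $ i = (z \<cdot>\<^sub>v v) $ i" using ev by simp
    then show ?thesis using that v(1) A by (simp add: scalar_prod_def atLeast0LessThan)
  qed
  define N where "N = (\<Sum>i<n. cnj (v $ i) * v $ i)"
  define q where "q = (\<Sum>i<n. \<Sum>j<n. cnj (v $ i) * complex_of_real (A $$ (i, j)) * v $ j)"
  have qN: "q = z * N"
    unfolding q_def N_def sum_distrib_left
  proof (intro sum.cong refl)
    fix i assume "i \<in> {..<n}"
    then have "(\<Sum>j<n. cnj (v $ i) * complex_of_real (A $$ (i, j)) * v $ j) = cnj (v $ i) * (z * v $ i)"
      unfolding mult.assoc by (simp add: e flip: sum_distrib_left)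
    then show "(\<Sum>j<n. cnj (v $ i) * complex_of_real (A $$ (i, j)) * v $ j) = z * (cnj (v $ i) * v $ i)"
      by (simp add: ac_simps)
  qed
  have "cnj q = (\<Sum>i<n. \<Sum>j<n. cnj (v $ j) * complex_of_real (A $$ (i, j)) * v $ i)"
    unfolding q_def cnj_sum by (simp add: ac_simps)
  also have "\<dots> = (\<Sum>j<n. \<Sum>i<n. cnj (v $ j) * complex_of_real (A $$ (i, j)) * v $ i)"
    by (rule sum.swap)
  also have "\<dots> = q" unfolding q_def by (intro sum.cong refl) (simp add: sym)
  finally have cq: "cnj q = q" .
  have N: "N = of_real (\<Sum>i<n. (cmod (v $ i))\<^sup>2)"
    unfolding N_def of_real_sum by (intro sum.cong refl) (simp add: complex_norm_square mult.commute del: of_real_power)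
  obtain i where i: "i < n" "v $ i \<noteq> 0"
    using v by (metis eq_vecI carrier_vecD index_zero_vec(1) index_zero_vec(2))
  have "(\<Sum>i<n. (cmod (v $ i))\<^sup>2) > 0"
    using i by (intro sum_pos2[of _ i]) auto
  then have N0: "N \<noteq> 0" "cnj N = N" unfolding N by (auto simp: of_real_sum[symmetric] simp del: of_real_sum)
  have "cnj z * N = z * N" using cq unfolding qN by (simp add: N0)
  then have "cnj z = z" using N0 by simp
  then show ?thesis by (simp add: Reals_cnj_iff)
qed

lemma char_poly_symmetric_splits:
  fixes A :: "real mat"
  assumes A: "A \<in> carrier_mat n n" and sym: "\<And>i j. i < n \<Longrightarrow> j < n \<Longrightarrow> A $$ (i, j) = A $$ (j, i)"
  shows "\<exists>es. char_poly A = (\<Prod>e\<leftarrow>es. [:- e, 1:])"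
proof (rule real_poly_splits)
  show "lead_coeff (char_poly A) = 1" using degree_monic_char_poly[OF A] by simp
  fix z assume "poly (map_poly complex_of_real (char_poly A)) z = 0"
  moreover have "char_poly (map_mat complex_of_real A) = map_poly complex_of_real (char_poly A)"
    by (rule of_real_hom.char_poly_hom[OF A])
  ultimately have "poly (char_poly (map_mat complex_of_real A)) z = 0" by simp
  then have "eigenvalue (map_mat complex_of_real A) z"
    using A by (subst eigenvalue_root_char_poly[of _ n]) auto
  then show "z \<in> \<real>" using complex_eigenvalue_symmetric_real[OF A] sym by blast
qed

section \<open>Orthogonal diagonalization of real symmetric matrices by reflections\<close>

lemma sum_kronecker_mult:
  fixes n :: nat
  shows "i < n \<Longrightarrow> (\<Sum>k<n. (if i = k then 1 else 0) * f k) = (f i :: real)"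
    "i < n \<Longrightarrow> (\<Sum>k<n. (if k = i then 1 else 0) * f k) = (f i :: real)"
  by (simp_all add: if_distrib[of "\<lambda>c. c * _"] cong: if_cong)

text \<open>Householder reflection in the hyperplane orthogonal to the difference of
  \<open>v\<close> and the first unit vector. Being symmetric and its own inverse, it preserves
  symmetry and spectrum under conjugation.\<close>

lemma unit_vector_reflection:
  fixes v :: "real vec"
  assumes v: "v \<in> carrier_vec n" and n: "n > 0" and unit: "(\<Sum>i<n. (v $ i)\<^sup>2) = 1"
  obtains H where "H \<in> carrier_mat n n" "H * H = 1\<^sub>m n" "transpose_mat H = H" "H *\<^sub>v v = unit_vec n 0"
proof
  define w where "w i = v $ i - (if 0 = i then 1 else 0)" for i
  define s where "s = (\<Sum>i<n. (w i)\<^sup>2)"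
  \<comment> \<open>If \<open>v\<close> already is the first unit vector, then \<open>s = 0\<close>,
    division by zero gives \<open>c = 0\<close>, and \<open>H\<close> is the identity, as
    desired.\<close>
  define c where "c = 2 / s"
  define H where "H = Matrix.mat n n (\<lambda>(i, j). (if i = j then 1 else 0) - c * w i * w j)"
  show H: "H \<in> carrier_mat n n" unfolding H_def by simp
  have cs: "c * c * s = 2 * c" unfolding c_def by (cases "s = 0") auto
  show "H * H = 1\<^sub>m n"
  proof (rule eq_matI)
    fix i j assume "i < dim_row (1\<^sub>m n)" "j < dim_col (1\<^sub>m n)"
    then have ij: "i < n" "j < n" by auto
    have "(H * H) $$ (i, j) = (\<Sum>k<n. ((if i = k then 1 else 0) - c * w i * w k) * ((if k = j then 1 else 0) - c * w k * w j))"
      using ij by (simp add: H_def scalar_prod_def atLeast0LessThan)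
    also have "\<dots> = (\<Sum>k<n. (if i = k then 1 else 0) * (if k = j then 1 else 0))
       - (\<Sum>k<n. (if i = k then 1 else 0) * (c * w k * w j))
       - (\<Sum>k<n. (if k = j then 1 else 0) * (c * w i * w k)) + c * c * s * w i * w j"
      unfolding s_def sum_distrib_left sum_distrib_right sum_subtractf[symmetric] sum.distrib[symmetric]
      by (intro sum.cong refl) (simp add: algebra_simps power2_eq_square)
    also have "\<dots> = (if i = j then 1 else 0)"
      unfolding cs using ij by (simp add: sum_kronecker_mult)
    finally show "(H * H) $$ (i, j) = 1\<^sub>m n $$ (i, j)" using ij by simp
  qed (use H in auto)
  show "transpose_mat H = H"
    by (rule eq_matI) (auto simp: H_def)
  show "H *\<^sub>v v = unit_vec n 0"
  proof (rule eq_vecI)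
    fix i assume "i < dim_vec (unit_vec n 0 :: real vec)"
    then have i: "i < n" by simp
    have "(\<Sum>k<n. w k * v $ k) = (\<Sum>k<n. (v $ k)\<^sup>2) - (\<Sum>k<n. (if 0 = k then 1 else 0) * v $ k)"
      unfolding sum_subtractf[symmetric]
      by (intro sum.cong refl) (simp add: w_def algebra_simps power2_eq_square)
    then have wv: "(\<Sum>k<n. w k * v $ k) = 1 - v $ 0"
      using n unit by (simp add: sum_kronecker_mult)
    have "s = (\<Sum>k<n. (v $ k)\<^sup>2) + (\<Sum>k<n. (if 0 = k then 1 else 0) * (1 - 2 * v $ k))"
      unfolding s_def sum.distrib[symmetric]
      by (intro sum.cong refl) (simp add: w_def algebra_simps power2_eq_square)
    then have s: "s = 2 * (1 - v $ 0)"
      using n unit by (subst (asm) sum_kronecker_mult) auto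
    have cw: "c * (1 - v $ 0) * w i = w i"
    proof (cases "s = 0")
      case True
      then have "\<forall>i<n. w i = 0" unfolding s_def by (subst (asm) sum_nonneg_eq_0_iff) auto
      then show ?thesis using i by simp
    qed (simp add: c_def s)
    have "(H *\<^sub>v v) $ i = (\<Sum>k<n. ((if i = k then 1 else 0) - c * w i * w k) * v $ k)"
      using i v by (simp add: H_def scalar_prod_def atLeast0LessThan)
    also have "\<dots> = (\<Sum>k<n. (if i = k then 1 else 0) * v $ k) - c * w i * (\<Sum>k<n. w k * v $ k)"
      unfolding sum_distrib_left sum_subtractf[symmetric]
      by (intro sum.cong refl) (simp add: algebra_simps)
    also have "\<dots> = v $ i - c * (1 - v $ 0) * w i"
      using i unfolding wv by (simp only: sum_kronecker_mult) (simp add: ac_simps)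
    also have "\<dots> = v $ i - w i" unfolding cw ..
    finally show "(H *\<^sub>v v) $ i = unit_vec n 0 $ i" using i by (auto simp: w_def)
  qed (use H in auto)
qed

text \<open>Deflation: a reflection that moves an eigenvector for the head of the list to the first
  unit vector clears the first column, hence by symmetry the first row. The remaining block is
  symmetric and its characteristic polynomial has one factor less. The eigenvectors come out in the
  order of the given list, so that a sorted list yields sorted eigenvectors.\<close>

lemma symmetric_diagonalization:
  fixes A :: "real mat"
  assumes "A \<in> carrier_mat n n" and "transpose_mat A = A"
    and "char_poly A = (\<Prod>e\<leftarrow>es. [:- e, 1:])"
  shows "length es = n \<and> (\<exists>W \<in> carrier_mat n n. transpose_mat W * W = 1\<^sub>m n \<and>
    A * W = W * Matrix.mat n n (\<lambda>(i, j). if i = j then es ! i else 0))"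
  using assms
proof (induction es arbitrary: n A)
  case Nil
  then have "n = 0" using degree_monic_char_poly[of A n] by simp
  then show ?case using Nil by (intro conjI bexI[of _ "1\<^sub>m 0"]) auto
next
  case (Cons e es n A)
  note A = Cons.prems(1) and sym = Cons.prems(2)
  have ev: "eigenvalue A e" unfolding eigenvalue_root_char_poly[OF A] Cons.prems(3) by simp
  then obtain v0 where v0: "v0 \<in> carrier_vec n" "v0 \<noteq> 0\<^sub>v n" and Av0: "A *\<^sub>v v0 = e \<cdot>\<^sub>v v0"
    using A unfolding eigenvalue_def eigenvector_def by auto
  obtain m where n: "n = Suc m" using eigenvalue_imp_nonzero_dim[OF A ev] by (cases n) auto
  define N where "N = sqrt (\<Sum>i<n. (v0 $ i)\<^sup>2)"
  obtain i where i: "i < n" "v0 $ i \<noteq> 0"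
    using v0 by (metis eq_vecI carrier_vecD index_zero_vec(1) index_zero_vec(2))
  then have "(\<Sum>i<n. (v0 $ i)\<^sup>2) > 0" by (intro sum_pos2[of _ i]) auto
  then have N: "N \<noteq> 0" "N\<^sup>2 = (\<Sum>i<n. (v0 $ i)\<^sup>2)" unfolding N_def by (auto simp: sum_nonneg)
  define v where "v = (1 / N) \<cdot>\<^sub>v v0"
  have v: "v \<in> carrier_vec n" unfolding v_def using v0 by simp
  have "(\<Sum>i<n. (v $ i)\<^sup>2) = (\<Sum>i<n. (v0 $ i)\<^sup>2) / N\<^sup>2"
    unfolding sum_divide_distrib using v0 by (intro sum.cong) (auto simp: v_def power_divide)
  then have unit: "(\<Sum>i<n. (v $ i)\<^sup>2) = 1"
    using N(1) unfolding N(2)[symmetric] by simp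
  have Av: "A *\<^sub>v v = e \<cdot>\<^sub>v v"
    unfolding v_def using Av0 A v0 by (simp add: mult_mat_vec smult_smult_assoc mult.commute)
  obtain H where H: "H \<in> carrier_mat n n" and HH: "H * H = 1\<^sub>m n" and Ht: "transpose_mat H = H"
    and Hv: "H *\<^sub>v v = unit_vec n 0"
    using unit_vector_reflection[OF v _ unit] n by auto
  define A' where "A' = H * A * H"
  have A': "A' \<in> carrier_mat n n" unfolding A'_def using H A by simp
  have A't: "transpose_mat A' = A'"
    unfolding A'_def using H A by (simp add: transpose_mult[of _ n n _ n] Ht sym assoc_mult_mat[of _ n n _ n _ n])
  have "v = (H * H) *\<^sub>v v" unfolding HH using v by simp
  also have "\<dots> = H *\<^sub>v unit_vec n 0" using H v by (simp add: assoc_mult_mat_vec[of _ n n _ n] Hv)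
  finally have He: "H *\<^sub>v unit_vec n 0 = v" ..
  have "A' *\<^sub>v unit_vec n 0 = H *\<^sub>v (A *\<^sub>v (H *\<^sub>v unit_vec n 0))"
    unfolding A'_def using H A by (simp add: assoc_mult_mat_vec[of _ n n _ n])
  also have "\<dots> = e \<cdot>\<^sub>v unit_vec n 0" unfolding He Av using H v by (simp add: mult_mat_vec Hv)
  finally have A'e: "A' *\<^sub>v unit_vec n 0 = e \<cdot>\<^sub>v unit_vec n 0" .
  have col0: "A' $$ (i, 0) = (if i = 0 then e else 0)" if "i < n" for i
  proof -
    have "(A' *\<^sub>v unit_vec n 0) $ i = A' $$ (i, 0)" using that A' by simp
    then show ?thesis using that n unfolding A'e by (cases "i = 0") auto
  qed
  have row0: "A' $$ (0, j) = (if j = 0 then e else 0)" if "j < n" for j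
    using arg_cong[OF A't, of "\<lambda>B. B $$ (0, j)"] col0[OF that] that A' n by auto
  define A3 where "A3 = Matrix.mat m m (\<lambda>(i, j). A' $$ (Suc i, Suc j))"
  let ?E = "Matrix.mat 1 1 (\<lambda>_. e)"
  have A3: "A3 \<in> carrier_mat m m" unfolding A3_def by simp
  have block: "A' = four_block_mat ?E (0\<^sub>m 1 m) (0\<^sub>m m 1) A3"
    by (rule eq_matI) (use A' n col0 row0 in \<open>auto simp: A3_def four_block_mat_def Let_def\<close>)
  have A3t: "transpose_mat A3 = A3"
  proof (rule eq_matI)
    fix i j assume "i < dim_row A3" "j < dim_col A3"
    then show "transpose_mat A3 $$ (i, j) = A3 $$ (i, j)"
      using arg_cong[OF A't, of "\<lambda>B. B $$ (Suc i, Suc j)"] A' n by (auto simp: A3_def)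
  qed (use A3 in auto)
  have "similar_mat_wit A' A H H"
    by (rule similar_mat_witI[OF HH HH _ A' A H H]) (simp add: A'_def)
  then have "char_poly A' = char_poly A" using char_poly_similar unfolding similar_mat_def by blast
  also have "char_poly A' = char_poly ?E * char_poly A3"
    unfolding block by (rule char_poly_four_block_zeros_col) (use A3 in auto)
  also have "char_poly ?E = [:- e, 1:]"
    by (simp add: char_poly_defs Determinant.det_def sign_def)
  finally have "char_poly A3 = (\<Prod>e\<leftarrow>es. [:- e, 1:])"
    unfolding Cons.prems(3) list.map prod_list.Cons by (simp only: mult_cancel_left) auto
  from Cons.IH[OF A3 A3t this] obtain W where len: "length es = m" and W: "W \<in> carrier_mat m m"
    and WW: "transpose_mat W * W = 1\<^sub>m m"
    and AW: "A3 * W = W * Matrix.mat m m (\<lambda>(i, j). if i = j then es ! i else 0)"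
    by auto
  let ?D3 = "Matrix.mat m m (\<lambda>(i, j). if i = j then es ! i else 0)"
  let ?D = "Matrix.mat n n (\<lambda>(i, j). if i = j then (e # es) ! i else 0)"
  define F where "F = four_block_mat (1\<^sub>m 1) (0\<^sub>m 1 m) (0\<^sub>m m 1) W"
  have F: "F \<in> carrier_mat n n" unfolding F_def n using four_block_carrier_mat[OF one_carrier_mat[of 1] W] by simp
  have D: "?D = four_block_mat ?E (0\<^sub>m 1 m) (0\<^sub>m m 1) ?D3"
    by (rule eq_matI) (use n in \<open>auto simp: four_block_mat_def Let_def nth_Cons split: nat.splits\<close>)
  have Dc: "?D \<in> carrier_mat n n" by simp
  have "transpose_mat F * F = four_block_mat (1\<^sub>m 1) (0\<^sub>m 1 m) (0\<^sub>m m 1) (transpose_mat W * W)"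
    unfolding F_def using W
    by (subst transpose_four_block_mat[of _ 1 1 _ m _ m]) (auto simp: mult_four_block_mat[of _ 1 1 _ m _ m _ _ 1 _ m])
  also have "\<dots> = 1\<^sub>m n" unfolding WW n by (rule eq_matI) auto
  finally have FF: "transpose_mat F * F = 1\<^sub>m n" .
  have "A' * F = four_block_mat ?E (0\<^sub>m 1 m) (0\<^sub>m m 1) (A3 * W)"
    unfolding F_def block using W A3 by (subst mult_four_block_mat[of _ 1 1 _ m _ m _ _ 1 _ m]) auto
  also have "\<dots> = F * ?D"
    unfolding F_def D AW using W A3 by (subst mult_four_block_mat[of _ 1 1 _ m _ m _ _ 1 _ m]) auto
  finally have AF: "A' * F = F * ?D" .
  define U where "U = H * F"
  have U: "U \<in> carrier_mat n n" unfolding U_def using H F by simp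
  have "transpose_mat U * U = transpose_mat F * (H * H) * F"
    unfolding U_def using H F by (simp add: transpose_mult[of _ n n _ n] Ht assoc_mult_mat[of _ n n _ n _ n])
  then have UU: "transpose_mat U * U = 1\<^sub>m n" unfolding HH using F FF by simp
  have "A * U = (H * H) * A * U" unfolding HH using A by simp
  also have "\<dots> = H * (A' * F)"
    unfolding U_def A'_def using H A F by (simp add: assoc_mult_mat[of _ n n _ n _ n])
  also have "\<dots> = U * ?D" unfolding AF U_def using H F by (simp add: assoc_mult_mat[of _ n n _ n _ n])
  finally have "A * U = U * ?D" .
  then show ?case using U UU len n by auto
qed

text \<open>This links the list that defines \<open>laplacian_eigenvalue\<close> to an orthonormal
  eigenbasis numbered in the same way. The second family of relations is completeness of the
  basis.\<close>

lemma sorted_proots_char_poly_symmetric: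
  fixes A :: "real mat"
  assumes A: "A \<in> carrier_mat n n" and sym: "transpose_mat A = A"
  defines "es \<equiv> sorted_list_of_multiset (proots (char_poly A))"
  obtains w :: "nat \<Rightarrow> nat \<Rightarrow> real" where
    "length es = n" "sorted es"
    "\<And>a b. a < n \<Longrightarrow> b < n \<Longrightarrow> (\<Sum>j<n. w a j * w b j) = (if a = b then 1 else 0)"
    "\<And>i j. i < n \<Longrightarrow> j < n \<Longrightarrow> (\<Sum>a<n. w a i * w a j) = (if i = j then 1 else 0)"
    "\<And>a i. a < n \<Longrightarrow> i < n \<Longrightarrow> (\<Sum>j<n. A $$ (i, j) * w a j) = es ! a * w a i"
proof -
  have "A $$ (i, j) = A $$ (j, i)" if "i < n" "j < n" for i j
    using arg_cong[OF sym, of "\<lambda>B. B $$ (i, j)"] A that by auto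
  from char_poly_symmetric_splits[OF A this] obtain fs
    where fs: "char_poly A = (\<Prod>e\<leftarrow>fs. [:- e, 1:])" by blast
  have pr: "proots (\<Prod>e\<leftarrow>gs. [:- e, 1:]) = mset gs" for gs :: "real list"
  proof (induction gs)
    case (Cons g gs)
    have "(\<Prod>e\<leftarrow>gs. [:- e, 1:]) \<noteq> 0" by (auto simp: prod_list_zero_iff)
    then show ?case using Cons by (simp add: proots_mult del: mult_pCons_left)
  qed simp
  have ms: "mset es = mset fs" unfolding es_def fs pr by (simp)
  have "char_poly A = (\<Prod>e\<leftarrow>es. [:- e, 1:])"
    unfolding fs prod_mset_prod_list[symmetric] mset_map ms ..
  from symmetric_diagonalization[OF A sym this] obtain W where len: "length es = n"
    and W: "W \<in> carrier_mat n n" and WW: "transpose_mat W * W = 1\<^sub>m n"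
    and AW: "A * W = W * Matrix.mat n n (\<lambda>(i, j). if i = j then es ! i else 0)"
    by auto
  \<comment> \<open>For square matrices a left inverse is a right inverse; this turns orthonormality
    into completeness.\<close>
  have WW': "W * transpose_mat W = 1\<^sub>m n"
    by (rule mat_mult_left_right_inverse[OF _ W WW]) (use W in simp)
  show ?thesis
  proof (rule that[of "\<lambda>a j. W $$ (j, a)"])
    show "length es = n" by (rule len)
    show "sorted es" unfolding es_def by simp
    show "(\<Sum>j<n. W $$ (j, a) * W $$ (j, b)) = (if a = b then 1 else 0)" if "a < n" "b < n" for a b
      using arg_cong[OF WW, of "\<lambda>B. B $$ (a, b)"] W that by (simp add: scalar_prod_def atLeast0LessThan)
    show "(\<Sum>a<n. W $$ (i, a) * W $$ (j, a)) = (if i = j then 1 else 0)" if "i < n" "j < n" for i j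
      using arg_cong[OF WW', of "\<lambda>B. B $$ (i, j)"] W that by (simp add: scalar_prod_def atLeast0LessThan)
    show "(\<Sum>j<n. A $$ (i, j) * W $$ (j, a)) = es ! a * W $$ (i, a)" if "a < n" "i < n" for a i
      using arg_cong[OF AW, of "\<lambda>B. B $$ (i, a)"] W A that
      by (simp add: scalar_prod_def atLeast0LessThan if_distrib[of "\<lambda>c. _ * c"] cong: if_cong)
  qed
qed

text \<open>There are \<open>m\<close> equations for \<open>m + 1\<close> unknowns. An additional
  zero row makes the matrix square and singular, and a kernel vector is normalized. In the
  Courant-Fischer argument this produces a trial vector orthogonal to the first \<open>m\<close>
  eigenvectors.\<close>

lemma homogeneous_system_nontrivial:
  fixes a :: "nat \<Rightarrow> nat \<Rightarrow> real"
  obtains c where "(\<Sum>j\<le>m. (c j)\<^sup>2) = 1" "\<And>i. i < m \<Longrightarrow> (\<Sum>j\<le>m. a i j * c j) = 0"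
proof -
  define M where "M = Matrix.mat (Suc m) (Suc m) (\<lambda>(i, j). if i = m then 0 else a i j)"
  have M: "M \<in> carrier_mat (Suc m) (Suc m)" unfolding M_def by simp
  have "M = mat\<^sub>r (Suc m) (Suc m) (\<lambda>i. if i = m then 0\<^sub>v (Suc m) else Matrix.vec (Suc m) (a i))"
    by (rule eq_matI) (auto simp: M_def)
  then have "Determinant.det M = 0" by (simp add: det_row_0)
  then obtain v where v: "v \<in> carrier_vec (Suc m)" "v \<noteq> 0\<^sub>v (Suc m)" and Mv: "M *\<^sub>v v = 0\<^sub>v (Suc m)"
    using det_0_iff_vec_prod_zero_field[OF M] by blast
  define N where "N = sqrt (\<Sum>i\<le>m. (v $ i)\<^sup>2)"
  obtain i where i: "i < Suc m" "v $ i \<noteq> 0"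
    using v by (metis eq_vecI carrier_vecD index_zero_vec(1) index_zero_vec(2))
  then have "(\<Sum>i\<le>m. (v $ i)\<^sup>2) > 0" by (intro sum_pos2[of _ i]) auto
  then have N: "N \<noteq> 0" "N\<^sup>2 = (\<Sum>i\<le>m. (v $ i)\<^sup>2)" unfolding N_def by (auto simp: sum_nonneg)
  show ?thesis
  proof (rule that[of "\<lambda>j. v $ j / N"])
    show "(\<Sum>j\<le>m. (v $ j / N)\<^sup>2) = 1"
      using N(1) by (simp add: power_divide N(2)[symmetric] flip: sum_divide_distrib)
    show "(\<Sum>j\<le>m. a i j * (v $ j / N)) = 0" if "i < m" for i
    proof -
      have "(M *\<^sub>v v) $ i = (\<Sum>j\<le>m. a i j * v $ j)"
        using that v by (simp add: M_def scalar_prod_def atLeast0LessThan lessThan_Suc_atMost)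
      then show ?thesis using that unfolding Mv by (simp flip: sum_divide_distrib)
    qed
  qed
qed

section \<open>Almost sure equidistribution of the sample\<close>

text \<open>Indicators take values in [0,1], so Hoeffding's inequality bounds the probability of a
  deviation by \<open>e\<close> geometrically in \<open>n\<close>. These bounds are summable, and
  Borel-Cantelli applies for each of the countably many tolerances \<open>1 / Suc k\<close>.\<close>

lemma (in prob_space) strong_law_indicator:
  assumes indep: "indep_vars (\<lambda>_. borel) X UNIV"
    and distr: "\<And>i::nat. distr M borel (X i) = \<mu>" and A: "A \<in> sets borel"
  shows "AE \<omega> in M. (\<lambda>n. (\<Sum>i<n. indicator A (X i \<omega>)) / real n) \<longlonglongrightarrow> measure \<mu> A"
proof -
  have X [measurable]: "X i \<in> borel_measurable M" for i
    using indep unfolding indep_vars_def by auto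
  note A [measurable]
  define Z where "Z i \<omega> = (indicator A (X i \<omega>) :: real)" for i \<omega>
  have Zm [measurable]: "Z i \<in> borel_measurable M" for i unfolding Z_def by measurable
  have indepZ: "indep_vars (\<lambda>_. borel) Z UNIV"
    using indep_vars_compose[OF indep, of "\<lambda>_ y. indicator A y :: real" "\<lambda>_. borel"]
    by (simp add: Z_def[abs_def] comp_def)
  have distrZ: "distr M borel (Z i) = distr M borel (Z 0)" for i
  proof -
    have "distr M borel (Z j) = distr \<mu> borel (indicator A :: _ \<Rightarrow> real)" for j
      unfolding distr[of j, symmetric] by (subst distr_distr) (auto simp: Z_def[abs_def] comp_def)
    then show ?thesis by simp
  qed
  have EZ: "expectation (Z 0) = measure \<mu> A"
  proof -
    have "measure \<mu> A = measure M (X 0 -` A \<inter> space M)"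
      unfolding distr[of 0, symmetric] by (subst measure_distr) auto
    also have "\<dots> = expectation (indicator (X 0 -` A \<inter> space M))" by simp
    also have "\<dots> = expectation (Z 0)"
      by (intro Bochner_Integration.integral_cong) (auto simp: Z_def indicator_def)
    finally show ?thesis ..
  qed
  define S where "S n \<omega> = (\<Sum>i<n. Z i \<omega>) / real n" for n \<omega>
  have Sm [measurable]: "S n \<in> borel_measurable M" for n unfolding S_def by measurable
  define B where "B e n = {\<omega> \<in> space M. \<bar>S n \<omega> - measure \<mu> A\<bar> \<ge> e}" for e n
  have Bm [measurable]: "B e n \<in> sets M" for e n unfolding B_def by measurable
  have ev: "AE \<omega> in M. eventually (\<lambda>n. \<omega> \<in> space M - B e n) sequentially" if e: "e > 0" for e :: real
  proof (rule borel_cantelli_AE1)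
    have le: "prob (B e n) \<le> 2 * exp (- 2 * e\<^sup>2) ^ n" if n: "n > 0" for n
    proof -
      interpret H: Hoeffding_ineq_iid M "{..<n}" Z "Z 0" 0 1 "measure \<mu> A"
      proof (unfold_locales)
        show "indep_vars (\<lambda>_. borel) Z {..<n}" using indep_vars_subset[OF indepZ] by auto
        show "distr M borel (Z i) = distr M borel (Z 0)" for i by (rule distrZ)
        show "AE x in M. Z 0 x \<in> {0..1}" by (auto simp: Z_def indicator_def)
        show "measure \<mu> A \<equiv> expectation (Z 0)" using EZ by simp
      qed (auto)
      have "prob (B e n) \<le> 2 * exp (- 2 * real (card {..<n}) * e\<^sup>2 / (1 - 0)\<^sup>2)"
        unfolding B_def S_def using H.Hoeffding_ineq_abs_ge'[of e] e n by auto
      also have "- 2 * real (card {..<n}) * e\<^sup>2 / (1 - 0)\<^sup>2 = real n * (- 2 * e\<^sup>2)" by simp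
      finally show ?thesis unfolding exp_of_nat_mult .
    qed
    show "summable (\<lambda>n. prob (B e n))"
    proof (rule summable_comparison_test_ev)
      show "eventually (\<lambda>n. norm (prob (B e n)) \<le> 2 * exp (- 2 * e\<^sup>2) ^ n) sequentially"
        using eventually_gt_at_top[of 0] by eventually_elim (use le in simp)
      show "summable (\<lambda>n. 2 * exp (- 2 * e\<^sup>2) ^ n)"
        using e by (intro summable_mult summable_geometric) auto
    qed
  qed (auto simp: less_top[symmetric])
  have "AE \<omega> in M. \<forall>k. eventually (\<lambda>n. \<omega> \<in> space M - B (1 / Suc k) n) sequentially"
    unfolding AE_all_countable using ev by auto
  then show ?thesis
  proof (eventually_elim)
    case (elim \<omega>)
    show ?case
    proof (rule tendstoI)
      fix e :: real assume "e > 0"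
      then obtain k where "1 / Suc k < e" using nat_approx_posE by blast
      then show "eventually (\<lambda>n. dist ((\<Sum>i<n. indicator A (X i \<omega>)) / real n) (measure \<mu> A) < e) sequentially"
        using elim[rule_format, of k]
        by (auto simp: B_def S_def Z_def dist_real_def elim!: eventually_mono)
    qed
  qed
qed

text \<open>Weak convergence of the empirical measures, as a property of a single point sequence. It
  separates the probabilistic part from the analysis, which is carried out for one fixed
  realization.\<close>

definition equidistributed :: "(nat \<Rightarrow> 'a::topological_space) \<Rightarrow> 'a measure \<Rightarrow> bool" where
  "equidistributed x \<mu> \<longleftrightarrow> (\<forall>\<phi>. continuous_on UNIV \<phi> \<longrightarrow>
     (\<lambda>n. (\<Sum>j<n. \<phi> (x j)) / real n) \<longlonglongrightarrow> (\<integral>y. (\<phi> y :: real) \<partial>\<mu>))"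

lemma abs_average_diff_le:
  fixes f g :: "nat \<Rightarrow> real"
  assumes "\<And>j. j < n \<Longrightarrow> \<bar>f j - g j\<bar> \<le> e" "e \<ge> 0"
  shows "\<bar>(\<Sum>j<n. f j) / real n - (\<Sum>j<n. g j) / real n\<bar> \<le> e"
proof (cases "n = 0")
  case False
  have "\<bar>(\<Sum>j<n. f j) - (\<Sum>j<n. g j)\<bar> \<le> (\<Sum>j<n. \<bar>f j - g j\<bar>)"
    unfolding sum_subtractf[symmetric] by (rule sum_abs)
  also have "\<dots> \<le> real n * e" using sum_bounded_above[of "{..<n}" "\<lambda>j. \<bar>f j - g j\<bar>" e] assms by simp
  finally show ?thesis
    using False by (simp add: abs_divide pos_divide_le_eq mult.commute flip: diff_divide_distrib)
qed (use assms in auto)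

lemma compact_bounded_real:
  fixes \<phi> :: "'a::topological_space \<Rightarrow> real"
  assumes "compact (UNIV :: 'a set)" "continuous_on UNIV \<phi>"
  obtains B where "B > 0" "\<And>y. \<bar>\<phi> y\<bar> \<le> B"
proof -
  have "bounded (range \<phi>)" using compact_continuous_image[OF assms(2,1)] compact_imp_bounded by blast
  then show ?thesis using that unfolding bounded_pos by auto
qed

lemma compact_integrable:
  fixes \<phi> :: "'a::topological_space \<Rightarrow> real"
  assumes "compact (UNIV :: 'a set)" "continuous_on UNIV \<phi>" "finite_measure \<mu>" "sets \<mu> = sets borel"
  shows "integrable \<mu> \<phi>"
proof -
  interpret finite_measure \<mu> by fact
  obtain B where "B > 0" "\<And>y. \<bar>\<phi> y\<bar> \<le> B" using compact_bounded_real[OF assms(1,2)] by blast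
  moreover have "\<phi> \<in> borel_measurable \<mu>"
    using borel_measurable_continuous_onI[OF assms(2)] assms(4) measurable_cong_sets by blast
  ultimately show ?thesis by (intro integrable_const_bound[of _ B]) auto
qed

text \<open>
  The sets \<open>U - \<Union>F\<close> arise from making a finite cover by basic open sets disjoint. There are
  countably many of them, so that the strong law can be applied to all of them simultaneously.
\<close>

lemma equidistributedI_basis:
  fixes x :: "nat \<Rightarrow> 'a::topological_space"
  assumes cpt: "compact (UNIV :: 'a set)" and \<mu>: "prob_space \<mu>" "sets \<mu> = sets borel"
    and basis: "topological_basis B"
    and lim: "\<And>U F. U \<in> B \<Longrightarrow> F \<subseteq> B \<Longrightarrow> finite F \<Longrightarrow>
      (\<lambda>n. (\<Sum>j<n. indicator (U - \<Union>F) (x j)) / real n) \<longlonglongrightarrow> measure \<mu> (U - \<Union>F)"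
  shows "equidistributed x \<mu>"
  unfolding equidistributed_def
proof (intro allI impI)
  interpret \<mu>: prob_space \<mu> by fact
  fix \<phi> :: "'a \<Rightarrow> real" assume cont: "continuous_on UNIV \<phi>"
  show "(\<lambda>n. (\<Sum>j<n. \<phi> (x j)) / real n) \<longlonglongrightarrow> (\<integral>y. \<phi> y \<partial>\<mu>)"
  proof (rule tendstoI)
    fix e :: real assume "e > 0"
    \<comment> \<open>Replacing \<open>\<phi>\<close> by a step function costs at most
      \<open>d\<close> in the average and in the integral, and the averages of the step function are
      off by less than \<open>d\<close>; altogether this stays below \<open>e\<close>.\<close>
    define d where "d = e / 4"
    have d: "d > 0" unfolding d_def using \<open>e > 0\<close> by simp
    have "\<exists>U\<in>B. y \<in> U \<and> (\<forall>z\<in>U. \<bar>\<phi> z - \<phi> y\<bar> < d)" for y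
    proof -
      have "open (\<phi> -` ball (\<phi> y) d)" using cont by (simp add: open_vimage continuous_on_eq_continuous_at)
      then obtain U where "U \<in> B" "y \<in> U" "U \<subseteq> \<phi> -` ball (\<phi> y) d"
        using topological_basisE[OF basis, of "\<phi> -` ball (\<phi> y) d" y] d by auto
      then show ?thesis by (intro bexI[of _ U]) (auto simp: dist_real_def abs_minus_commute)
    qed
    then obtain U where U: "\<And>y. U y \<in> B" "\<And>y. y \<in> U y" "\<And>y z. z \<in> U y \<Longrightarrow> \<bar>\<phi> z - \<phi> y\<bar> < d"
      by metis
    have op: "open (U y)" for y using topological_basis_open[OF basis U(1)] .
    obtain Y where Y: "finite Y" "UNIV \<subseteq> (\<Union>y\<in>Y. U y)"
    proof (rule compactE_image[OF cpt, of UNIV U])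
      show "UNIV \<subseteq> \<Union> (range U)" using U(2) by blast
    qed (use op in auto)
    obtain g :: "nat \<Rightarrow> 'a" and m where g: "Y = g ` {..<m}"
      using finite_imp_nat_seg_image_inj_on[OF Y(1)] unfolding lessThan_def by blast
    define A where "A i = U (g i) - \<Union> (U ` g ` {..<i})" for i
    define \<psi> where "\<psi> z = (\<Sum>i<m. \<phi> (g i) * indicator (A i) z)" for z
    have \<psi>: "\<bar>\<phi> z - \<psi> z\<bar> \<le> d" for z
    proof -
      \<comment> \<open>The cells \<open>A i\<close> are disjoint, and the one containing
        \<open>z\<close> belongs to the first neighbourhood of the cover that contains
        \<open>z\<close>.\<close>
      define i where "i = (LEAST i. z \<in> U (g i))"
      obtain i0 where i0: "i0 < m" "z \<in> U (g i0)" using Y(2) unfolding g by auto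
      have i: "z \<in> U (g i)" "i < m" "\<And>j. j < i \<Longrightarrow> z \<notin> U (g j)"
        unfolding i_def using i0 by (auto intro: LeastI Least_le order.strict_trans1 dest: not_less_Least)
      have "indicator (A j) z = (if j = i then 1 else 0 :: real)" if "j < m" for j
        using i by (cases j i rule: linorder_cases) (auto simp: A_def indicator_def)
      then have "\<psi> z = \<phi> (g i)" unfolding \<psi>_def using i by (simp add: if_distrib[of "\<lambda>c. _ * c"] cong: if_cong)
      then show ?thesis using U(3)[OF i(1)] by simp
    qed
    have Am: "A i \<in> sets \<mu>" for i unfolding A_def \<mu>(2) using op by auto
    have "(\<lambda>n. (\<Sum>i<m. \<phi> (g i) * ((\<Sum>j<n. indicator (A i) (x j)) / real n))) \<longlonglongrightarrow> (\<Sum>i<m. \<phi> (g i) * measure \<mu> (A i))"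
      unfolding A_def using U(1) by (intro tendsto_intros lim) auto
    also have "(\<lambda>n. (\<Sum>i<m. \<phi> (g i) * ((\<Sum>j<n. indicator (A i) (x j)) / real n))) = (\<lambda>n. (\<Sum>j<n. \<psi> (x j)) / real n)"
      unfolding \<psi>_def sum_distrib_left sum_divide_distrib times_divide_eq_right
      by (rule ext, rule sum.swap)
    also have "(\<Sum>i<m. \<phi> (g i) * measure \<mu> (A i)) = (\<integral>y. \<psi> y \<partial>\<mu>)"
      unfolding \<psi>_def using Am by (subst Bochner_Integration.integral_sum) (auto simp: less_top[symmetric])
    finally have "eventually (\<lambda>n. dist ((\<Sum>j<n. \<psi> (x j)) / real n) (\<integral>y. \<psi> y \<partial>\<mu>) < d) sequentially"
      using d by (rule tendstoD)
    moreover have "\<bar>(\<integral>y. \<phi> y \<partial>\<mu>) - (\<integral>y. \<psi> y \<partial>\<mu>)\<bar> \<le> d"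
    proof -
      have i: "integrable \<mu> \<phi>" by (rule compact_integrable[OF cpt cont _ \<mu>(2)]) unfold_locales
      have "integrable \<mu> \<psi>" unfolding \<psi>_def
        using Am by (intro Bochner_Integration.integrable_sum integrable_mult_right integrable_real_indicator)
          (auto simp: less_top[symmetric])
      then have "(\<integral>y. \<phi> y \<partial>\<mu>) - (\<integral>y. \<psi> y \<partial>\<mu>) = (\<integral>y. \<phi> y - \<psi> y \<partial>\<mu>)" using i by simp
      also have "\<bar>\<dots>\<bar> \<le> (\<integral>y. \<bar>\<phi> y - \<psi> y\<bar> \<partial>\<mu>)" by (rule integral_abs_bound)
      also have "\<dots> \<le> (\<integral>y. d \<partial>\<mu>)"
        using i \<open>integrable \<mu> \<psi>\<close> \<psi> by (intro integral_mono) auto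
      finally show ?thesis by (simp add: \<mu>.prob_space)
    qed
    ultimately show "eventually (\<lambda>n. dist ((\<Sum>j<n. \<phi> (x j)) / real n) (\<integral>y. \<phi> y \<partial>\<mu>) < e) sequentially"
    proof (elim eventually_mono)
      fix n assume a: "dist ((\<Sum>j<n. \<psi> (x j)) / real n) (\<integral>y. \<psi> y \<partial>\<mu>) < d"
      have "\<bar>(\<Sum>j<n. \<phi> (x j)) / real n - (\<Sum>j<n. \<psi> (x j)) / real n\<bar> \<le> d"
        using \<psi> d by (intro abs_average_diff_le) auto
      then show "dist ((\<Sum>j<n. \<phi> (x j)) / real n) (\<integral>y. \<phi> y \<partial>\<mu>) < e"
        using a \<open>\<bar>(\<integral>y. \<phi> y \<partial>\<mu>) - (\<integral>y. \<psi> y \<partial>\<mu>)\<bar> \<le> d\<close> d unfolding dist_real_def d_def by linarith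
    qed
  qed
qed

lemma (in prob_space) AE_equidistributed:
  fixes X :: "nat \<Rightarrow> 'a \<Rightarrow> 'm::second_countable_topology"
  assumes cpt: "compact (UNIV :: 'm set)"
    and indep: "indep_vars (\<lambda>_. borel) X UNIV" and distr: "\<And>i. distr M borel (X i) = \<mu>"
  shows "AE \<omega> in M. equidistributed (\<lambda>i. X i \<omega>) \<mu>"
proof -
  obtain B :: "'m set set" where B: "countable B" "topological_basis B"
    using ex_countable_basis by blast
  have op: "open U" if "U \<in> B" for U using topological_basis_open[OF B(2) that] .
  define \<A> where "\<A> = (\<lambda>(U, F). U - \<Union>F) ` (B \<times> {F. finite F \<and> F \<subseteq> B})"
  have "countable {F. finite F \<and> F \<subseteq> B}" by (rule countable_Collect_finite_subset[OF B(1)])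
  then have "countable (B \<times> {F. finite F \<and> F \<subseteq> B})" using B(1) by (rule countable_SIGMA[rotated])
  then have "countable \<A>" unfolding \<A>_def by (rule countable_image)
  moreover have "A \<in> sets borel" if "A \<in> \<A>" for A
  proof -
    from that obtain U F where "A = U - \<Union>F" "U \<in> B" "F \<subseteq> B" unfolding \<A>_def by auto
    moreover have "open (\<Union>F)" using \<open>F \<subseteq> B\<close> op by (intro open_Union) auto
    ultimately show ?thesis using op by (auto intro: sets.Diff borel_open)
  qed
  ultimately have lim: "AE \<omega> in M. \<forall>A\<in>\<A>. (\<lambda>n. (\<Sum>i<n. indicator A (X i \<omega>)) / real n) \<longlonglongrightarrow> measure \<mu> A"
    using strong_law_indicator[OF indep distr] by (subst AE_ball_countable) auto
  have X: "X i \<in> borel_measurable M" for i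
    using indep unfolding indep_vars_def by auto
  have \<mu>: "prob_space \<mu>" "sets \<mu> = sets borel"
    unfolding distr[of 0, symmetric] using X by (auto intro: prob_space_distr)
  show ?thesis using lim
  proof eventually_elim
    case (elim \<omega>)
    show ?case
    proof (rule equidistributedI_basis[OF cpt \<mu> B(2)])
      fix U F assume "U \<in> B" "F \<subseteq> B" "finite F"
      then have "U - \<Union>F \<in> \<A>" unfolding \<A>_def by (intro image_eqI[of _ _ "(U, F)"]) auto
      with elim show "(\<lambda>n. (\<Sum>j<n. indicator (U - \<Union>F) (X j \<omega>)) / real n) \<longlonglongrightarrow> measure \<mu> (U - \<Union>F)"
        by blast
    qed
  qed
qed

section \<open>Subsequences and equicontinuity\<close>

text \<open>Refine once for each index; stability keeps what was achieved for the earlier indices.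
  Since there are finitely many of them, no diagonal sequence is required.\<close>

lemma common_subsequence:
  fixes k :: nat and P :: "nat \<Rightarrow> (nat \<Rightarrow> nat) \<Rightarrow> bool"
  assumes ex: "\<And>i s. i < k \<Longrightarrow> strict_mono (s :: nat \<Rightarrow> nat) \<Longrightarrow> \<exists>r. strict_mono r \<and> P i (s \<circ> r)"
    and stable: "\<And>i s r. strict_mono (s :: nat \<Rightarrow> nat) \<Longrightarrow> strict_mono (r :: nat \<Rightarrow> nat) \<Longrightarrow> P i s \<Longrightarrow> P i (s \<circ> r)"
    and s: "strict_mono (s :: nat \<Rightarrow> nat)"
  shows "\<exists>r. strict_mono r \<and> (\<forall>i<k. P i (s \<circ> r))"
proof -
  have "\<exists>r. strict_mono r \<and> (\<forall>i<m. P i (s \<circ> r))" if "m \<le> k" for m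
    using that
  proof (induction m)
    case 0
    have "strict_mono (id :: nat \<Rightarrow> nat)" by (simp add: strict_mono_def)
    then show ?case by auto
  next
    case (Suc m)
    then obtain r where r: "strict_mono r" "\<forall>i<m. P i (s \<circ> r)" using Suc_leD by blast
    obtain r' where r': "strict_mono r'" "P m (s \<circ> r \<circ> r')"
      using ex[of m "s \<circ> r"] Suc.prems s r(1) by (auto simp: strict_mono_o)
    have "\<forall>i<m. P i (s \<circ> r \<circ> r')"
      using r r'(1) s stable by (blast intro: strict_mono_o)
    then have "\<forall>i<Suc m. P i (s \<circ> r \<circ> r')" using r'(2) less_Suc_eq by auto
    moreover have "strict_mono (r \<circ> r')" using r(1) r'(1) by (rule strict_mono_o)
    ultimately show ?case unfolding comp_assoc by blast
  qed
  then show ?thesis by blast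
qed

lemma bounded_real_subsequence:
  fixes a :: "nat \<Rightarrow> real"
  assumes "\<And>n. \<bar>a n\<bar> \<le> B"
  obtains l r where "strict_mono r" "(a \<circ> r) \<longlonglongrightarrow> l" "\<bar>l\<bar> \<le> B"
proof -
  have "\<forall>n. a n \<in> {-B..B}" using assms by (auto simp: abs_le_iff minus_le_iff)
  from compact_imp_seq_compact[OF compact_Icc] this
  obtain l r where "l \<in> {-B..B}" "strict_mono r" "(a \<circ> r) \<longlonglongrightarrow> l" by (rule seq_compactE)
  then show ?thesis using that by (auto simp: abs_le_iff)
qed

text \<open>Stated with neighbourhoods because the space carries only a topology. The index type is
  arbitrary: below it is the sequence index for averages, but the other argument of the kernel in
  \<open>\<eta>_equicontinuous\<close>.\<close>

definition equicontinuous :: "('i \<Rightarrow> 'a::topological_space \<Rightarrow> real) \<Rightarrow> bool" where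
  "equicontinuous F \<longleftrightarrow>
     (\<forall>x. \<forall>e>0. \<exists>U. open U \<and> x \<in> U \<and> (\<forall>i. \<forall>y\<in>U. \<bar>F i y - F i x\<bar> < e))"

lemma equicontinuous_continuous:
  assumes "equicontinuous F"
  shows "continuous_on UNIV (F i)"
  unfolding continuous_on_topological
proof (intro ballI allI impI)
  fix x and B :: "real set" assume "open B" "F i x \<in> B"
  then obtain e where e: "e > 0" "ball (F i x) e \<subseteq> B" by (meson open_contains_ball)
  then obtain U where "open U" "x \<in> U" "\<forall>i. \<forall>y\<in>U. \<bar>F i y - F i x\<bar> < e"
    using assms unfolding equicontinuous_def by meson
  then have "\<forall>y\<in>U. F i y \<in> B" using e(2) by (auto simp: dist_real_def abs_minus_commute subset_iff)
  then show "\<exists>A. open A \<and> x \<in> A \<and> (\<forall>y\<in>UNIV. y \<in> A \<longrightarrow> F i y \<in> B)"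
    using \<open>open U\<close> \<open>x \<in> U\<close> by blast
qed

text \<open>Finitely many neighbourhoods on which all \<open>F n\<close> vary by less than
  \<open>d\<close> cover the space; the limit varies by at most \<open>d\<close> there. Convergence
  at the finitely many centres then controls all points, with three errors of at most
  \<open>d = e / 4\<close> each.\<close>

lemma equicontinuous_pointwise_imp_uniform:
  fixes F :: "nat \<Rightarrow> 'a::topological_space \<Rightarrow> real"
  assumes cpt: "compact (UNIV :: 'a set)" and eq: "equicontinuous F"
    and lim: "\<And>x. (\<lambda>n. F n x) \<longlonglongrightarrow> g x"
  shows "uniform_limit UNIV F g sequentially" "continuous_on UNIV g"
proof -
  show ul: "uniform_limit UNIV F g sequentially"
  proof (rule uniform_limitI)
    fix e :: real assume "e > 0"
    define d where "d = e / 4"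
    have d: "d > 0" unfolding d_def using \<open>e > 0\<close> by simp
    have "\<exists>U. open U \<and> x \<in> U \<and> (\<forall>i. \<forall>y\<in>U. \<bar>F i y - F i x\<bar> < d)" for x
      using eq d unfolding equicontinuous_def by blast
    then obtain U where U: "\<And>x. open (U x)" "\<And>x. x \<in> U x" "\<And>x i y. y \<in> U x \<Longrightarrow> \<bar>F i y - F i x\<bar> < d"
      by metis
    have gU: "\<bar>g y - g x\<bar> \<le> d" if y: "y \<in> U x" for x y
    proof (rule tendsto_upperbound)
      show "(\<lambda>n. \<bar>F n y - F n x\<bar>) \<longlonglongrightarrow> \<bar>g y - g x\<bar>" by (intro tendsto_intros lim)
      show "\<forall>\<^sub>F n in sequentially. \<bar>F n y - F n x\<bar> \<le> d" using U(3)[OF y] by (simp add: less_imp_le)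
    qed simp
    obtain Y where Y: "finite Y" "UNIV \<subseteq> (\<Union>x\<in>Y. U x)"
    proof (rule compactE_image[OF cpt, of UNIV U])
      show "UNIV \<subseteq> \<Union> (range U)" using U(2) by blast
    qed (use U(1) in auto)
    have "\<forall>\<^sub>F n in sequentially. \<forall>x\<in>Y. dist (F n x) (g x) < d"
      using Y(1) tendstoD[OF lim d] by (simp add: eventually_ball_finite)
    then show "\<forall>\<^sub>F n in sequentially. \<forall>x\<in>UNIV. dist (F n x) (g x) < e"
    proof eventually_elim
      case (elim n)
      show ?case
      proof
        fix y
        obtain x where x: "x \<in> Y" "y \<in> U x" using Y(2) by blast
        then show "dist (F n y) (g y) < e"
          using bspec[OF elim x(1)] U(3)[OF x(2), of n] gU[OF x(2)] d
          unfolding dist_real_def d_def abs_if by (auto split: if_splits)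
      qed
    qed
  qed
  show "continuous_on UNIV g"
    by (rule uniform_limit_theorem[OF _ ul]) (auto simp: equicontinuous_continuous[OF eq])
qed

text \<open>Arzela-Ascoli: a diagonal sequence converges on a countable dense set, and
  equicontinuity carries the Cauchy property over to every point.\<close>

lemma equicontinuous_bounded_convergent_subsequence:
  fixes F :: "nat \<Rightarrow> 'a::second_countable_topology \<Rightarrow> real"
  assumes cpt: "compact (UNIV :: 'a set)" and eq: "equicontinuous F"
    and bounded: "\<And>n x. \<bar>F n x\<bar> \<le> B"
  obtains r g where "strict_mono r" "uniform_limit UNIV (\<lambda>n. F (r n)) g sequentially" "continuous_on UNIV g"
proof -
  obtain D :: "'a set" where D: "countable D" "\<And>U. open U \<Longrightarrow> U \<noteq> {} \<Longrightarrow> \<exists>d\<in>D. d \<in> U"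
  proof (rule countable_dense_setE)
    fix D :: "'a set" assume "countable D" "\<And>X. open X \<Longrightarrow> X \<noteq> {} \<Longrightarrow> \<exists>d\<in>D. d \<in> X"
    then show thesis by (rule that)
  qed
  have "D \<noteq> {}" using D(2)[OF open_UNIV UNIV_not_empty] by blast
  define d where "d = from_nat_into D"
  have range_d: "range d = D" unfolding d_def using \<open>D \<noteq> {}\<close> D(1) by (rule range_from_nat_into)
  interpret subseqs "\<lambda>n s. convergent (\<lambda>i. F (s i) (d n))"
  proof
    fix n and s :: "nat \<Rightarrow> nat" assume "strict_mono s"
    obtain l r where "strict_mono r" "((\<lambda>i. F (s i) (d n)) \<circ> r) \<longlonglongrightarrow> l"
      by (rule bounded_real_subsequence[of "\<lambda>i. F (s i) (d n)" B]) (use bounded in auto)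
    then show "\<exists>r'. strict_mono r' \<and> convergent (\<lambda>i. F ((s \<circ> r') i) (d n))"
      by (auto simp: convergent_def comp_def)
  qed
  define r where "r = diagseq"
  have r: "strict_mono r" unfolding r_def by (rule subseq_diagseq)
  have conv_D: "convergent (\<lambda>i. F (r i) (d n))" for n
  proof -
    \<comment> \<open>Only the tail of the diagonal sequence is a subsequence of the one chosen for
      \<open>d n\<close>; the initial segment is restored afterwards.\<close>
    have "convergent (\<lambda>i. F ((diagseq \<circ> (+) (Suc n)) i) (d n))"
    proof (rule diagseq_holds)
      fix s t :: "nat \<Rightarrow> nat" and m
      assume st: "strict_mono s" "convergent (\<lambda>i. F (t i) (d m))"
      then obtain L where "(\<lambda>i. F (t i) (d m)) \<longlonglongrightarrow> L" unfolding convergent_def by blast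
      from LIMSEQ_subseq_LIMSEQ[OF this st(1)]
      show "convergent (\<lambda>i. F ((t \<circ> s) i) (d m))" by (auto simp: comp_def convergent_def)
    qed
    then have "convergent (\<lambda>i. F (r (i + Suc n)) (d n))" by (simp add: r_def comp_def add.commute)
    then show ?thesis by (subst (asm) convergent_ignore_initial_segment[of "\<lambda>i. F (r i) (d n)"])
  qed
  have "Cauchy (\<lambda>i. F (r i) x)" for x
  proof (rule metric_CauchyI)
    fix e :: real assume "e > 0"
    then obtain U where U: "open U" "x \<in> U" "\<And>i y. y \<in> U \<Longrightarrow> \<bar>F i y - F i x\<bar> < e / 3"
      using eq unfolding equicontinuous_def by (metis divide_pos_pos zero_less_numeral)
    then obtain n where n: "d n \<in> U" using D(2)[of U] range_d by blast
    have "Cauchy (\<lambda>i. F (r i) (d n))" using conv_D by (rule convergent_Cauchy)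
    then obtain M where M: "\<forall>i\<ge>M. \<forall>j\<ge>M. dist (F (r i) (d n)) (F (r j) (d n)) < e / 3"
      using \<open>e > 0\<close> unfolding Cauchy_def by (meson divide_pos_pos zero_less_numeral)
    show "\<exists>M. \<forall>i\<ge>M. \<forall>j\<ge>M. dist (F (r i) x) (F (r j) x) < e"
    proof (intro exI allI impI)
      fix i j assume "i \<ge> M" "j \<ge> M"
      then have "\<bar>F (r i) (d n) - F (r j) (d n)\<bar> < e / 3" using M by (auto simp: dist_real_def)
      then show "dist (F (r i) x) (F (r j) x) < e"
        using U(3)[OF n, of "r i"] U(3)[OF n, of "r j"] unfolding dist_real_def by linarith
    qed
  qed
  then have "\<exists>g. \<forall>x. (\<lambda>i. F (r i) x) \<longlonglongrightarrow> g x"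
    by (auto intro!: choice simp: Cauchy_convergent_iff convergent_def)
  then obtain g where g: "\<And>x. (\<lambda>i. F (r i) x) \<longlonglongrightarrow> g x" by blast
  have "equicontinuous (\<lambda>i. F (r i))" using eq unfolding equicontinuous_def by meson
  from equicontinuous_pointwise_imp_uniform[OF cpt this g] r that show ?thesis by blast
qed

text \<open>The square root satisfies
  \<open>\<bar>sqrt a - sqrt b\<bar> \<le> sqrt \<bar>a - b\<bar>\<close>, so closeness up to the
  square of \<open>e\<close> suffices, even where \<open>g\<close> comes close to 0.\<close>

lemma uniform_limit_sqrt:
  fixes F :: "nat \<Rightarrow> 'a \<Rightarrow> real"
  assumes "uniform_limit S F g sequentially" and nonneg: "\<And>n x. F n x \<ge> 0" "\<And>x. g x \<ge> 0"
  shows "uniform_limit S (\<lambda>n x. sqrt (F n x)) (\<lambda>x. sqrt (g x)) sequentially"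
proof (rule uniform_limitI)
  have le: "sqrt a - sqrt b \<le> sqrt \<bar>a - b\<bar>" if "a \<ge> 0" "b \<ge> 0" for a b :: real
  proof (cases "b \<le> a")
    case True
    have "sqrt (b + (a - b)) \<le> sqrt b + sqrt (a - b)" using True that by (intro sqrt_add_le_add_sqrt) auto
    then show ?thesis using True by simp
  next
    case False
    then have "sqrt a \<le> sqrt b" by simp
    then show ?thesis by (meson diff_le_0_iff_le order_trans real_sqrt_ge_zero abs_ge_zero)
  qed
  have *: "\<bar>sqrt a - sqrt b\<bar> \<le> sqrt \<bar>a - b\<bar>" if "a \<ge> 0" "b \<ge> 0" for a b :: real
    using le[OF that] le[OF that(2,1)] by (simp add: abs_le_iff abs_minus_commute)
  fix e :: real assume "e > 0"
  then have "e\<^sup>2 > 0" by simp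
  with assms(1) have "\<forall>\<^sub>F n in sequentially. \<forall>x\<in>S. dist (F n x) (g x) < e\<^sup>2"
    by (rule uniform_limitD)
  then show "\<forall>\<^sub>F n in sequentially. \<forall>x\<in>S. dist (sqrt (F n x)) (sqrt (g x)) < e"
  proof eventually_elim
    case (elim n)
    show ?case
    proof
      fix x assume "x \<in> S"
      then have "sqrt \<bar>F n x - g x\<bar> < e"
        using elim \<open>e > 0\<close> by (intro real_less_lsqrt) (auto simp: dist_real_def)
      then show "dist (sqrt (F n x)) (sqrt (g x)) < e" using *[of "F n x" "g x"] nonneg by (simp add: dist_real_def)
    qed
  qed
qed

section \<open>Averages of the kernel over an equidistributed sequence\<close>

text \<open>The deterministic setting: \<open>x\<close> is one realization of the sample, and its
  randomness survives only in equidistribution.\<close>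

locale sample_kernel =
  fixes x :: "nat \<Rightarrow> 'm::second_countable_topology" and \<mu> :: "'m measure" and \<eta> :: "'m \<Rightarrow> 'm \<Rightarrow> real"
  assumes compact_space: "compact (UNIV :: 'm set)"
    and prob_\<mu>: "prob_space \<mu>" and sets_\<mu>: "sets \<mu> = sets borel"
    and full_support: "\<And>U. open U \<Longrightarrow> U \<noteq> {} \<Longrightarrow> emeasure \<mu> U > 0"
    and \<eta>_sym: "\<And>y z. \<eta> y z = \<eta> z y"
    and \<eta>_cont: "continuous_on UNIV (\<lambda>(y, z). \<eta> y z)"
    and \<eta>_pos: "\<And>y z. \<eta> y z > 0"
    and equidistributed: "equidistributed x \<mu>"
begin

sublocale \<mu>: prob_space \<mu> by (rule prob_\<mu>)

lemma integrable_continuous: "continuous_on UNIV (\<phi> :: 'm \<Rightarrow> real) \<Longrightarrow> integrable \<mu> \<phi>"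
  by (rule compact_integrable[OF compact_space _ _ sets_\<mu>]) unfold_locales

lemma average_tendsto: "continuous_on UNIV \<phi> \<Longrightarrow> (\<lambda>n. (\<Sum>j<n. \<phi> (x j)) / real n) \<longlonglongrightarrow> (\<integral>y. \<phi> y \<partial>\<mu>)"
  using equidistributed unfolding equidistributed_def by blast

text \<open>A vanishing integral would force \<open>\<phi> = 0\<close> almost everywhere, whereas
  the set where \<open>\<phi>\<close> is positive is open and nonempty and hence has positive
  measure by full support.\<close>

lemma integral_pos:
  fixes \<phi> :: "'m \<Rightarrow> real"
  assumes cont: "continuous_on UNIV \<phi>" and nonneg: "\<And>y. \<phi> y \<ge> 0" and "\<phi> z > 0"
  shows "(\<integral>y. \<phi> y \<partial>\<mu>) > 0"
proof -
  have "(\<integral>y. \<phi> y \<partial>\<mu>) \<noteq> 0"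
  proof
    assume "(\<integral>y. \<phi> y \<partial>\<mu>) = 0"
    then have "AE y in \<mu>. \<phi> y = 0"
      using integral_nonneg_eq_0_iff_AE[OF integrable_continuous[OF cont]] nonneg by auto
    moreover have o: "open {y. \<phi> y > 0}" using cont by (intro open_Collect_less) auto
    moreover have "space \<mu> = UNIV" using sets_eq_imp_space_eq[OF sets_\<mu>] by simp
    moreover have "AE y in \<mu>. \<not> \<phi> y > 0" using \<open>AE y in \<mu>. \<phi> y = 0\<close> by eventually_elim simp
    ultimately have "emeasure \<mu> {y. \<phi> y > 0} = 0"
      using emeasure_eq_0_AE[of "\<lambda>y. \<phi> y > 0" \<mu>] by auto
    then show False using full_support[OF o] \<open>\<phi> z > 0\<close> by auto
  qed
  moreover have "(\<integral>y. \<phi> y \<partial>\<mu>) \<ge> 0" using nonneg by simp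
  ultimately show ?thesis by linarith
qed

text \<open>Density of the sample, tested by continuous functions: the positive part of
  \<open>\<phi>\<close> has positive integral, so its averages over the sample are eventually
  positive.\<close>

lemma sample_meets_positive:
  fixes \<phi> :: "'m \<Rightarrow> real"
  assumes cont: "continuous_on UNIV \<phi>" and "\<phi> z > 0"
  obtains j where "\<phi> (x j) > 0"
proof -
  define \<psi> where "\<psi> y = max 0 (\<phi> y)" for y
  have c: "continuous_on UNIV \<psi>" unfolding \<psi>_def by (intro continuous_intros cont)
  have "(\<integral>y. \<psi> y \<partial>\<mu>) > 0" by (rule integral_pos[OF c, of z]) (use assms in \<open>auto simp: \<psi>_def\<close>)
  with average_tendsto[OF c] have "eventually (\<lambda>n. (\<Sum>j<n. \<psi> (x j)) / real n > 0) sequentially"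
    by (rule order_tendstoD(1))
  then obtain n where n: "(\<Sum>j<n. \<psi> (x j)) / real n > 0"
    unfolding eventually_sequentially by blast
  have "\<exists>j<n. \<psi> (x j) > 0"
  proof (rule ccontr)
    assume "\<not> ?thesis"
    then have "(\<Sum>j<n. \<psi> (x j)) \<le> 0" by (intro sum_nonpos) (meson lessThan_iff not_less)
    then show False using n by (simp add: zero_less_divide_iff)
  qed
  then show ?thesis using that by (auto simp: \<psi>_def max_def split: if_splits)
qed

lemma \<eta>_bounds: obtains c C where "c > 0" "C > 0" "\<And>y z. c \<le> \<eta> y z" "\<And>y z. \<eta> y z \<le> C"
proof -
  have cpt: "compact (UNIV :: ('m \<times> 'm) set)"
    using compact_Times[OF compact_space compact_space] by simp
  obtain p where p: "\<forall>q. (\<lambda>(y, z). \<eta> y z) p \<le> (\<lambda>(y, z). \<eta> y z) q"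
    using continuous_attains_inf[OF cpt _ \<eta>_cont] by auto
  obtain r where r: "\<forall>q. (\<lambda>(y, z). \<eta> y z) q \<le> (\<lambda>(y, z). \<eta> y z) r"
    using continuous_attains_sup[OF cpt _ \<eta>_cont] by auto
  show ?thesis
    by (rule that[of "(\<lambda>(y, z). \<eta> y z) p" "(\<lambda>(y, z). \<eta> y z) r"])
      (use p r \<eta>_pos in \<open>auto simp: split_beta split: prod.splits\<close>)
qed

definition c_min where "c_min = (SOME c. c > 0 \<and> (\<forall>y z. c \<le> \<eta> y z))"
definition c_max where "c_max = (SOME C. C > 0 \<and> (\<forall>y z. \<eta> y z \<le> C))"

lemma c_min: "c_min > 0" "c_min \<le> \<eta> y z"
proof -
  have "\<exists>c. c > 0 \<and> (\<forall>y z. c \<le> \<eta> y z)" using \<eta>_bounds by metis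
  from someI_ex[OF this] show "c_min > 0" "c_min \<le> \<eta> y z" unfolding c_min_def by auto
qed

lemma c_max: "c_max > 0" "\<eta> y z \<le> c_max"
proof -
  have "\<exists>C. C > 0 \<and> (\<forall>y z. \<eta> y z \<le> C)" using \<eta>_bounds by metis
  from someI_ex[OF this] show "c_max > 0" "\<eta> y z \<le> c_max" unfolding c_max_def by auto
qed

lemma \<eta>_cont_right: "continuous_on UNIV (\<eta> y)"
proof -
  have "continuous_on UNIV (\<lambda>z :: 'm. (y, z))" by (intro continuous_intros)
  from continuous_on_compose2[OF \<eta>_cont this] show ?thesis by simp
qed

text \<open>The tube lemma: the product neighbourhoods of the points \<open>(y0, z)\<close> can be
  reduced to finitely many by compactness in \<open>z\<close>, and their first factors intersect in
  a neighbourhood of \<open>y0\<close> that serves all \<open>z\<close>.\<close>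

lemma \<eta>_equicontinuous: "equicontinuous (\<lambda>z y. \<eta> y z)"
  unfolding equicontinuous_def
proof (intro allI impI)
  fix y0 and e :: real assume "e > 0"
  have "\<exists>A B. open A \<and> open B \<and> y0 \<in> A \<and> z \<in> B \<and> (\<forall>y\<in>A. \<forall>z'\<in>B. \<bar>\<eta> y z' - \<eta> y0 z\<bar> < e / 2)" for z
  proof -
    let ?S = "(\<lambda>(y, z). \<eta> y z) -` ball (\<eta> y0 z) (e / 2)"
    have "open ?S" by (rule open_vimage[OF open_ball \<eta>_cont])
    moreover have "(y0, z) \<in> ?S" using \<open>e > 0\<close> by simp
    ultimately obtain A B where "open A" "open B" "(y0, z) \<in> A \<times> B" "A \<times> B \<subseteq> ?S"
      by (rule open_prod_elim)
    then show ?thesis by (intro exI[of _ A] exI[of _ B]) (auto simp: dist_real_def abs_minus_commute subset_iff)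
  qed
  then obtain A B where AB: "\<And>z. open (A z)" "\<And>z. open (B z)" "\<And>z. y0 \<in> A z" "\<And>z. z \<in> B z"
    "\<And>z y z'. y \<in> A z \<Longrightarrow> z' \<in> B z \<Longrightarrow> \<bar>\<eta> y z' - \<eta> y0 z\<bar> < e / 2"
    by metis
  obtain Z where Z: "finite Z" "UNIV \<subseteq> (\<Union>z\<in>Z. B z)"
  proof (rule compactE_image[OF compact_space, of UNIV B])
    show "UNIV \<subseteq> \<Union> (range B)" using AB(4) by blast
  qed (use AB(2) in auto)
  show "\<exists>U. open U \<and> y0 \<in> U \<and> (\<forall>z. \<forall>y\<in>U. \<bar>\<eta> y z - \<eta> y0 z\<bar> < e)"
  proof (intro exI[of _ "\<Inter>z\<in>Z. A z"] conjI allI ballI)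
    show "open (\<Inter>z\<in>Z. A z)" using Z(1) AB(1) by auto
    show "y0 \<in> (\<Inter>z\<in>Z. A z)" using AB(3) by auto
    fix z y assume y: "y \<in> (\<Inter>z\<in>Z. A z)"
    obtain w where w: "w \<in> Z" "z \<in> B w" using Z(2) by blast
    have "\<bar>\<eta> y z - \<eta> y0 w\<bar> < e / 2" using AB(5) w y by blast
    moreover have "\<bar>\<eta> y0 z - \<eta> y0 w\<bar> < e / 2" using AB(5)[OF AB(3) w(2)] .
    ultimately show "\<bar>\<eta> y z - \<eta> y0 z\<bar> < e" by linarith
  qed
qed

text \<open>
  Writing an eigenvector of the normalized Laplacian as \<open>sqrt deg * q\<close> turns the eigenvalue equation into
  \<open>ker_avg q = (1 - \<lambda>) * deg * q\<close>, without square roots; likewise for the limiting operator.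
\<close>

definition ker_avg :: "nat \<Rightarrow> (nat \<Rightarrow> real) \<Rightarrow> 'm \<Rightarrow> real" where
  "ker_avg n q y = (\<Sum>j<n. \<eta> y (x j) * q j) / real n"

definition ker_int :: "('m \<Rightarrow> real) \<Rightarrow> 'm \<Rightarrow> real" where
  "ker_int \<phi> y = (\<integral>z. \<eta> y z * \<phi> z \<partial>\<mu>)"

abbreviation deg_n :: "nat \<Rightarrow> 'm \<Rightarrow> real" where "deg_n n \<equiv> ker_avg n (\<lambda>_. 1)"
abbreviation deg :: "'m \<Rightarrow> real" where "deg \<equiv> ker_int (\<lambda>_. 1)"

lemma deg_n_bounds: "n > 0 \<Longrightarrow> c_min \<le> deg_n n y" "deg_n n y \<le> c_max"
proof -
  have "c_min \<le> deg_n n y" if "n > 0"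
    using sum_bounded_below[of "{..<n}" c_min "\<lambda>j. \<eta> y (x j)"] c_min that
    by (simp add: ker_avg_def pos_le_divide_eq mult.commute)
  then show "n > 0 \<Longrightarrow> c_min \<le> deg_n n y" .
  show "deg_n n y \<le> c_max"
    using sum_bounded_above[of "{..<n}" "\<lambda>j. \<eta> y (x j)" c_max] c_max
    by (cases "n = 0") (auto simp: ker_avg_def pos_divide_le_eq mult.commute)
qed

lemma deg_n_pos: "n > 0 \<Longrightarrow> deg_n n y > 0"
  using deg_n_bounds(1)[of n y] c_min(1) by linarith

lemma deg_ge: "c_min \<le> deg y"
proof -
  have "(\<integral>z. c_min \<partial>\<mu>) \<le> (\<integral>z. \<eta> y z * 1 \<partial>\<mu>)"
    using integrable_continuous[OF \<eta>_cont_right] c_min by (intro integral_mono) auto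
  then show ?thesis by (simp add: ker_int_def \<mu>.prob_space)
qed

lemma deg_pos: "deg y > 0" using deg_ge[of y] c_min(1) by linarith

lemma abs_ker_avg_le: "\<bar>ker_avg n q y\<bar> \<le> c_max * ((\<Sum>j<n. \<bar>q j\<bar>) / real n)"
proof -
  have "\<bar>\<Sum>j<n. \<eta> y (x j) * q j\<bar> \<le> (\<Sum>j<n. \<bar>\<eta> y (x j) * q j\<bar>)" by (rule sum_abs)
  also have "\<dots> \<le> (\<Sum>j<n. c_max * \<bar>q j\<bar>)"
    using c_max \<eta>_pos by (intro sum_mono) (auto simp: abs_mult abs_of_pos intro!: mult_right_mono)
  finally show ?thesis by (simp add: ker_avg_def abs_divide divide_right_mono flip: sum_distrib_left)
qed

text \<open>The variation of the average is at most the variation of the kernel times the mean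
  absolute weight, so individual weights may be large.\<close>

lemma ker_avg_equicontinuous:
  fixes N :: "nat \<Rightarrow> nat"
  assumes B: "\<And>n. (\<Sum>j<N n. \<bar>q n j\<bar>) / real (N n) \<le> B"
  shows "equicontinuous (\<lambda>n. ker_avg (N n) (q n))"
  unfolding equicontinuous_def
proof (intro allI impI)
  fix y and e :: real assume "e > 0"
  have B0: "B \<ge> 0" using B[of 0] by (meson divide_nonneg_nonneg of_nat_0_le_iff order_trans sum_nonneg abs_ge_zero)
  \<comment> \<open>The summand 1 covers \<open>B = 0\<close> and makes the final estimate
    strict.\<close>
  define d where "d = e / (B + 1)"
  have "d > 0" unfolding d_def using B0 \<open>e > 0\<close> by simp
  then obtain U where U: "open U" "y \<in> U" "\<And>z w. w \<in> U \<Longrightarrow> \<bar>\<eta> w z - \<eta> y z\<bar> < d"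
    using \<eta>_equicontinuous unfolding equicontinuous_def by meson
  have "\<bar>ker_avg (N n) (q n) w - ker_avg (N n) (q n) y\<bar> < e" if w: "w \<in> U" for n w
  proof -
    have "\<bar>(\<Sum>j<N n. \<eta> w (x j) * q n j) - (\<Sum>j<N n. \<eta> y (x j) * q n j)\<bar>
       \<le> (\<Sum>j<N n. \<bar>(\<eta> w (x j) - \<eta> y (x j)) * q n j\<bar>)"
      unfolding sum_subtractf[symmetric] left_diff_distrib by (rule sum_abs)
    also have "\<dots> \<le> (\<Sum>j<N n. d * \<bar>q n j\<bar>)"
      using U(3)[OF w] by (intro sum_mono) (auto simp: abs_mult less_imp_le intro!: mult_right_mono)
    also have "\<dots> = d * (\<Sum>j<N n. \<bar>q n j\<bar>)" by (simp add: sum_distrib_left)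
    finally have "\<bar>ker_avg (N n) (q n) w - ker_avg (N n) (q n) y\<bar> \<le> d * ((\<Sum>j<N n. \<bar>q n j\<bar>) / real (N n))"
      unfolding ker_avg_def diff_divide_distrib[symmetric] abs_divide
      by (simp add: divide_right_mono)
    also have "\<dots> \<le> d * B" using B \<open>d > 0\<close> by (intro mult_left_mono) auto
    also have "\<dots> < d * (B + 1)" using \<open>d > 0\<close> by simp
    also have "\<dots> = e" unfolding d_def using B0 by simp
    finally show ?thesis .
  qed
  then show "\<exists>U. open U \<and> y \<in> U \<and> (\<forall>n. \<forall>w\<in>U. \<bar>ker_avg (N n) (q n) w - ker_avg (N n) (q n) y\<bar> < e)"
    using U by blast
qed

text \<open>Vectors of growing length \<open>N n\<close> are compared with the restriction of a
  function to the sample. The map \<open>N\<close> lists the sample sizes under consideration, which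
  allows passing to subsequences.\<close>

definition sample_limit :: "(nat \<Rightarrow> nat) \<Rightarrow> (nat \<Rightarrow> nat \<Rightarrow> real) \<Rightarrow> ('m \<Rightarrow> real) \<Rightarrow> bool" where
  "sample_limit N q \<phi> \<longleftrightarrow> (\<forall>e>0. \<forall>\<^sub>F n in sequentially. \<forall>j<N n. \<bar>q n j - \<phi> (x j)\<bar> < e)"

lemma sample_limitD: "sample_limit N q \<phi> \<Longrightarrow> e > 0 \<Longrightarrow> \<forall>\<^sub>F n in sequentially. \<forall>j<N n. \<bar>q n j - \<phi> (x j)\<bar> < e"
  unfolding sample_limit_def by blast

text \<open>Continuing the vector by the limit itself beyond \<open>N n\<close> makes the domain
  constant, so that the rules for uniform limits, in particular the one for products, become
  available.\<close>

lemma sample_limit_iff_uniform_limit: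
  "sample_limit N q \<phi> \<longleftrightarrow>
     uniform_limit UNIV (\<lambda>n j. if j < N n then q n j else \<phi> (x j)) (\<lambda>j. \<phi> (x j)) sequentially"
  unfolding sample_limit_def uniform_limit_iff by (auto simp: dist_real_def intro!: eventually_cong)

lemma sample_limit_uniform_limit:
  assumes "uniform_limit UNIV F \<phi> sequentially"
    and "\<forall>\<^sub>F n in sequentially. \<forall>j<N n. q n j = F n (x j)"
  shows "sample_limit N q \<phi>"
  unfolding sample_limit_def
proof (intro allI impI)
  fix e :: real assume "e > 0"
  show "\<forall>\<^sub>F n in sequentially. \<forall>j<N n. \<bar>q n j - \<phi> (x j)\<bar> < e"
    using uniform_limitD[OF assms(1) \<open>e > 0\<close>] assms(2)
    by eventually_elim (auto simp: dist_real_def)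
qed

lemma sample_limit_const: "sample_limit N (\<lambda>n j. \<phi> (x j)) \<phi>"
  unfolding sample_limit_def by simp

lemma continuous_bounded: "continuous_on UNIV (\<phi> :: 'm \<Rightarrow> real) \<Longrightarrow> bounded (range \<phi>)"
  using compact_continuous_image compact_space compact_imp_bounded by blast

lemma sample_limit_mult:
  assumes "sample_limit N q \<phi>" "sample_limit N q' \<psi>" and cont: "continuous_on UNIV \<phi>" "continuous_on UNIV \<psi>"
  shows "sample_limit N (\<lambda>n j. q n j * q' n j) (\<lambda>y. \<phi> y * \<psi> y)"
proof -
  have b: "bounded (range (\<lambda>j. \<phi> (x j)))" "bounded (range (\<lambda>j. \<psi> (x j)))"
    by (rule bounded_subset[OF continuous_bounded[OF cont(1)]], blast)
      (rule bounded_subset[OF continuous_bounded[OF cont(2)]], blast)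
  have "uniform_limit UNIV (\<lambda>n j. (if j < N n then q n j else \<phi> (x j)) * (if j < N n then q' n j else \<psi> (x j)))
     (\<lambda>j. \<phi> (x j) * \<psi> (x j)) sequentially"
    using assms(1,2) unfolding sample_limit_iff_uniform_limit by (rule uniform_lim_mult) (use b in auto)
  also have "(\<lambda>n j. (if j < N n then q n j else \<phi> (x j)) * (if j < N n then q' n j else \<psi> (x j))) =
      (\<lambda>n j. if j < N n then q n j * q' n j else \<phi> (x j) * \<psi> (x j))" by (intro ext) simp
  finally show ?thesis unfolding sample_limit_iff_uniform_limit .
qed

lemma sample_limit_subseq:
  assumes "sample_limit N q \<phi>" "strict_mono r"
  shows "sample_limit (N \<circ> r) (q \<circ> r) \<phi>"
  unfolding sample_limit_def
proof (intro allI impI)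
  fix e :: real assume "e > 0"
  from eventually_subseq[OF assms(2) sample_limitD[OF assms(1) this]]
  show "\<forall>\<^sub>F n in sequentially. \<forall>j<(N \<circ> r) n. \<bar>(q \<circ> r) n j - \<phi> (x j)\<bar> < e" by simp
qed

lemma average_sample_limit:
  assumes N: "filterlim N at_top sequentially" and q: "sample_limit N q \<phi>" and cont: "continuous_on UNIV \<phi>"
  shows "(\<lambda>n. (\<Sum>j<N n. q n j) / real (N n)) \<longlonglongrightarrow> (\<integral>y. \<phi> y \<partial>\<mu>)"
proof -
  have "(\<lambda>n. (\<Sum>j<N n. \<phi> (x j)) / real (N n)) \<longlonglongrightarrow> (\<integral>y. \<phi> y \<partial>\<mu>)"
    using filterlim_compose[OF average_tendsto[OF cont] N] by simp
  moreover have "(\<lambda>n. (\<Sum>j<N n. q n j) / real (N n) - (\<Sum>j<N n. \<phi> (x j)) / real (N n)) \<longlonglongrightarrow> 0"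
  proof (rule tendstoI)
    fix e :: real assume "e > 0"
    then have "e / 2 > 0" by simp
    from sample_limitD[OF q this]
    show "\<forall>\<^sub>F n in sequentially. dist ((\<Sum>j<N n. q n j) / real (N n) - (\<Sum>j<N n. \<phi> (x j)) / real (N n)) 0 < e"
    proof eventually_elim
      case (elim n)
      have "\<bar>(\<Sum>j<N n. q n j) / real (N n) - (\<Sum>j<N n. \<phi> (x j)) / real (N n)\<bar> \<le> e / 2"
        using elim \<open>e > 0\<close> by (intro abs_average_diff_le) (auto simp: less_imp_le)
      then show ?case using \<open>e > 0\<close> by simp
    qed
  qed
  ultimately show ?thesis by (rule Lim_transform)
qed

lemma ker_avg_diff: "ker_avg n q y - ker_avg n q' y = ker_avg n (\<lambda>j. q j - q' j) y"
  by (simp add: ker_avg_def sum_subtractf right_diff_distrib diff_divide_distrib)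

text \<open>For weights \<open>\<phi> (x j)\<close>, equidistribution with test function
  \<open>\<eta> y z * \<phi> z\<close> gives convergence at each \<open>y\<close>, and
  equicontinuity makes it uniform, with continuity of the limit as a by-product. Passing to general
  weights costs at most \<open>c_max\<close> times their uniform error.\<close>

lemma
  assumes N: "filterlim N at_top sequentially" and q: "sample_limit N q \<phi>" and cont: "continuous_on UNIV \<phi>"
  shows ker_avg_uniform_limit: "uniform_limit UNIV (\<lambda>n. ker_avg (N n) (q n)) (ker_int \<phi>) sequentially"
    and ker_int_continuous': "continuous_on UNIV (ker_int \<phi>)"
proof -
  obtain B where B: "B > 0" "\<And>y. \<bar>\<phi> y\<bar> \<le> B" using compact_bounded_real[OF compact_space cont] by blast
  have "(\<Sum>j<N n. \<bar>\<phi> (x j)\<bar>) / real (N n) \<le> B" for n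
    using sum_bounded_above[of "{..<N n}" "\<lambda>j. \<bar>\<phi> (x j)\<bar>" B] B
    by (cases "N n = 0") (auto simp: pos_divide_le_eq mult.commute)
  then have eq: "equicontinuous (\<lambda>n. ker_avg (N n) (\<lambda>j. \<phi> (x j)))"
    by (rule ker_avg_equicontinuous[where N = N and q = "\<lambda>n j. \<phi> (x j)"])
  have pw: "(\<lambda>n. ker_avg (N n) (\<lambda>j. \<phi> (x j)) y) \<longlonglongrightarrow> ker_int \<phi> y" for y
    unfolding ker_avg_def ker_int_def
    by (rule average_sample_limit[OF N sample_limit_const[where \<phi> = "\<lambda>z. \<eta> y z * \<phi> z"]])
      (intro continuous_intros cont \<eta>_cont_right)
  note ul = equicontinuous_pointwise_imp_uniform[OF compact_space eq pw]
  show "continuous_on UNIV (ker_int \<phi>)" by (rule ul(2))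
  have "uniform_limit UNIV (\<lambda>n y. ker_avg (N n) (q n) y - ker_avg (N n) (\<lambda>j. \<phi> (x j)) y) (\<lambda>_. 0) sequentially"
  proof (rule uniform_limitI)
    fix e :: real assume "e > 0"
    then have "e / (2 * c_max) > 0" using c_max(1) by simp
    from sample_limitD[OF q this]
    show "\<forall>\<^sub>F n in sequentially. \<forall>y\<in>UNIV. dist (ker_avg (N n) (q n) y - ker_avg (N n) (\<lambda>j. \<phi> (x j)) y) 0 < e"
    proof eventually_elim
      case (elim n)
      show ?case
      proof
        fix y
        have "(\<Sum>j<N n. \<bar>q n j - \<phi> (x j)\<bar>) / real (N n) \<le> e / (2 * c_max)"
          using abs_average_diff_le[of "N n" "\<lambda>j. \<bar>q n j - \<phi> (x j)\<bar>" "\<lambda>_. 0" "e / (2 * c_max)"] elim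
            \<open>e / (2 * c_max) > 0\<close> by (simp add: less_imp_le)
        then have "c_max * ((\<Sum>j<N n. \<bar>q n j - \<phi> (x j)\<bar>) / real (N n)) \<le> c_max * (e / (2 * c_max))"
          using c_max(1) by (intro mult_left_mono) auto
        also have "\<dots> = e / 2" using c_max(1) by simp
        finally show "dist (ker_avg (N n) (q n) y - ker_avg (N n) (\<lambda>j. \<phi> (x j)) y) 0 < e"
          using abs_ker_avg_le[of "N n" "\<lambda>j. q n j - \<phi> (x j)" y] \<open>e > 0\<close>
          unfolding ker_avg_diff dist_real_def diff_0_right by linarith
      qed
    qed
  qed
  from uniform_limit_add[OF this ul(1)]
  show "uniform_limit UNIV (\<lambda>n. ker_avg (N n) (q n)) (ker_int \<phi>) sequentially" by simp
qed

lemma ker_int_continuous: "continuous_on UNIV \<phi> \<Longrightarrow> continuous_on UNIV (ker_int \<phi>)"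
  using ker_int_continuous'[OF filterlim_ident sample_limit_const] .

lemma deg_continuous: "continuous_on UNIV deg" by (rule ker_int_continuous) simp

lemma deg_uniform_limit: "filterlim N at_top sequentially \<Longrightarrow> uniform_limit UNIV (\<lambda>n. deg_n (N n)) deg sequentially"
  using ker_avg_uniform_limit[OF _ sample_limit_const[where \<phi> = "\<lambda>_. 1"]] by simp

lemma deg_sample_limit: "filterlim N at_top sequentially \<Longrightarrow> sample_limit N (\<lambda>n j. deg_n (N n) (x j)) deg"
  by (rule sample_limit_uniform_limit[OF deg_uniform_limit]) auto

lemma average_ker_avg_tendsto:
  assumes N: "filterlim N at_top sequentially" and q: "sample_limit N q \<phi>" "continuous_on UNIV \<phi>"
    and q': "sample_limit N q' \<psi>" "continuous_on UNIV \<psi>"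
  shows "(\<lambda>n. (\<Sum>i<N n. q n i * ker_avg (N n) (q' n) (x i)) / real (N n)) \<longlonglongrightarrow> (\<integral>y. \<phi> y * ker_int \<psi> y \<partial>\<mu>)"
proof (rule average_sample_limit[OF N])
  have "sample_limit N (\<lambda>n i. ker_avg (N n) (q' n) (x i)) (ker_int \<psi>)"
    by (rule sample_limit_uniform_limit[OF ker_avg_uniform_limit[OF N q']]) simp
  from sample_limit_mult[OF q(1) this q(2) ker_int_continuous[OF q'(2)]]
  show "sample_limit N (\<lambda>n i. q n i * ker_avg (N n) (q' n) (x i)) (\<lambda>y. \<phi> y * ker_int \<psi> y)" .
  show "continuous_on UNIV (\<lambda>y. \<phi> y * ker_int \<psi> y)"
    by (intro continuous_intros q(2) ker_int_continuous q'(2))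
qed

text \<open>Both sides are limits of the same double averages over the sample, which replaces Fubini's theorem.\<close>

lemma ker_int_symmetric:
  assumes "continuous_on UNIV \<phi>" "continuous_on UNIV \<psi>"
  shows "(\<integral>y. \<phi> y * ker_int \<psi> y \<partial>\<mu>) = (\<integral>y. \<psi> y * ker_int \<phi> y \<partial>\<mu>)"
proof (rule LIMSEQ_unique)
  note lim = average_ker_avg_tendsto[OF filterlim_ident sample_limit_const _ sample_limit_const]
  show "(\<lambda>n. (\<Sum>i<n. \<phi> (x i) * ker_avg n (\<lambda>j. \<psi> (x j)) (x i)) / real n) \<longlonglongrightarrow> (\<integral>y. \<phi> y * ker_int \<psi> y \<partial>\<mu>)"
    by (rule lim[OF assms])
  have "(\<Sum>i<n. \<psi> (x i) * ker_avg n (\<lambda>j. \<phi> (x j)) (x i)) = (\<Sum>i<n. \<phi> (x i) * ker_avg n (\<lambda>j. \<psi> (x j)) (x i))" for n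
    unfolding ker_avg_def sum_distrib_left sum_divide_distrib times_divide_eq_right
    by (subst sum.swap) (simp add: \<eta>_sym ac_simps)
  then show "(\<lambda>n. (\<Sum>i<n. \<phi> (x i) * ker_avg n (\<lambda>j. \<psi> (x j)) (x i)) / real n) \<longlonglongrightarrow> (\<integral>y. \<psi> y * ker_int \<phi> y \<partial>\<mu>)"
    using lim[OF assms(2,1)] by simp
qed

text \<open>The equation expresses \<open>q\<close> on the sample as its kernel average divided by
  \<open>\<kappa> n\<close> times the degree. The averages are equicontinuous and bounded, hence
  subconverge to some \<open>G\<close>; because \<open>\<tau> \<noteq> 0\<close> the quotients
  converge as well, and their limit is the eigenfunction.\<close>

lemma eigenvector_subsequence:
  fixes N :: "nat \<Rightarrow> nat" and q :: "nat \<Rightarrow> nat \<Rightarrow> real"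
  assumes N: "filterlim N at_top sequentially"
    and eig: "\<And>n i. i < N n \<Longrightarrow> ker_avg (N n) (q n) (x i) = \<kappa> n * deg_n (N n) (x i) * q n i"
    and \<kappa>: "\<kappa> \<longlonglongrightarrow> \<tau>" "\<tau> \<noteq> 0"
    and B: "\<And>n. (\<Sum>j<N n. \<bar>q n j\<bar>) / real (N n) \<le> B"
  obtains r \<phi> where "strict_mono r" "continuous_on UNIV \<phi>" "sample_limit (N \<circ> r) (q \<circ> r) \<phi>"
    "\<And>y. ker_int \<phi> y = \<tau> * deg y * \<phi> y"
proof -
  have eq: "equicontinuous (\<lambda>n. ker_avg (N n) (q n))" by (rule ker_avg_equicontinuous[OF B])
  have bd: "\<bar>ker_avg (N n) (q n) y\<bar> \<le> c_max * B" for n y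
    using abs_ker_avg_le[of "N n" "q n" y] mult_left_mono[OF B[of n], of c_max] c_max(1) by linarith
  obtain r G where r: "strict_mono r" and ul: "uniform_limit UNIV (\<lambda>n. ker_avg (N (r n)) (q (r n))) G sequentially"
    and G: "continuous_on UNIV G"
    by (rule equicontinuous_bounded_convergent_subsequence[OF compact_space eq bd])
  have Nr: "filterlim (\<lambda>n. N (r n)) at_top sequentially"
    using filterlim_compose[OF N filterlim_subseq[OF r]] .
  have \<kappa>r: "(\<lambda>n. \<kappa> (r n)) \<longlonglongrightarrow> \<tau>" using LIMSEQ_subseq_LIMSEQ[OF \<kappa>(1) r] by (simp add: comp_def)
  define \<phi> where "\<phi> y = G y / (\<tau> * deg y)" for y
  have cont: "continuous_on UNIV \<phi>"
    unfolding \<phi>_def using \<kappa>(2) deg_pos by (intro continuous_intros G deg_continuous) (auto simp: less_le)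
  have "uniform_limit UNIV (\<lambda>n _ :: 'm. \<kappa> (r n)) (\<lambda>_. \<tau>) sequentially"
    using \<kappa>r by (simp add: uniform_limit_iff tendsto_iff)
  from uniform_lim_mult[OF this deg_uniform_limit[OF Nr]]
  have den: "uniform_limit UNIV (\<lambda>n y. \<kappa> (r n) * deg_n (N (r n)) y) (\<lambda>y. \<tau> * deg y) sequentially"
    using continuous_bounded[OF deg_continuous] by (auto simp: image_constant_conv)
  have ul\<phi>: "uniform_limit UNIV (\<lambda>n y. ker_avg (N (r n)) (q (r n)) y / (\<kappa> (r n) * deg_n (N (r n)) y)) \<phi> sequentially"
    unfolding \<phi>_def
  proof (rule uniform_lim_divide[OF ul den])
    show "bounded (range G)" by (rule continuous_bounded[OF G])
    \<comment> \<open>The limit denominators are bounded away from 0, as uniform convergence of the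
      quotient requires.\<close>
    show "\<bar>\<tau>\<bar> * c_min > 0" using \<kappa>(2) c_min(1) by simp
    show "\<bar>\<tau>\<bar> * c_min \<le> norm (\<tau> * deg y)" for y
      using deg_ge[of y] deg_pos[of y] by (simp add: abs_mult mult_left_mono)
  qed
  have "\<forall>\<^sub>F n in sequentially. \<kappa> (r n) \<noteq> 0" using \<kappa>r \<kappa>(2) by (rule tendsto_imp_eventually_ne)
  then have "\<forall>\<^sub>F n in sequentially. \<forall>j<N (r n). q (r n) j = ker_avg (N (r n)) (q (r n)) (x j) / (\<kappa> (r n) * deg_n (N (r n)) (x j))"
  proof eventually_elim
    case (elim n)
    show ?case
    proof (intro allI impI)
      fix j assume j: "j < N (r n)"
      then have "deg_n (N (r n)) (x j) > 0" by (intro deg_n_pos) auto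
      then show "q (r n) j = ker_avg (N (r n)) (q (r n)) (x j) / (\<kappa> (r n) * deg_n (N (r n)) (x j))"
        using eig[OF j] elim by simp
    qed
  qed
  from sample_limit_uniform_limit[OF ul\<phi> this]
  have sl: "sample_limit (\<lambda>n. N (r n)) (\<lambda>n. q (r n)) \<phi>" .
  \<comment> \<open>The same averages converge to \<open>G\<close> by choice of the subsequence, and
    to \<open>ker_int \<phi>\<close> because their weights converge to
    \<open>\<phi>\<close>.\<close>
  have "ker_int \<phi> y = G y" for y
    using tendsto_uniform_limitI[OF ker_avg_uniform_limit[OF Nr sl cont], of y] tendsto_uniform_limitI[OF ul, of y]
    by (auto intro: LIMSEQ_unique)
  then have "ker_int \<phi> y = \<tau> * deg y * \<phi> y" for y
    using \<kappa>(2) deg_pos[of y] by (simp add: \<phi>_def)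
  then show ?thesis using that[OF r cont] sl by (simp add: comp_def)
qed

section \<open>The spectrum of the sample Laplacian\<close>

lemma degree_eq_deg_n: "n > 0 \<Longrightarrow> (\<Sum>j<n. \<eta> y (x j)) = real n * deg_n n y"
  by (simp add: ker_avg_def)

lemma laplacian_eq_mat:
  assumes n: "n > 0"
  shows "laplacian \<eta> n x = Matrix.mat n n (\<lambda>(i, j). (if i = j then 1 else 0)
    - \<eta> (x i) (x j) / (real n * (sqrt (deg_n n (x i)) * sqrt (deg_n n (x j)))))"
proof -
  define f where "f i = 1 / sqrt (real n * deg_n n (x i))" for i
  define S where "S = Matrix.mat n n (\<lambda>(i, j). \<eta> (x i) (x j))"
  have S: "S \<in> carrier_mat n n" unfolding S_def by simp
  have "laplacian \<eta> n x = 1\<^sub>m n - mat_diag n f * S * mat_diag n f"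
    unfolding laplacian_def inv_sqrt_degree_mat_def similarity_mat_def degree_eq_deg_n[OF n] S_def f_def[symmetric] ..
  also have "mat_diag n f * S = Matrix.mat n n (\<lambda>(i, j). f i * S $$ (i, j))"
    by (rule mat_diag_mult_left[OF S])
  also have "\<dots> * mat_diag n f = Matrix.mat n n (\<lambda>(i, j). Matrix.mat n n (\<lambda>(i, j). f i * S $$ (i, j)) $$ (i, j) * f j)"
    by (rule mat_diag_mult_right[of _ n n]) simp
  also have "1\<^sub>m n - \<dots> = Matrix.mat n n (\<lambda>(i, j). (if i = j then 1 else 0)
    - \<eta> (x i) (x j) / (real n * (sqrt (deg_n n (x i)) * sqrt (deg_n n (x j)))))"
    by (rule eq_matI) (auto simp: S_def f_def real_sqrt_mult)
  finally show ?thesis .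
qed

lemma laplacian_carrier: "n > 0 \<Longrightarrow> laplacian \<eta> n x \<in> carrier_mat n n"
  by (simp add: laplacian_eq_mat)

lemma laplacian_entry:
  assumes "i < n" "j < n"
  shows "laplacian \<eta> n x $$ (i, j) = (if i = j then 1 else 0)
    - \<eta> (x i) (x j) / (real n * (sqrt (deg_n n (x i)) * sqrt (deg_n n (x j))))"
  using assms by (subst laplacian_eq_mat) auto

lemma transpose_laplacian:
  assumes n: "n > 0"
  shows "transpose_mat (laplacian \<eta> n x) = laplacian \<eta> n x"
  unfolding laplacian_eq_mat[OF n] by (rule eq_matI) (auto simp: \<eta>_sym mult.commute)

lemma normalized_kernel_sum:
  assumes eig: "\<And>i. i < n \<Longrightarrow> (\<Sum>j<n. laplacian \<eta> n x $$ (i, j) * v j) = s * v i" and i: "i < n"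
  shows "(\<Sum>j<n. \<eta> (x i) (x j) / (real n * (sqrt (deg_n n (x i)) * sqrt (deg_n n (x j)))) * v j) = (1 - s) * v i"
proof -
  have "(\<Sum>j<n. laplacian \<eta> n x $$ (i, j) * v j) = (\<Sum>j<n. (if i = j then 1 else 0) * v j)
    - (\<Sum>j<n. \<eta> (x i) (x j) / (real n * (sqrt (deg_n n (x i)) * sqrt (deg_n n (x j)))) * v j)"
    unfolding sum_subtractf[symmetric] using i by (intro sum.cong) (auto simp: laplacian_entry left_diff_distrib)
  then show ?thesis using eig[OF i] i by (simp add: sum_kronecker_mult left_diff_distrib)
qed

lemma ker_avg_eigenvector:
  assumes eig: "\<And>i. i < n \<Longrightarrow> (\<Sum>j<n. laplacian \<eta> n x $$ (i, j) * v j) = s * v i" and i: "i < n"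
  defines "q \<equiv> \<lambda>j. v j / sqrt (deg_n n (x j))"
  shows "ker_avg n q (x i) = (1 - s) * deg_n n (x i) * q i"
proof -
  have d: "deg_n n (x i) > 0" using i by (intro deg_n_pos) auto
  have "ker_avg n q (x i) = (\<Sum>j<n. \<eta> (x i) (x j) * q j) / real n" by (rule ker_avg_def)
  also have "\<dots> = sqrt (deg_n n (x i)) *
     (\<Sum>j<n. \<eta> (x i) (x j) / (real n * (sqrt (deg_n n (x i)) * sqrt (deg_n n (x j)))) * v j)"
    unfolding q_def sum_divide_distrib sum_distrib_left
    using d by (intro sum.cong refl) simp
  also have "\<dots> = sqrt (deg_n n (x i)) * ((1 - s) * v i)"
    by (simp only: normalized_kernel_sum[of n v s i, OF eig i])
  also have "\<dots> = (1 - s) * v i * (deg_n n (x i) / sqrt (deg_n n (x i)))"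
    using d by (subst real_div_sqrt) simp_all
  also have "\<dots> = (1 - s) * deg_n n (x i) * q i" unfolding q_def by simp
  finally show ?thesis .
qed

text \<open>The vectors \<open>q a\<close> are orthonormal for the inner product weighted by the
  degrees. The third property is the half of Courant-Fischer that is used later: expanding
  \<open>g\<close> in the eigenbasis, only terms with index at least \<open>l\<close> remain, and
  \<open>\<kappa>\<close> decreases because the Laplacian eigenvalues are sorted.\<close>

lemma laplacian_spectrum:
  assumes n: "n > 0"
  defines "\<kappa> \<equiv> \<lambda>l. 1 - laplacian_eigenvalue \<eta> n x l"
  obtains q :: "nat \<Rightarrow> nat \<Rightarrow> real" where
    "\<And>a i. a < n \<Longrightarrow> i < n \<Longrightarrow> ker_avg n (q a) (x i) = \<kappa> a * deg_n n (x i) * q a i"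
    "\<And>a b. a < n \<Longrightarrow> b < n \<Longrightarrow> (\<Sum>i<n. deg_n n (x i) * q a i * q b i) / real n = (if a = b then 1 else 0)"
    "\<And>l g. l < n \<Longrightarrow> (\<And>a. a < l \<Longrightarrow> (\<Sum>i<n. deg_n n (x i) * q a i * g i) = 0) \<Longrightarrow>
      (\<Sum>i<n. g i * ker_avg n g (x i)) \<le> \<kappa> l * (\<Sum>i<n. deg_n n (x i) * (g i)\<^sup>2)"
proof -
  define es where "es = sorted_list_of_multiset (proots (char_poly (laplacian \<eta> n x)))"
  obtain w :: "nat \<Rightarrow> nat \<Rightarrow> real" where len: "length es = n" and sorted: "sorted es"
    and orth: "\<And>a b. a < n \<Longrightarrow> b < n \<Longrightarrow> (\<Sum>j<n. w a j * w b j) = (if a = b then 1 else 0)"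
    and compl: "\<And>i j. i < n \<Longrightarrow> j < n \<Longrightarrow> (\<Sum>a<n. w a i * w a j) = (if i = j then 1 else 0)"
    and eig: "\<And>a i. a < n \<Longrightarrow> i < n \<Longrightarrow> (\<Sum>j<n. laplacian \<eta> n x $$ (i, j) * w a j) = es ! a * w a i"
  proof (rule sorted_proots_char_poly_symmetric[OF laplacian_carrier[OF n] transpose_laplacian[OF n], folded es_def])
    fix w :: "nat \<Rightarrow> nat \<Rightarrow> real"
    assume "length es = n" "sorted es"
      "\<And>a b. a < n \<Longrightarrow> b < n \<Longrightarrow> (\<Sum>j<n. w a j * w b j) = (if a = b then 1 else 0)"
      "\<And>i j. i < n \<Longrightarrow> j < n \<Longrightarrow> (\<Sum>a<n. w a i * w a j) = (if i = j then 1 else 0)"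
      "\<And>a i. a < n \<Longrightarrow> i < n \<Longrightarrow> (\<Sum>j<n. laplacian \<eta> n x $$ (i, j) * w a j) = es ! a * w a i"
    then show thesis by (rule that)
  qed
  have \<kappa>: "\<kappa> a = 1 - es ! a" for a unfolding \<kappa>_def laplacian_eigenvalue_def es_def ..
  define d where "d i = deg_n n (x i)" for i
  have d: "d i > 0" for i unfolding d_def by (rule deg_n_pos[OF n])
  have dd: "sqrt (d i) * sqrt (d i) = d i" for i using d[of i] by simp
  \<comment> \<open>The factor \<open>sqrt (real n)\<close> makes the weighted mean, rather than the
    weighted sum, of the squares equal to 1, so that the normalization survives as an integral in
    the limit.\<close>
  define q where "q a j = sqrt (real n) * (w a j / sqrt (d j))" for a j
  show ?thesis
  proof (rule that[of q])
    fix a i assume a: "a < n" and i: "i < n"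
    have "ker_avg n (q a) (x i) = sqrt (real n) * ker_avg n (\<lambda>j. w a j / sqrt (deg_n n (x j))) (x i)"
      by (simp add: ker_avg_def q_def d_def sum_distrib_left ac_simps)
    also have "ker_avg n (\<lambda>j. w a j / sqrt (deg_n n (x j))) (x i) =
        (1 - es ! a) * deg_n n (x i) * (w a i / sqrt (deg_n n (x i)))"
      by (rule ker_avg_eigenvector) (use eig a i in auto)
    also have "sqrt (real n) * \<dots> = \<kappa> a * deg_n n (x i) * q a i" unfolding \<kappa> q_def d_def by simp
    finally show "ker_avg n (q a) (x i) = \<kappa> a * deg_n n (x i) * q a i" .
  next
    fix a b assume ab: "a < n" "b < n"
    have "(\<Sum>i<n. deg_n n (x i) * q a i * q b i) = (\<Sum>i<n. real n * (w a i * w b i))"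
    proof (intro sum.cong refl)
      fix i
      have "deg_n n (x i) * q a i * q b i = (sqrt (real n) * sqrt (real n)) * ((d i / (sqrt (d i) * sqrt (d i))) * (w a i * w b i))"
        unfolding q_def d_def by simp
      then show "deg_n n (x i) * q a i * q b i = real n * (w a i * w b i)" using d[of i] unfolding dd by simp
    qed
    then show "(\<Sum>i<n. deg_n n (x i) * q a i * q b i) / real n = (if a = b then 1 else 0)"
      using orth[OF ab] n by (simp flip: sum_distrib_left)
  next
    fix l and g :: "nat \<Rightarrow> real"
    assume l: "l < n" and perp: "\<And>a. a < l \<Longrightarrow> (\<Sum>i<n. deg_n n (x i) * q a i * g i) = 0"
    define G where "G j = sqrt (d j) * g j" for j
    define b where "b a = (\<Sum>j<n. w a j * G j)" for a
    have "b a = 0" if "a < l" for a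
    proof -
      have "(\<Sum>i<n. deg_n n (x i) * q a i * g i) = sqrt (real n) * b a"
        unfolding b_def sum_distrib_left
      proof (intro sum.cong refl)
        fix i
        have "deg_n n (x i) * q a i * g i = sqrt (real n) * (w a i * ((d i / sqrt (d i)) * g i))"
          unfolding q_def d_def[symmetric] by simp
        also have "d i / sqrt (d i) = sqrt (d i)" using d[of i] by (intro real_div_sqrt) simp
        finally show "deg_n n (x i) * q a i * g i = sqrt (real n) * (w a i * G i)" unfolding G_def .
      qed
      then show ?thesis using perp[OF that] n by simp
    qed
    have G: "G j = (\<Sum>a<n. b a * w a j)" if "j < n" for j
    proof -
      have "(\<Sum>a<n. b a * w a j) = (\<Sum>i<n. \<Sum>a<n. (w a i * w a j) * G i)"
        unfolding b_def sum_distrib_right by (subst sum.swap) (simp add: ac_simps)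
      also have "\<dots> = (\<Sum>i<n. (if i = j then 1 else 0) * G i)"
        unfolding sum_distrib_right[symmetric] using that by (intro sum.cong) (auto simp: compl)
      finally show ?thesis using that by (simp add: sum_kronecker_mult)
    qed
    \<comment> \<open>With \<open>c = 1\<close> this is Parseval's identity for the norm, with
      \<open>c = \<kappa>\<close> it diagonalizes the quadratic form.\<close>
    have expand: "(\<Sum>i<n. G i * (\<Sum>a<n. c a * b a * w a i)) = (\<Sum>a<n. c a * (b a)\<^sup>2)" for c
    proof -
      have "(\<Sum>i<n. G i * (\<Sum>a<n. c a * b a * w a i)) = (\<Sum>a<n. \<Sum>i<n. c a * b a * (w a i * G i))"
        unfolding sum_distrib_left by (subst sum.swap) (simp add: ac_simps)
      also have "\<dots> = (\<Sum>a<n. c a * (b a)\<^sup>2)"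
        unfolding sum_distrib_left[symmetric] b_def[symmetric] by (simp add: power2_eq_square ac_simps)
      finally show ?thesis .
    qed
    have "(\<Sum>i<n. deg_n n (x i) * (g i)\<^sup>2) = (\<Sum>i<n. G i * G i)"
    proof (intro sum.cong refl)
      fix i
      have "G i * G i = (sqrt (d i) * sqrt (d i)) * (g i)\<^sup>2" by (simp add: G_def power2_eq_square)
      then show "deg_n n (x i) * (g i)\<^sup>2 = G i * G i" unfolding d_def[symmetric] dd by simp
    qed
    also have "\<dots> = (\<Sum>i<n. G i * (\<Sum>a<n. 1 * b a * w a i))"
      by (intro sum.cong refl) (subst (2) G, auto)
    also have "\<dots> = (\<Sum>a<n. (b a)\<^sup>2)" unfolding expand by simp
    finally have norm: "(\<Sum>i<n. deg_n n (x i) * (g i)\<^sup>2) = (\<Sum>a<n. (b a)\<^sup>2)" .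
    let ?M = "\<lambda>i j. \<eta> (x i) (x j) / (real n * (sqrt (d i) * sqrt (d j)))"
    have "(\<Sum>i<n. g i * ker_avg n g (x i)) = (\<Sum>i<n. G i * (\<Sum>j<n. ?M i j * G j))"
      unfolding ker_avg_def sum_divide_distrib sum_distrib_left G_def using d
      by (intro sum.cong refl) (simp add: less_imp_neq[symmetric])
    also have "\<dots> = (\<Sum>i<n. G i * (\<Sum>a<n. \<kappa> a * b a * w a i))"
    proof (intro sum.cong refl)
      fix i assume "i \<in> {..<n}"
      then have i: "i < n" by simp
      have "(\<Sum>j<n. ?M i j * G j) = (\<Sum>j<n. \<Sum>a<n. b a * (?M i j * w a j))"
        by (intro sum.cong refl) (simp add: G sum_distrib_left sum_divide_distrib ac_simps)
      also have "\<dots> = (\<Sum>a<n. b a * (\<Sum>j<n. ?M i j * w a j))"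
        unfolding sum_distrib_left by (rule sum.swap)
      also have "\<dots> = (\<Sum>a<n. \<kappa> a * b a * w a i)"
        using normalized_kernel_sum[OF eig i] unfolding d_def \<kappa> by (intro sum.cong refl) simp
      finally show "G i * (\<Sum>j<n. ?M i j * G j) = G i * (\<Sum>a<n. \<kappa> a * b a * w a i)" by simp
    qed
    also have "\<dots> = (\<Sum>a<n. \<kappa> a * (b a)\<^sup>2)" by (rule expand)
    also have "\<dots> \<le> (\<Sum>a<n. \<kappa> l * (b a)\<^sup>2)"
    proof (rule sum_mono)
      fix a assume "a \<in> {..<n}"
      then show "\<kappa> a * (b a)\<^sup>2 \<le> \<kappa> l * (b a)\<^sup>2"
      proof (cases "a < l")
        case True
        then show ?thesis using \<open>\<And>a. a < l \<Longrightarrow> b a = 0\<close> by simp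
      next
        case False
        then have "es ! l \<le> es ! a" using sorted len \<open>a \<in> {..<n}\<close> by (intro sorted_nth_mono) auto
        then show ?thesis unfolding \<kappa> by (intro mult_right_mono) auto
      qed
    qed
    finally show "(\<Sum>i<n. g i * ker_avg n g (x i)) \<le> \<kappa> l * (\<Sum>i<n. deg_n n (x i) * (g i)\<^sup>2)"
      unfolding norm sum_distrib_left .
  qed
qed

section \<open>Spectral convergence\<close>

lemma mean_degree_eq_deg: "mean_degree \<eta> \<mu> = deg"
  by (intro ext) (simp add: mean_degree_def ker_int_def)

lemma limit_operator_eigen_iff:
  "limit_operator \<eta> \<mu> f y = s * f y \<longleftrightarrow>
     ker_int (\<lambda>z. f z / sqrt (deg z)) y = (1 - s) * deg y * (f y / sqrt (deg y))"
proof -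
  define d where "d = sqrt (deg y)"
  have d: "d > 0" "deg y = d * d" unfolding d_def using deg_pos[of y] by auto
  have "(\<integral>z. \<eta> y z / sqrt (deg y * deg z) * f z \<partial>\<mu>) = (\<integral>z. (1 / d) * (\<eta> y z * (f z / sqrt (deg z))) \<partial>\<mu>)"
    unfolding d_def by (intro Bochner_Integration.integral_cong) (auto simp: real_sqrt_mult)
  also have "\<dots> = (1 / d) * ker_int (\<lambda>z. f z / sqrt (deg z)) y"
    unfolding ker_int_def[of "\<lambda>z. f z / sqrt (deg z)"] by (rule integral_mult_right_zero)
  finally have "limit_operator \<eta> \<mu> f y = f y - (1 / d) * ker_int (\<lambda>z. f z / sqrt (deg z)) y"
    unfolding limit_operator_def mean_degree_eq_deg by simp
  then have K: "ker_int (\<lambda>z. f z / sqrt (deg z)) y = d * (f y - limit_operator \<eta> \<mu> f y)"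
    using d(1) by simp
  have "(1 - s) * deg y * (f y / sqrt (deg y)) = d * (f y - s * f y)"
    unfolding d_def[symmetric] d(2) using d(1) by (simp add: algebra_simps)
  then show ?thesis unfolding K using d(1) by auto
qed

lemma sqrt_deg_continuous: "continuous_on UNIV (\<lambda>y. sqrt (deg y))"
  by (intro continuous_intros deg_continuous)

text \<open>Bounding the eigenvalue equation entry by entry and averaging compares the mean
  \<open>m\<close> of \<open>\<bar>q i\<bar>\<close> with itself, and \<open>m > 0\<close> can be
  cancelled. The bound is crude, but independent of \<open>n\<close>, which is enough to extract
  convergent subsequences.\<close>

lemma laplacian_eigenvalue_bound:
  assumes "l < n"
  shows "\<bar>1 - laplacian_eigenvalue \<eta> n x l\<bar> \<le> c_max / c_min"
proof -
  have n: "n > 0" using assms by simp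
  define \<kappa> where "\<kappa> = 1 - laplacian_eigenvalue \<eta> n x l"
  obtain q where eig: "\<And>i. i < n \<Longrightarrow> ker_avg n q (x i) = \<kappa> * deg_n n (x i) * q i"
    and nrm: "(\<Sum>i<n. deg_n n (x i) * q i * q i) / real n = 1"
  proof (rule laplacian_spectrum[OF n])
    fix q :: "nat \<Rightarrow> nat \<Rightarrow> real"
    assume "\<And>a i. a < n \<Longrightarrow> i < n \<Longrightarrow> ker_avg n (q a) (x i) = (1 - laplacian_eigenvalue \<eta> n x a) * deg_n n (x i) * q a i"
      "\<And>a b. a < n \<Longrightarrow> b < n \<Longrightarrow> (\<Sum>i<n. deg_n n (x i) * q a i * q b i) / real n = (if a = b then 1 else 0)"
    then show thesis using assms by (intro that[of "q l"]) (auto simp: \<kappa>_def)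
  qed
  define m where "m = (\<Sum>i<n. \<bar>q i\<bar>) / real n"
  have "m > 0"
  proof (rule ccontr)
    assume "\<not> m > 0"
    moreover have "(\<Sum>i<n. \<bar>q i\<bar>) \<ge> 0" by (simp add: sum_nonneg)
    ultimately have "(\<Sum>i<n. \<bar>q i\<bar>) = 0" unfolding m_def using n by (simp add: zero_less_divide_iff)
    then have "\<forall>i<n. q i = 0" by (subst (asm) sum_nonneg_eq_0_iff) auto
    then show False using nrm by simp
  qed
  have "\<bar>\<kappa>\<bar> * c_min * \<bar>q i\<bar> \<le> c_max * m" if "i < n" for i
  proof -
    have "\<bar>\<kappa>\<bar> * c_min * \<bar>q i\<bar> \<le> \<bar>\<kappa>\<bar> * deg_n n (x i) * \<bar>q i\<bar>"
      using deg_n_bounds(1)[OF n] by (intro mult_right_mono mult_left_mono) auto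
    also have "\<dots> = \<bar>ker_avg n q (x i)\<bar>" unfolding eig[OF that] using deg_n_pos[OF n, of "x i"] by (simp add: abs_mult)
    also have "\<dots> \<le> c_max * m" unfolding m_def by (rule abs_ker_avg_le)
    finally show ?thesis .
  qed
  then have "(\<Sum>i<n. \<bar>\<kappa>\<bar> * c_min * \<bar>q i\<bar>) \<le> (\<Sum>i<n. c_max * m)" by (intro sum_mono) auto
  then have "(\<bar>\<kappa>\<bar> * c_min) * (\<Sum>i<n. \<bar>q i\<bar>) \<le> (c_max * m) * real n" by (simp add: sum_distrib_left mult.commute)
  then have "(\<bar>\<kappa>\<bar> * c_min) * m \<le> c_max * m" unfolding m_def using n by (simp add: field_simps)
  then have "\<bar>\<kappa>\<bar> * c_min \<le> c_max" using \<open>m > 0\<close> by simp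
  then show ?thesis unfolding \<kappa>_def using c_min(1) by (simp add: pos_le_divide_eq)
qed

text \<open>Separates the coefficients of a trial vector from matrices of the fixed size
  \<open>l + 1\<close>, whose entries, divided by \<open>n\<close>, converge when the
  \<open>p a\<close> come from fixed continuous functions.\<close>

lemma quadratic_form_expand:
  fixes c :: "nat \<Rightarrow> real" and p :: "nat \<Rightarrow> nat \<Rightarrow> real" and l :: nat
  defines "g \<equiv> \<lambda>i. \<Sum>a\<le>l. c a * p a i"
  shows "(\<Sum>i<n. g i * ker_avg n g (x i)) = (\<Sum>a\<le>l. \<Sum>b\<le>l. c a * c b * (\<Sum>i<n. p a i * ker_avg n (p b) (x i)))"
    and "(\<Sum>i<n. deg_n n (x i) * (g i)\<^sup>2) = (\<Sum>a\<le>l. \<Sum>b\<le>l. c a * c b * (\<Sum>i<n. deg_n n (x i) * p a i * p b i))"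
proof -
  have ka: "ker_avg n g y = (\<Sum>b\<le>l. c b * ker_avg n (p b) y)" for y
  proof -
    have "(\<Sum>j<n. \<eta> y (x j) * g j) = (\<Sum>b\<le>l. \<Sum>j<n. \<eta> y (x j) * (c b * p b j))"
      unfolding g_def sum_distrib_left by (rule sum.swap)
    then show ?thesis
      unfolding ker_avg_def[of n g] ker_avg_def[of n "p _"]
      by (simp add: sum_divide_distrib sum_distrib_left ac_simps)
  qed
  have "(\<Sum>i<n. g i * ker_avg n g (x i)) = (\<Sum>i<n. \<Sum>a\<le>l. \<Sum>b\<le>l. c a * c b * (p a i * ker_avg n (p b) (x i)))"
    unfolding ka unfolding g_def sum_product by (intro sum.cong refl) (simp add: ac_simps)
  also have "\<dots> = (\<Sum>a\<le>l. \<Sum>i<n. \<Sum>b\<le>l. c a * c b * (p a i * ker_avg n (p b) (x i)))" by (rule sum.swap)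
  also have "\<dots> = (\<Sum>a\<le>l. \<Sum>b\<le>l. \<Sum>i<n. c a * c b * (p a i * ker_avg n (p b) (x i)))"
    by (intro sum.cong refl sum.swap)
  finally show "(\<Sum>i<n. g i * ker_avg n g (x i)) = (\<Sum>a\<le>l. \<Sum>b\<le>l. c a * c b * (\<Sum>i<n. p a i * ker_avg n (p b) (x i)))"
    by (simp only: sum_distrib_left)
  have "(\<Sum>i<n. deg_n n (x i) * (g i)\<^sup>2) = (\<Sum>i<n. \<Sum>a\<le>l. \<Sum>b\<le>l. c a * c b * (deg_n n (x i) * p a i * p b i))"
  proof (intro sum.cong refl)
    fix i
    have "deg_n n (x i) * (g i)\<^sup>2 = deg_n n (x i) * (\<Sum>a\<le>l. \<Sum>b\<le>l. (c a * p a i) * (c b * p b i))"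
      unfolding g_def power2_eq_square sum_product ..
    also have "\<dots> = (\<Sum>a\<le>l. \<Sum>b\<le>l. c a * c b * (deg_n n (x i) * p a i * p b i))"
      unfolding sum_distrib_left by (intro sum.cong refl) (simp only: ac_simps)
    finally show "deg_n n (x i) * (g i)\<^sup>2 = (\<Sum>a\<le>l. \<Sum>b\<le>l. c a * c b * (deg_n n (x i) * p a i * p b i))" .
  qed
  also have "\<dots> = (\<Sum>a\<le>l. \<Sum>i<n. \<Sum>b\<le>l. c a * c b * (deg_n n (x i) * p a i * p b i))" by (rule sum.swap)
  also have "\<dots> = (\<Sum>a\<le>l. \<Sum>b\<le>l. \<Sum>i<n. c a * c b * (deg_n n (x i) * p a i * p b i))"
    by (intro sum.cong refl sum.swap)
  finally show "(\<Sum>i<n. deg_n n (x i) * (g i)\<^sup>2) = (\<Sum>a\<le>l. \<Sum>b\<le>l. c a * c b * (\<Sum>i<n. deg_n n (x i) * p a i * p b i))"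
    by (simp only: sum_distrib_left)
qed

end

section \<open>Comparison of the sample spectrum with the simple eigenvalues of the limit\<close>

locale spectral_limit = sample_kernel x \<mu> \<eta>
  for x :: "nat \<Rightarrow> 'm::second_countable_topology" and \<mu> \<eta> +
  fixes k :: nat and \<sigma> :: "nat \<Rightarrow> real" and f :: "nat \<Rightarrow> 'm \<Rightarrow> real"
  assumes first: "first_eigenvalues_simple (limit_operator \<eta> \<mu>) k \<sigma>"
    and f: "\<And>l. l < k \<Longrightarrow> eigenfunction (limit_operator \<eta> \<mu>) (f l) (\<sigma> l)"
    and \<sigma>_less_1: "\<And>l. l < k \<Longrightarrow> \<sigma> l < 1"
begin

text \<open>The eigenfunction in the variables without square roots. Correspondingly,
  \<open>\<theta>\<close> and \<open>\<kappa>\<close> are eigenvalues of normalized averaging, so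
  the smallest eigenvalues of the Laplacian become the largest ones here.\<close>

definition \<phi> :: "nat \<Rightarrow> 'm \<Rightarrow> real" where "\<phi> l y = f l y / sqrt (deg y)"
definition \<theta> :: "nat \<Rightarrow> real" where "\<theta> l = 1 - \<sigma> l"
definition \<kappa> :: "nat \<Rightarrow> nat \<Rightarrow> real" where "\<kappa> n l = 1 - laplacian_eigenvalue \<eta> n x l"

lemma \<theta>_pos: "l < k \<Longrightarrow> \<theta> l > 0" unfolding \<theta>_def using \<sigma>_less_1 by simp

lemma \<theta>_strict: "a < b \<Longrightarrow> b < k \<Longrightarrow> \<theta> b < \<theta> a"
  using first unfolding first_eigenvalues_simple_def \<theta>_def strict_mono_on_def by auto

lemma \<theta>_mono: "a \<le> b \<Longrightarrow> b < k \<Longrightarrow> \<theta> b \<le> \<theta> a"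
  using \<theta>_strict[of a b] by (cases "a = b") auto

lemma f_continuous: "l < k \<Longrightarrow> continuous_on UNIV (f l)"
  using f unfolding eigenfunction_def by blast

lemma \<phi>_continuous: "l < k \<Longrightarrow> continuous_on UNIV (\<phi> l)"
  unfolding \<phi>_def using deg_pos
  by (intro continuous_intros f_continuous deg_continuous) (auto simp: less_imp_neq[symmetric])

lemma \<phi>_eigen: "l < k \<Longrightarrow> ker_int (\<phi> l) y = \<theta> l * deg y * \<phi> l y"
  using f[of l] limit_operator_eigen_iff[of "f l" y "\<sigma> l"]
  unfolding eigenfunction_def \<phi>_def[abs_def] \<theta>_def by metis

lemma eigenfunction_of_ker_int:
  assumes cont: "continuous_on UNIV \<psi>" and nz: "\<psi> z \<noteq> 0" and eig: "\<And>y. ker_int \<psi> y = \<tau> * deg y * \<psi> y"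
  shows "eigenfunction (limit_operator \<eta> \<mu>) (\<lambda>y. sqrt (deg y) * \<psi> y) (1 - \<tau>)"
  unfolding eigenfunction_def
proof (intro conjI)
  show "continuous_on UNIV (\<lambda>y. sqrt (deg y) * \<psi> y)" by (intro continuous_intros sqrt_deg_continuous cont)
  have s: "sqrt (deg y) \<noteq> 0" for y using deg_pos[of y] by simp
  then show "(\<lambda>y. sqrt (deg y) * \<psi> y) \<noteq> (\<lambda>x. 0)" using nz by (auto simp: fun_eq_iff)
  have "(\<lambda>z. sqrt (deg z) * \<psi> z / sqrt (deg z)) = \<psi>" using s by simp
  then show "limit_operator \<eta> \<mu> (\<lambda>y. sqrt (deg y) * \<psi> y) = (\<lambda>y. (1 - \<tau>) * (sqrt (deg y) * \<psi> y))"
    using s eig by (intro ext) (subst limit_operator_eigen_iff, simp)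
qed

text \<open>Simplicity supplies some generator of the eigenspace; being nonzero, the prescribed
  \<open>f l\<close> is a nonzero multiple of it and generates as well.\<close>

lemma eigenspace_f:
  assumes l: "l < k" and g: "eigenfunction (limit_operator \<eta> \<mu>) g (\<sigma> l)"
  obtains c where "g = (\<lambda>y. c * f l y)"
proof -
  obtain f0 where f0: "\<And>g. eigenfunction (limit_operator \<eta> \<mu>) g (\<sigma> l) \<Longrightarrow> \<exists>c. g = (\<lambda>x. c * f0 x)"
    using first l unfolding first_eigenvalues_simple_def simple_eigenvalue_def by meson
  obtain a where a: "g = (\<lambda>x. a * f0 x)" using f0[OF g] by blast
  obtain b where b: "f l = (\<lambda>x. b * f0 x)" using f0[OF f[OF l]] by blast
  have "f l \<noteq> (\<lambda>x. 0)" using f[OF l] unfolding eigenfunction_def by blast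
  then have "b \<noteq> 0" using b by auto
  then have "g = (\<lambda>y. (a / b) * f l y)" unfolding a b by simp
  then show ?thesis by (rule that)
qed

text \<open>An eigenvalue of the limiting operator outside the list exceeds every
  \<open>\<sigma> l\<close>. Since \<open>1 - \<tau> \<le> \<sigma> l\<close>, this one is listed,
  and strict monotonicity bounds its index.\<close>

lemma large_eigenvalue_cases:
  assumes "continuous_on UNIV \<psi>" "\<psi> z \<noteq> 0" "\<And>y. ker_int \<psi> y = \<tau> * deg y * \<psi> y" "l < k" "\<tau> \<ge> \<theta> l"
  obtains m where "m \<le> l" "\<tau> = \<theta> m"
proof -
  have "1 - \<tau> \<in> \<sigma> ` {..<k}"
    using eigenfunction_of_ker_int[OF assms(1-3)] first assms(4,5)
    unfolding first_eigenvalues_simple_def \<theta>_def by force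
  then obtain m where m: "m < k" "\<tau> = \<theta> m" unfolding \<theta>_def by auto
  then have "m \<le> l" using \<theta>_strict[of l m] assms(5) by fastforce
  then show ?thesis using m that by blast
qed

definition gram :: "nat \<Rightarrow> nat \<Rightarrow> real" where "gram a b = (\<integral>y. deg y * \<phi> a y * \<phi> b y \<partial>\<mu>)"

lemma gram_orthogonal:
  assumes "a < k" "b < k" "a \<noteq> b"
  shows "gram a b = 0"
proof -
  have "(\<integral>y. \<phi> a y * ker_int (\<phi> b) y \<partial>\<mu>) = \<theta> b * gram a b"
    unfolding gram_def \<phi>_eigen[OF assms(2)] by (subst integral_mult_right_zero[symmetric]) (simp add: ac_simps)
  moreover have "(\<integral>y. \<phi> b y * ker_int (\<phi> a) y \<partial>\<mu>) = \<theta> a * gram a b"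
    unfolding gram_def \<phi>_eigen[OF assms(1)] by (subst integral_mult_right_zero[symmetric]) (simp add: ac_simps)
  ultimately have "\<theta> b * gram a b = \<theta> a * gram a b"
    using ker_int_symmetric[OF \<phi>_continuous \<phi>_continuous] assms by metis
  moreover have "\<theta> a \<noteq> \<theta> b" using \<theta>_strict[of a b] \<theta>_strict[of b a] assms by (cases a b rule: linorder_cases) auto
  ultimately show ?thesis by simp
qed

lemma gram_pos:
  assumes "a < k"
  shows "gram a a > 0"
proof -
  have "f a \<noteq> (\<lambda>x. 0)" using f[OF assms] unfolding eigenfunction_def by blast
  then obtain z where "f a z \<noteq> 0" by auto
  then have "\<phi> a z \<noteq> 0" unfolding \<phi>_def using deg_pos[of z] by simp
  show ?thesis unfolding gram_def
  proof (rule integral_pos[of _ z])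
    show "continuous_on UNIV (\<lambda>y. deg y * \<phi> a y * \<phi> a y)"
      by (intro continuous_intros deg_continuous \<phi>_continuous[OF assms])
    show "deg y * \<phi> a y * \<phi> a y \<ge> 0" for y using deg_pos[of y] by (simp add: mult.assoc)
    show "deg z * \<phi> a z * \<phi> a z > 0" using deg_pos[of z] \<open>\<phi> a z \<noteq> 0\<close> by (simp add: mult.assoc zero_less_mult_iff flip: power2_eq_square)
  qed
qed

text \<open>
  Courant-Fischer with the trial space spanned by \<open>\<phi> 0, \<dots>, \<phi> l\<close> restricted to the sample.
\<close>

lemma \<kappa>_limit_lower_bound:
  assumes l: "l < k" and N: "filterlim N at_top sequentially" and lN: "\<And>n. l < N n" and lim: "(\<lambda>n. \<kappa> (N n) l) \<longlonglongrightarrow> \<tau>"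
  shows "\<theta> l \<le> \<tau>"
proof -
  have "\<exists>c. (\<Sum>a\<le>l. (c a)\<^sup>2) = 1 \<and>
     (\<Sum>a\<le>l. \<Sum>b\<le>l. c a * c b * ((\<Sum>i<n. \<phi> a (x i) * ker_avg n (\<lambda>j. \<phi> b (x j)) (x i)) / real n))
     \<le> \<kappa> n l * (\<Sum>a\<le>l. \<Sum>b\<le>l. c a * c b * ((\<Sum>i<n. deg_n n (x i) * \<phi> a (x i) * \<phi> b (x i)) / real n))"
    if n: "l < n" for n
  proof -
    have n0: "n > 0" using n by simp
    obtain q where minmax: "\<And>g. (\<And>a. a < l \<Longrightarrow> (\<Sum>i<n. deg_n n (x i) * q a i * g i) = 0) \<Longrightarrow>
      (\<Sum>i<n. g i * ker_avg n g (x i)) \<le> \<kappa> n l * (\<Sum>i<n. deg_n n (x i) * (g i)\<^sup>2)"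
    proof (rule laplacian_spectrum[OF n0])
      fix q :: "nat \<Rightarrow> nat \<Rightarrow> real"
      assume "\<And>l g. l < n \<Longrightarrow> (\<And>a. a < l \<Longrightarrow> (\<Sum>i<n. deg_n n (x i) * q a i * g i) = 0) \<Longrightarrow>
        (\<Sum>i<n. g i * ker_avg n g (x i)) \<le> (1 - laplacian_eigenvalue \<eta> n x l) * (\<Sum>i<n. deg_n n (x i) * (g i)\<^sup>2)"
      from this[OF n] show thesis unfolding \<kappa>_def[symmetric] by (rule that)
    qed
    \<comment> \<open>The trial space has dimension \<open>l + 1\<close>, and orthogonality to the
      first \<open>l\<close> sample eigenvectors imposes only \<open>l\<close> conditions.\<close>
    obtain c where c: "(\<Sum>a\<le>l. (c a)\<^sup>2) = 1"
      and perp: "\<And>m. m < l \<Longrightarrow> (\<Sum>a\<le>l. (\<Sum>i<n. deg_n n (x i) * q m i * \<phi> a (x i)) * c a) = 0"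
    proof (rule homogeneous_system_nontrivial[of l "\<lambda>m a. \<Sum>i<n. deg_n n (x i) * q m i * \<phi> a (x i)"])
      fix c :: "nat \<Rightarrow> real"
      assume "(\<Sum>a\<le>l. (c a)\<^sup>2) = 1" "\<And>m. m < l \<Longrightarrow> (\<Sum>a\<le>l. (\<Sum>i<n. deg_n n (x i) * q m i * \<phi> a (x i)) * c a) = 0"
      then show thesis by (rule that)
    qed
    define g where "g i = (\<Sum>a\<le>l. c a * \<phi> a (x i))" for i
    have "(\<Sum>i<n. deg_n n (x i) * q m i * g i) = 0" if "m < l" for m
    proof -
      have "(\<Sum>i<n. deg_n n (x i) * q m i * g i) = (\<Sum>i<n. \<Sum>a\<le>l. deg_n n (x i) * q m i * \<phi> a (x i) * c a)"
        unfolding g_def sum_distrib_left by (intro sum.cong refl) (simp only: ac_simps)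
      also have "\<dots> = (\<Sum>a\<le>l. (\<Sum>i<n. deg_n n (x i) * q m i * \<phi> a (x i)) * c a)"
        unfolding sum_distrib_right by (rule sum.swap)
      finally show ?thesis using perp[OF that] by simp
    qed
    from minmax[OF this] have "(\<Sum>a\<le>l. \<Sum>b\<le>l. c a * c b * (\<Sum>i<n. \<phi> a (x i) * ker_avg n (\<lambda>j. \<phi> b (x j)) (x i)))
      \<le> \<kappa> n l * (\<Sum>a\<le>l. \<Sum>b\<le>l. c a * c b * (\<Sum>i<n. deg_n n (x i) * \<phi> a (x i) * \<phi> b (x i)))"
      unfolding g_def quadratic_form_expand .
    \<comment> \<open>After division by \<open>n\<close> the matrix entries are averages over the
      sample and have limits.\<close>
    then have "(\<Sum>a\<le>l. \<Sum>b\<le>l. c a * c b * (\<Sum>i<n. \<phi> a (x i) * ker_avg n (\<lambda>j. \<phi> b (x j)) (x i))) / real n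
      \<le> \<kappa> n l * (\<Sum>a\<le>l. \<Sum>b\<le>l. c a * c b * (\<Sum>i<n. deg_n n (x i) * \<phi> a (x i) * \<phi> b (x i))) / real n"
      by (rule divide_right_mono) simp
    then show ?thesis
      using c by (intro exI[of _ c]) (simp only: times_divide_eq_right sum_divide_distrib[symmetric] simp_thms)
  qed
  then have "\<forall>n. \<exists>c. (\<Sum>a\<le>l. (c a)\<^sup>2) = 1 \<and>
     (\<Sum>a\<le>l. \<Sum>b\<le>l. c a * c b * ((\<Sum>i<N n. \<phi> a (x i) * ker_avg (N n) (\<lambda>j. \<phi> b (x j)) (x i)) / real (N n)))
     \<le> \<kappa> (N n) l * (\<Sum>a\<le>l. \<Sum>b\<le>l. c a * c b * ((\<Sum>i<N n. deg_n (N n) (x i) * \<phi> a (x i) * \<phi> b (x i)) / real (N n)))"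
    using lN by blast
  from choice[OF this] obtain c where c1: "\<And>n. (\<Sum>a\<le>l. (c n a)\<^sup>2) = 1"
    and ineq: "\<And>n. (\<Sum>a\<le>l. \<Sum>b\<le>l. c n a * c n b * ((\<Sum>i<N n. \<phi> a (x i) * ker_avg (N n) (\<lambda>j. \<phi> b (x j)) (x i)) / real (N n)))
     \<le> \<kappa> (N n) l * (\<Sum>a\<le>l. \<Sum>b\<le>l. c n a * c n b * ((\<Sum>i<N n. deg_n (N n) (x i) * \<phi> a (x i) * \<phi> b (x i)) / real (N n)))"
    by blast
  have cb: "\<bar>c n a\<bar> \<le> 1" if "a \<le> l" for n a
  proof -
    have "(c n a)\<^sup>2 \<le> (\<Sum>a\<le>l. (c n a)\<^sup>2)" using that by (intro member_le_sum) auto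
    then show ?thesis unfolding c1 by (simp add: abs_square_le_1)
  qed
  have "\<exists>r. strict_mono r \<and> (\<forall>a<Suc l. convergent (\<lambda>n. c ((id \<circ> r) n) a))"
  proof (rule common_subsequence)
    fix a and s :: "nat \<Rightarrow> nat" assume a: "a < Suc l" and "strict_mono s"
    obtain m r where "strict_mono r" "((\<lambda>n. c (s n) a) \<circ> r) \<longlonglongrightarrow> m"
      by (rule bounded_real_subsequence[of "\<lambda>n. c (s n) a" 1]) (use cb a in auto)
    then show "\<exists>r. strict_mono r \<and> convergent (\<lambda>n. c ((s \<circ> r) n) a)"
      by (auto simp: convergent_def comp_def)
  next
    fix a and s r :: "nat \<Rightarrow> nat" assume r: "strict_mono r" and "convergent (\<lambda>n. c (s n) a)"
    then obtain L where "(\<lambda>n. c (s n) a) \<longlonglongrightarrow> L" unfolding convergent_def by blast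
    from LIMSEQ_subseq_LIMSEQ[OF this r]
    show "convergent (\<lambda>n. c ((s \<circ> r) n) a)" by (auto simp: comp_def convergent_def)
  qed (rule strict_mono_id)
  then obtain r where r: "strict_mono r" and "\<forall>a<Suc l. convergent (\<lambda>n. c (r n) a)" by auto
  then have "\<forall>a. \<exists>m. a < Suc l \<longrightarrow> (\<lambda>n. c (r n) a) \<longlonglongrightarrow> m" unfolding convergent_def by blast
  from choice[OF this] obtain e where e: "\<And>a. a \<le> l \<Longrightarrow> (\<lambda>n. c (r n) a) \<longlonglongrightarrow> e a"
    by (auto simp: less_Suc_eq_le)
  have Nr: "filterlim (\<lambda>n. N (r n)) at_top sequentially"
    using filterlim_compose[OF N filterlim_subseq[OF r]] .
  have \<tau>: "(\<lambda>n. \<kappa> (N (r n)) l) \<longlonglongrightarrow> \<tau>" using LIMSEQ_subseq_LIMSEQ[OF lim r] by (simp add: comp_def)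
  have A: "(\<lambda>n. (\<Sum>i<N (r n). \<phi> a (x i) * ker_avg (N (r n)) (\<lambda>j. \<phi> b (x j)) (x i)) / real (N (r n))) \<longlonglongrightarrow> \<theta> b * gram a b"
    if "a \<le> l" "b \<le> l" for a b
  proof -
    have ab: "a < k" "b < k" using that l by auto
    have "(\<integral>y. \<phi> a y * ker_int (\<phi> b) y \<partial>\<mu>) = \<theta> b * gram a b"
      unfolding gram_def \<phi>_eigen[OF ab(2)] by (subst integral_mult_right_zero[symmetric]) (simp add: ac_simps)
    then show ?thesis
      using average_ker_avg_tendsto[OF Nr sample_limit_const \<phi>_continuous[OF ab(1)] sample_limit_const \<phi>_continuous[OF ab(2)]] by simp
  qed
  have B: "(\<lambda>n. (\<Sum>i<N (r n). deg_n (N (r n)) (x i) * \<phi> a (x i) * \<phi> b (x i)) / real (N (r n))) \<longlonglongrightarrow> gram a b"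
    if "a \<le> l" "b \<le> l" for a b
  proof -
    have ab: "continuous_on UNIV (\<phi> a)" "continuous_on UNIV (\<phi> b)" using that l by (auto intro!: \<phi>_continuous)
    note m1 = sample_limit_mult[OF deg_sample_limit[OF Nr] sample_limit_const deg_continuous ab(1)]
    have c: "continuous_on UNIV (\<lambda>y. deg y * \<phi> a y)" by (intro continuous_intros deg_continuous ab)
    note m2 = sample_limit_mult[OF m1 sample_limit_const c ab(2)]
    show ?thesis unfolding gram_def
      by (rule average_sample_limit[OF Nr m2]) (intro continuous_intros c ab)
  qed
  have "(\<Sum>a\<le>l. \<Sum>b\<le>l. e a * e b * (\<theta> b * gram a b)) \<le> \<tau> * (\<Sum>a\<le>l. \<Sum>b\<le>l. e a * e b * gram a b)"
  proof (rule LIMSEQ_le)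
    show "(\<lambda>n. \<Sum>a\<le>l. \<Sum>b\<le>l. c (r n) a * c (r n) b * ((\<Sum>i<N (r n). \<phi> a (x i) * ker_avg (N (r n)) (\<lambda>j. \<phi> b (x j)) (x i)) / real (N (r n))))
      \<longlonglongrightarrow> (\<Sum>a\<le>l. \<Sum>b\<le>l. e a * e b * (\<theta> b * gram a b))"
      by (intro tendsto_sum tendsto_mult A e) auto
    show "(\<lambda>n. \<kappa> (N (r n)) l * (\<Sum>a\<le>l. \<Sum>b\<le>l. c (r n) a * c (r n) b * ((\<Sum>i<N (r n). deg_n (N (r n)) (x i) * \<phi> a (x i) * \<phi> b (x i)) / real (N (r n)))))
      \<longlonglongrightarrow> \<tau> * (\<Sum>a\<le>l. \<Sum>b\<le>l. e a * e b * gram a b)"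
      by (intro tendsto_sum tendsto_mult B e \<tau>) auto
  qed (use ineq in blast)
  \<comment> \<open>Orthogonality removes the mixed terms on both sides: \<open>h = \<theta>\<close>
    on the left, \<open>h = 1\<close> on the right.\<close>
  moreover have diag: "(\<Sum>a\<le>l. \<Sum>b\<le>l. e a * e b * (h b * gram a b)) = (\<Sum>a\<le>l. (e a)\<^sup>2 * (h a * gram a a))" for h :: "nat \<Rightarrow> real"
  proof (intro sum.cong refl)
    fix a assume "a \<in> {..l}"
    then have "(\<Sum>b\<le>l. e a * e b * (h b * gram a b)) = (\<Sum>b\<le>l. if a = b then (e a)\<^sup>2 * (h a * gram a a) else 0)"
      using l by (intro sum.cong refl) (auto simp: gram_orthogonal power2_eq_square)
    then show "(\<Sum>b\<le>l. e a * e b * (h b * gram a b)) = (e a)\<^sup>2 * (h a * gram a a)" using \<open>a \<in> {..l}\<close> by simp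
  qed
  ultimately have le: "(\<Sum>a\<le>l. (e a)\<^sup>2 * (\<theta> a * gram a a)) \<le> \<tau> * (\<Sum>a\<le>l. (e a)\<^sup>2 * gram a a)"
    using diag[of "\<lambda>_. 1"] by simp
  have gp: "gram a a > 0" if "a \<le> l" for a using that l by (intro gram_pos) auto
  have "\<theta> l * (\<Sum>a\<le>l. (e a)\<^sup>2 * gram a a) \<le> (\<Sum>a\<le>l. (e a)\<^sup>2 * (\<theta> a * gram a a))"
    unfolding sum_distrib_left
  proof (rule sum_mono)
    fix a assume a: "a \<in> {..l}"
    then have "\<theta> l * ((e a)\<^sup>2 * gram a a) \<le> \<theta> a * ((e a)\<^sup>2 * gram a a)"
      using \<theta>_mono[of a l] l gp[of a] by (intro mult_right_mono) auto
    then show "\<theta> l * ((e a)\<^sup>2 * gram a a) \<le> (e a)\<^sup>2 * (\<theta> a * gram a a)" by (simp add: ac_simps)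
  qed
  also note le
  finally have *: "\<theta> l * (\<Sum>a\<le>l. (e a)\<^sup>2 * gram a a) \<le> \<tau> * (\<Sum>a\<le>l. (e a)\<^sup>2 * gram a a)" .
  \<comment> \<open>The normalization of the coefficients persists in the limit, so the weighted
    norm is positive and can be cancelled.\<close>
  have "(\<lambda>n. \<Sum>a\<le>l. (c (r n) a)\<^sup>2) \<longlonglongrightarrow> (\<Sum>a\<le>l. (e a)\<^sup>2)" by (intro tendsto_sum tendsto_power e) auto
  then have "(\<Sum>a\<le>l. (e a)\<^sup>2) = 1" unfolding c1 by (simp add: LIMSEQ_const_iff)
  then obtain a where a: "a \<le> l" "e a \<noteq> 0" by (metis (no_types, lifting) atMost_iff power_zero_numeral sum.neutral zero_neq_one)
  then have "(\<Sum>a\<le>l. (e a)\<^sup>2 * gram a a) > 0" using gp by (intro sum_pos2[of _ a]) (simp_all add: less_imp_le)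
  with * show ?thesis by simp
qed

text \<open>
  For the upper bound, limits of the first \<open>k\<close> orthonormal eigenvectors are orthonormal eigenfunctions
  for large eigenvalues of the limiting operator; as these are simple, the limit eigenvalues are
  distinct, and the lower bound leaves no room for a shift of the index.
\<close>

lemma \<kappa>_subsequence:
  assumes s: "strict_mono (s :: nat \<Rightarrow> nat)" and sk: "\<And>n. s n \<ge> k"
  obtains r where "strict_mono r" "\<forall>l<k. (\<lambda>n. \<kappa> (s (r n)) l) \<longlonglongrightarrow> \<theta> l"
proof (cases "k = 0")
  case True
  then show ?thesis using that[OF strict_mono_id] by simp
next
  case False
  have "\<exists>r. strict_mono r \<and> (\<forall>l<k. convergent (\<lambda>n. \<kappa> (s ((id \<circ> r) n)) l))"
  proof (rule common_subsequence)
    fix l and t :: "nat \<Rightarrow> nat" assume l: "l < k" and "strict_mono t"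
    have "\<bar>\<kappa> (s (t n)) l\<bar> \<le> c_max / c_min" for n
      unfolding \<kappa>_def using sk[of "t n"] l by (intro laplacian_eigenvalue_bound) auto
    then obtain m r where "strict_mono r" "((\<lambda>n. \<kappa> (s (t n)) l) \<circ> r) \<longlonglongrightarrow> m"
      by (rule bounded_real_subsequence[of "\<lambda>n. \<kappa> (s (t n)) l"])
    then show "\<exists>r. strict_mono r \<and> convergent (\<lambda>n. \<kappa> (s ((t \<circ> r) n)) l)"
      by (auto simp: convergent_def comp_def)
  next
    fix l and t r :: "nat \<Rightarrow> nat" assume r: "strict_mono r" and "convergent (\<lambda>n. \<kappa> (s (t n)) l)"
    then obtain L where "(\<lambda>n. \<kappa> (s (t n)) l) \<longlonglongrightarrow> L" unfolding convergent_def by blast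
    from LIMSEQ_subseq_LIMSEQ[OF this r]
    show "convergent (\<lambda>n. \<kappa> (s ((t \<circ> r) n)) l)" by (auto simp: comp_def convergent_def)
  qed (rule strict_mono_id)
  then obtain r where r: "strict_mono r" and "\<forall>l<k. convergent (\<lambda>n. \<kappa> (s (r n)) l)" by auto
  then have "\<forall>l. \<exists>m. l < k \<longrightarrow> (\<lambda>n. \<kappa> (s (r n)) l) \<longlonglongrightarrow> m" unfolding convergent_def by blast
  from choice[OF this] obtain \<tau> where \<tau>: "\<And>l. l < k \<Longrightarrow> (\<lambda>n. \<kappa> (s (r n)) l) \<longlonglongrightarrow> \<tau> l" by auto
  define N where "N n = s (r n)" for n
  have Nm: "strict_mono N" unfolding N_def using s r by (auto simp: strict_mono_def)
  have N: "filterlim N at_top sequentially" by (rule filterlim_subseq[OF Nm])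
  have Nk: "N n \<ge> k" for n unfolding N_def using sk .
  have N0: "N n > 0" for n using Nk[of n] False by simp
  have \<tau>N: "(\<lambda>n. \<kappa> (N n) l) \<longlonglongrightarrow> \<tau> l" if "l < k" for l using \<tau>[OF that] unfolding N_def .
  have \<tau>_ge: "\<theta> l \<le> \<tau> l" if "l < k" for l
    by (rule \<kappa>_limit_lower_bound[OF that N _ \<tau>N[OF that]]) (use that Nk in \<open>auto intro: less_le_trans\<close>)
  have "\<forall>n. \<exists>q. (\<forall>a i. a < N n \<longrightarrow> i < N n \<longrightarrow> ker_avg (N n) (q a) (x i) = \<kappa> (N n) a * deg_n (N n) (x i) * q a i) \<and>
    (\<forall>a b. a < N n \<longrightarrow> b < N n \<longrightarrow> (\<Sum>i<N n. deg_n (N n) (x i) * q a i * q b i) / real (N n) = (if a = b then 1 else 0))"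
  proof
    fix n
    show "\<exists>q. (\<forall>a i. a < N n \<longrightarrow> i < N n \<longrightarrow> ker_avg (N n) (q a) (x i) = \<kappa> (N n) a * deg_n (N n) (x i) * q a i) \<and>
    (\<forall>a b. a < N n \<longrightarrow> b < N n \<longrightarrow> (\<Sum>i<N n. deg_n (N n) (x i) * q a i * q b i) / real (N n) = (if a = b then 1 else 0))"
      by (rule laplacian_spectrum[OF N0[of n], folded \<kappa>_def]) blast
  qed
  from choice[OF this] obtain Q
    where Q: "\<And>n a i. a < N n \<Longrightarrow> i < N n \<Longrightarrow> ker_avg (N n) (Q n a) (x i) = \<kappa> (N n) a * deg_n (N n) (x i) * Q n a i"
    and Qo: "\<And>n a b. a < N n \<Longrightarrow> b < N n \<Longrightarrow> (\<Sum>i<N n. deg_n (N n) (x i) * Q n a i * Q n b i) / real (N n) = (if a = b then 1 else 0)"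
    by blast
  define P where "P l t \<longleftrightarrow> (\<exists>\<psi>. continuous_on UNIV \<psi> \<and> sample_limit (N \<circ> t) ((\<lambda>n. Q n l) \<circ> t) \<psi> \<and>
    (\<forall>y. ker_int \<psi> y = \<tau> l * deg y * \<psi> y))" for l t
  have "\<exists>t. strict_mono t \<and> (\<forall>l<k. P l (id \<circ> t))"
  proof (rule common_subsequence)
    fix l and t :: "nat \<Rightarrow> nat" assume l: "l < k" and t: "strict_mono t"
    have Nt: "filterlim (N \<circ> t) at_top sequentially"
      using filterlim_subseq[OF strict_mono_o[OF Nm t]] .
    have lN: "l < N (t n)" for n using l Nk[of "t n"] by simp
    have eig: "ker_avg ((N \<circ> t) n) (Q (t n) l) (x i) = \<kappa> (N (t n)) l * deg_n ((N \<circ> t) n) (x i) * Q (t n) l i" if "i < (N \<circ> t) n" for n i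
      using Q[OF lN, of i] that by simp
    have \<kappa>t: "(\<lambda>n. \<kappa> (N (t n)) l) \<longlonglongrightarrow> \<tau> l" using LIMSEQ_subseq_LIMSEQ[OF \<tau>N[OF l] t] by (simp add: comp_def)
    \<comment> \<open>Use \<open>\<bar>q\<bar> \<le> 1 + q\<^sup>2\<close> and the lower bound
      \<open>c_min\<close> of the degrees; the degree-weighted mean of the squares is 1.\<close>
    have "(\<Sum>j<(N \<circ> t) n. \<bar>Q (t n) l j\<bar>) / real ((N \<circ> t) n) \<le> 1 + 1 / c_min" for n
    proof -
      let ?N = "N (t n)"
      have "(\<Sum>j<?N. \<bar>Q (t n) l j\<bar>) \<le> (\<Sum>j<?N. 1 + (deg_n ?N (x j) * Q (t n) l j * Q (t n) l j) / c_min)"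
      proof (rule sum_mono)
        fix j
        let ?q = "Q (t n) l j"
        have "0 \<le> (\<bar>?q\<bar> - 1)\<^sup>2" by simp
        also have "\<dots> = ?q\<^sup>2 - 2 * \<bar>?q\<bar> + 1" by (simp add: power2_diff)
        finally have "\<bar>?q\<bar> \<le> 1 + ?q\<^sup>2" using abs_ge_zero[of ?q] by linarith
        also have "?q\<^sup>2 \<le> (deg_n ?N (x j) * ?q * ?q) / c_min"
          using mult_right_mono[OF deg_n_bounds(1)[OF N0, of "t n" "x j"], of "?q\<^sup>2"] c_min(1)
          by (simp add: pos_le_divide_eq power2_eq_square ac_simps)
        finally show "\<bar>?q\<bar> \<le> 1 + (deg_n ?N (x j) * ?q * ?q) / c_min" by simp
      qed
      also have "\<dots> = real ?N + (\<Sum>j<?N. deg_n ?N (x j) * Q (t n) l j * Q (t n) l j) / c_min"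
        by (simp add: sum.distrib sum_divide_distrib)
      also have "(\<Sum>j<?N. deg_n ?N (x j) * Q (t n) l j * Q (t n) l j) = real ?N"
        using Qo[OF lN lN, of n] N0[of "t n"] by (simp add: divide_eq_1_iff)
      finally show ?thesis using N0[of "t n"] c_min(1) by (simp add: field_simps)
    qed
    note bound = this
    have "\<tau> l \<noteq> 0" using \<tau>_ge[OF l] \<theta>_pos[OF l] by linarith
    obtain u \<psi> where u: "strict_mono u" "continuous_on UNIV \<psi>"
      "sample_limit (N \<circ> t \<circ> u) ((\<lambda>n. Q (t n) l) \<circ> u) \<psi>" "\<And>y. ker_int \<psi> y = \<tau> l * deg y * \<psi> y"
      using eigenvector_subsequence[OF Nt eig \<kappa>t \<open>\<tau> l \<noteq> 0\<close> bound] by blast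
    have "P l (t \<circ> u)"
      unfolding P_def using u(2,3,4) by (intro exI[of _ \<psi>]) (simp add: comp_def)
    then show "\<exists>u. strict_mono u \<and> P l (t \<circ> u)" using u(1) by blast
  next
    fix l and t u :: "nat \<Rightarrow> nat" assume u: "strict_mono u" and "P l t"
    then obtain \<psi> where "continuous_on UNIV \<psi>" "sample_limit (N \<circ> t) ((\<lambda>n. Q n l) \<circ> t) \<psi>"
      "\<forall>y. ker_int \<psi> y = \<tau> l * deg y * \<psi> y" unfolding P_def by blast
    then show "P l (t \<circ> u)"
      unfolding P_def using sample_limit_subseq[OF _ u, of "N \<circ> t" "(\<lambda>n. Q n l) \<circ> t" \<psi>]
      by (intro exI[of _ \<psi>]) (simp add: comp_def)
  qed (rule strict_mono_id)
  then obtain t where t: "strict_mono t" and "\<forall>l<k. P l t" by auto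
  then have "\<forall>l. \<exists>\<psi>. l < k \<longrightarrow> continuous_on UNIV \<psi> \<and> sample_limit (N \<circ> t) ((\<lambda>n. Q n l) \<circ> t) \<psi> \<and>
    (\<forall>y. ker_int \<psi> y = \<tau> l * deg y * \<psi> y)" unfolding P_def by blast
  from choice[OF this] obtain \<psi> where \<psi>: "\<And>l. l < k \<Longrightarrow> continuous_on UNIV (\<psi> l)"
    "\<And>l. l < k \<Longrightarrow> sample_limit (N \<circ> t) ((\<lambda>n. Q n l) \<circ> t) (\<psi> l)"
    "\<And>l y. l < k \<Longrightarrow> ker_int (\<psi> l) y = \<tau> l * deg y * \<psi> l y" by blast
  have Nt: "filterlim (N \<circ> t) at_top sequentially"
    using filterlim_subseq[OF strict_mono_o[OF Nm t]] .
  have \<psi>o: "(\<integral>y. deg y * \<psi> a y * \<psi> b y \<partial>\<mu>) = (if a = b then 1 else 0)" if "a < k" "b < k" for a b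
  proof (rule LIMSEQ_unique)
    note m1 = sample_limit_mult[OF deg_sample_limit[OF Nt] \<psi>(2)[OF that(1)] deg_continuous \<psi>(1)[OF that(1)]]
    have c: "continuous_on UNIV (\<lambda>y. deg y * \<psi> a y)" by (intro continuous_intros deg_continuous \<psi> that)
    note m2 = sample_limit_mult[OF m1 \<psi>(2)[OF that(2)] c \<psi>(1)[OF that(2)]]
    have "(\<lambda>n. (\<Sum>j<(N \<circ> t) n. deg_n ((N \<circ> t) n) (x j) * ((\<lambda>n. Q n a) \<circ> t) n j * ((\<lambda>n. Q n b) \<circ> t) n j) / real ((N \<circ> t) n))
       \<longlonglongrightarrow> (\<integral>y. deg y * \<psi> a y * \<psi> b y \<partial>\<mu>)"
      by (rule average_sample_limit[OF Nt m2]) (intro continuous_intros c \<psi> that)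
    moreover have "a < N (t n)" "b < N (t n)" for n using that Nk[of "t n"] by auto
    ultimately show "(\<lambda>n. if a = b then 1 else 0 :: real) \<longlonglongrightarrow> (\<integral>y. deg y * \<psi> a y * \<psi> b y \<partial>\<mu>)"
      by (simp add: Qo)
  qed simp
  have \<psi>nz: "\<exists>z. \<psi> l z \<noteq> 0" if "l < k" for l
  proof (rule ccontr)
    assume "\<nexists>z. \<psi> l z \<noteq> 0"
    then show False using \<psi>o[OF that that] by simp
  qed
  have "\<forall>l. \<exists>m. l < k \<longrightarrow> m \<le> l \<and> \<tau> l = \<theta> m"
  proof
    fix l
    show "\<exists>m. l < k \<longrightarrow> m \<le> l \<and> \<tau> l = \<theta> m"
    proof (cases "l < k")
      case True
      then obtain z where "\<psi> l z \<noteq> 0" using \<psi>nz by blast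
      then obtain m where "m \<le> l" "\<tau> l = \<theta> m"
        by (rule large_eigenvalue_cases[OF \<psi>(1)[OF True] _ \<psi>(3)[OF True] True \<tau>_ge[OF True]])
      then show ?thesis by blast
    qed simp
  qed
  from choice[OF this] obtain m where m: "\<And>l. l < k \<Longrightarrow> m l \<le> l" "\<And>l. l < k \<Longrightarrow> \<tau> l = \<theta> (m l)" by blast
  \<comment> \<open>Otherwise simplicity makes both limits multiples of one function, which
    contradicts their orthonormality.\<close>
  have inj: "a = b" if ab: "a < k" "b < k" "m a = m b" for a b
  proof (rule ccontr)
    assume "a \<noteq> b"
    have mk: "m a < k" using m(1)[OF ab(1)] ab(1) by simp
    have "\<exists>c. \<forall>y. \<psi> l y = c * \<phi> (m a) y" if l: "l < k" "m l = m a" for l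
    proof -
      obtain z where z: "\<psi> l z \<noteq> 0" using \<psi>nz[OF l(1)] by blast
      have "eigenfunction (limit_operator \<eta> \<mu>) (\<lambda>y. sqrt (deg y) * \<psi> l y) (\<sigma> (m a))"
        using eigenfunction_of_ker_int[OF \<psi>(1)[OF l(1)] z \<psi>(3)[OF l(1)]] unfolding m(2)[OF l(1)] l(2) by (simp add: \<theta>_def)
      then obtain c where c: "(\<lambda>y. sqrt (deg y) * \<psi> l y) = (\<lambda>y. c * f (m a) y)" by (rule eigenspace_f[OF mk])
      have "\<psi> l y = c * \<phi> (m a) y" for y
        using fun_cong[OF c, of y] deg_pos[of y] by (simp add: \<phi>_def field_simps)
      then show ?thesis by blast
    qed
    then obtain c d where cd: "\<And>y. \<psi> a y = c * \<phi> (m a) y" "\<And>y. \<psi> b y = d * \<phi> (m a) y"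
      using ab by metis
    have g: "(\<integral>y. deg y * (c * \<phi> (m a) y) * (d * \<phi> (m a) y) \<partial>\<mu>) = (c * d) * gram (m a) (m a)" for c d
      unfolding gram_def by (subst integral_mult_right_zero[symmetric]) (simp add: ac_simps)
    have "c * c * gram (m a) (m a) = 1" using \<psi>o[OF ab(1) ab(1)] unfolding cd g by simp
    moreover have "d * d * gram (m a) (m a) = 1" using \<psi>o[OF ab(2) ab(2)] unfolding cd g by simp
    moreover have "c * d * gram (m a) (m a) = 0" using \<psi>o[OF ab(1) ab(2)] \<open>a \<noteq> b\<close> unfolding cd g by simp
    ultimately show False by auto
  qed
  \<comment> \<open>An injective map with \<open>m l \<le> l\<close> is the identity: by induction
    all smaller values are already taken.\<close>
  have ml: "l < k \<Longrightarrow> m l = l" for l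
  proof (induction l rule: less_induct)
    case (less l)
    show ?case
    proof (rule ccontr)
      assume "m l \<noteq> l"
      then have lt: "m l < l" using m(1)[OF less.prems] by simp
      then have "m (m l) = m l" using less by simp
      then show False using inj[of "m l" l] lt less.prems by auto
    qed
  qed
  show ?thesis
  proof (rule that[OF r], intro allI impI)
    fix l assume "l < k"
    then show "(\<lambda>n. \<kappa> (s (r n)) l) \<longlonglongrightarrow> \<theta> l" using \<tau>[of l] m(2)[of l] ml[of l] by simp
  qed
qed

lemma laplacian_eigenvalue_tendsto:
  assumes l: "l < k"
  shows "(\<lambda>n. laplacian_eigenvalue \<eta> n x l) \<longlonglongrightarrow> \<sigma> l"
proof -
  have "(\<lambda>n. \<kappa> n l) \<longlonglongrightarrow> \<theta> l"
  proof (rule tendstoI, rule ccontr)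
    fix e :: real assume "e > 0" and "\<not> (\<forall>\<^sub>F n in sequentially. dist (\<kappa> n l) (\<theta> l) < e)"
    then obtain s :: "nat \<Rightarrow> nat" where s: "strict_mono s" and far: "\<And>n. \<not> dist (\<kappa> (s n) l) (\<theta> l) < e"
      using not_eventually_sequentiallyD by blast
    \<comment> \<open>The shift makes all sample sizes at least \<open>k\<close>, so that the first
      \<open>k\<close> eigenvalues exist.\<close>
    have "strict_mono (\<lambda>n. s (n + k))" using s by (auto simp: strict_mono_def)
    moreover have "k \<le> s (n + k)" for n using seq_suble[OF s, of "n + k"] by linarith
    ultimately obtain r where "strict_mono r" and lim: "\<forall>l<k. (\<lambda>n. \<kappa> (s (r n + k)) l) \<longlonglongrightarrow> \<theta> l"
      by (rule \<kappa>_subsequence)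
    from tendstoD[OF lim[rule_format, OF l] \<open>e > 0\<close>] show False using far by simp
  qed
  from tendsto_diff[OF tendsto_const[of 1] this] show ?thesis unfolding \<kappa>_def \<theta>_def by simp
qed

text \<open>A sequence of sample sizes at which no sign works has a subsequence along which the
  eigenvectors converge to an eigenfunction \<open>g = c * f l\<close>. Sup norms pass to the limit,
  so the scaling hypothesis gives \<open>\<bar>c\<bar> = 1\<close>, and \<open>c\<close> is itself
  an admissible sign.\<close>

lemma eigenvector_tendsto_eigenfunction:
  fixes u :: "nat \<Rightarrow> nat \<Rightarrow> real"
  assumes l: "l < k"
    and u: "\<And>n. n \<ge> k \<Longrightarrow> eigenvector (laplacian \<eta> n x) (Matrix.vec n (u n)) (laplacian_eigenvalue \<eta> n x l)"
    and scaling: "(\<lambda>n. Max ((\<lambda>i. \<bar>u n i\<bar>) ` {..<n})) \<longlonglongrightarrow> (SUP y. \<bar>f l y\<bar>)"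
    and e: "e > 0"
  shows "\<forall>\<^sub>F n in sequentially. \<exists>s. \<bar>s\<bar> = 1 \<and> (\<forall>j<n. \<bar>u n j - s * f l (x j)\<bar> < e)"
proof (rule ccontr)
  assume neg: "\<not> ?thesis"
  \<comment> \<open>With the guard \<open>n \<ge> k\<close>, the bad sample sizes automatically lie
    where \<open>u n\<close> is known to be an eigenvector.\<close>
  have "\<not> (\<forall>\<^sub>F n in sequentially. n \<ge> k \<longrightarrow> (\<exists>s. \<bar>s\<bar> = 1 \<and> (\<forall>j<n. \<bar>u n j - s * f l (x j)\<bar> < e)))"
  proof
    assume "\<forall>\<^sub>F n in sequentially. n \<ge> k \<longrightarrow> (\<exists>s. \<bar>s\<bar> = 1 \<and> (\<forall>j<n. \<bar>u n j - s * f l (x j)\<bar> < e))"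
    then have "\<forall>\<^sub>F n in sequentially. \<exists>s. \<bar>s\<bar> = 1 \<and> (\<forall>j<n. \<bar>u n j - s * f l (x j)\<bar> < e)"
      using eventually_ge_at_top[of k] by eventually_elim blast
    with neg show False ..
  qed
  from not_eventually_sequentiallyD[OF this] obtain N :: "nat \<Rightarrow> nat"
    where N: "strict_mono N" and Nk: "\<And>n. N n \<ge> k"
      and far: "\<And>n. \<not> (\<exists>s. \<bar>s\<bar> = 1 \<and> (\<forall>j<N n. \<bar>u (N n) j - s * f l (x j)\<bar> < e))" by blast
  have N0: "N n > 0" for n using Nk[of n] l by simp
  have Nt: "filterlim N at_top sequentially" using N by (rule filterlim_subseq)
  define M where "M n = Max ((\<lambda>i. \<bar>u n i\<bar>) ` {..<n})" for n
  define F where "F = (SUP y. \<bar>f l y\<bar>)"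
  have MF: "M \<longlonglongrightarrow> F" using scaling unfolding M_def F_def .
  have M: "\<bar>u n i\<bar> \<le> M n" if "i < n" for n i unfolding M_def using that by (intro Max_ge) auto
  have "Bseq M" using MF by (intro convergent_imp_Bseq) (auto simp: convergent_def)
  then obtain B where B: "B > 0" "\<And>n. \<bar>M n\<bar> \<le> B" unfolding Bseq_def by auto
  define q where "q n j = u (N n) j / sqrt (deg_n (N n) (x j))" for n j
  have eig: "ker_avg (N n) (q n) (x i) = \<kappa> (N n) l * deg_n (N n) (x i) * q n i" if i: "i < N n" for n i
    unfolding q_def \<kappa>_def
  proof (rule ker_avg_eigenvector[OF _ i])
    fix i assume i: "i < N n"
    have "(laplacian \<eta> (N n) x *\<^sub>v Matrix.vec (N n) (u (N n))) $ i = (laplacian_eigenvalue \<eta> (N n) x l \<cdot>\<^sub>v Matrix.vec (N n) (u (N n))) $ i"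
      using u[OF Nk[of n]] unfolding eigenvector_def by simp
    then show "(\<Sum>j<N n. laplacian \<eta> (N n) x $$ (i, j) * u (N n) j) = laplacian_eigenvalue \<eta> (N n) x l * u (N n) i"
      using i laplacian_carrier[OF N0[of n]] by (simp add: scalar_prod_def atLeast0LessThan)
  qed
  have bound: "(\<Sum>j<N n. \<bar>q n j\<bar>) / real (N n) \<le> B / sqrt c_min" for n
  proof -
    have "\<bar>q n j\<bar> \<le> B / sqrt c_min" if j: "j < N n" for j
    proof -
      have "\<bar>q n j\<bar> = \<bar>u (N n) j\<bar> / sqrt (deg_n (N n) (x j))"
        unfolding q_def using deg_n_pos[OF N0, of n "x j"] by (simp add: abs_divide)
      also have "\<dots> \<le> B / sqrt c_min"
        using M[OF j] B(2)[of "N n"] deg_n_bounds(1)[OF N0, of n "x j"] c_min(1) by (intro frac_le) auto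
      finally show ?thesis .
    qed
    then have "(\<Sum>j<N n. \<bar>q n j\<bar>) \<le> real (N n) * (B / sqrt c_min)"
      using sum_bounded_above[of "{..<N n}" "\<lambda>j. \<bar>q n j\<bar>" "B / sqrt c_min"] by simp
    then show ?thesis using N0[of n] by (simp only: pos_divide_le_eq of_nat_0_less_iff mult.commute)
  qed
  have \<kappa>N: "(\<lambda>n. \<kappa> (N n) l) \<longlonglongrightarrow> \<theta> l"
    unfolding \<kappa>_def \<theta>_def using LIMSEQ_subseq_LIMSEQ[OF laplacian_eigenvalue_tendsto[OF l] N]
    by (intro tendsto_intros) (simp add: comp_def)
  have "\<theta> l \<noteq> 0" using \<theta>_pos[OF l] by simp
  obtain r \<psi> where r: "strict_mono r" and \<psi>: "continuous_on UNIV \<psi>" "sample_limit (N \<circ> r) (q \<circ> r) \<psi>"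
    "\<And>y. ker_int \<psi> y = \<theta> l * deg y * \<psi> y"
    using eigenvector_subsequence[OF Nt eig \<kappa>N \<open>\<theta> l \<noteq> 0\<close> bound] by blast
  have Nr: "filterlim (N \<circ> r) at_top sequentially"
    using filterlim_subseq[OF strict_mono_o[OF N r]] .
  \<comment> \<open>This undoes the division by the square root of the degree: \<open>g\<close> is
    the limit of the eigenvectors themselves.\<close>
  define g where "g y = sqrt (deg y) * \<psi> y" for y
  have g: "continuous_on UNIV g" unfolding g_def by (intro continuous_intros sqrt_deg_continuous \<psi>)
  have "uniform_limit UNIV (\<lambda>n y. sqrt (deg_n ((N \<circ> r) n) y)) (\<lambda>y. sqrt (deg y)) sequentially"
  proof (rule uniform_limit_sqrt[OF deg_uniform_limit[OF Nr]])
    show "deg_n ((N \<circ> r) n) y \<ge> 0" for n y by (rule less_imp_le[OF deg_n_pos]) (simp add: N0)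
    show "deg y \<ge> 0" for y by (rule less_imp_le[OF deg_pos])
  qed
  then have "sample_limit (N \<circ> r) (\<lambda>n j. sqrt (deg_n ((N \<circ> r) n) (x j))) (\<lambda>y. sqrt (deg y))"
    by (rule sample_limit_uniform_limit) simp
  from sample_limit_mult[OF this \<psi>(2) sqrt_deg_continuous \<psi>(1)]
  have sl': "sample_limit (N \<circ> r) (\<lambda>n j. sqrt (deg_n ((N \<circ> r) n) (x j)) * (q \<circ> r) n j) g" unfolding g_def .
  have usl: "\<forall>\<^sub>F n in sequentially. \<forall>j<N (r n). \<bar>u (N (r n)) j - g (x j)\<bar> < d" if "d > 0" for d
    using sample_limitD[OF sl' that]
  proof eventually_elim
    case (elim n)
    have "sqrt (deg_n (N (r n)) (x j)) * q (r n) j = u (N (r n)) j" for j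
      unfolding q_def using deg_n_pos[OF N0, of "r n" "x j"] by simp
    then show ?case using elim by simp
  qed
  have MNr: "(\<lambda>n. M (N (r n))) \<longlonglongrightarrow> F"
    using LIMSEQ_subseq_LIMSEQ[OF MF strict_mono_o[OF N r]] by (simp add: comp_def)
  \<comment> \<open>The two bounds identify \<open>F\<close> as the sup norm of \<open>g\<close>.
    Here a sample point almost attains \<open>\<bar>g y\<bar>\<close>, and it eventually enters the
    maximum \<open>M\<close>; one third of \<open>d\<close> goes to each approximation.\<close>
  have g_le: "\<bar>g y\<bar> \<le> F" for y
  proof (rule field_le_epsilon)
    fix d :: real assume "d > 0"
    have "continuous_on UNIV (\<lambda>z. d / 3 - (\<bar>g y\<bar> - \<bar>g z\<bar>))" by (intro continuous_intros g)
    then obtain j where j: "d / 3 - (\<bar>g y\<bar> - \<bar>g (x j)\<bar>) > 0"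
      by (rule sample_meets_positive[of _ y]) (use \<open>d > 0\<close> in auto)
    have "d / 3 > 0" using \<open>d > 0\<close> by simp
    have "\<forall>\<^sub>F n in sequentially. \<bar>g y\<bar> - 2 * (d / 3) \<le> M (N (r n))"
      using usl[OF \<open>d / 3 > 0\<close>] filterlim_at_top[THEN iffD1, OF Nr, rule_format, of "Suc j"]
    proof eventually_elim
      case (elim n)
      then have "j < N (r n)" by simp
      then have "\<bar>u (N (r n)) j - g (x j)\<bar> < d / 3" "\<bar>u (N (r n)) j\<bar> \<le> M (N (r n))" using elim(1) M by auto
      then show ?case using j by linarith
    qed
    from tendsto_lowerbound[OF MNr this] show "\<bar>g y\<bar> \<le> F + d" using \<open>d > 0\<close> by simp
  qed
  have F_le: "F \<le> G" if G: "\<And>y. \<bar>g y\<bar> \<le> G" for G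
  proof (rule field_le_epsilon)
    fix d :: real assume "d > 0"
    have "\<forall>\<^sub>F n in sequentially. M (N (r n)) \<le> G + d"
      using usl[OF \<open>d > 0\<close>]
    proof eventually_elim
      case (elim n)
      have "{..<N (r n)} \<noteq> {}" using N0[of "r n"] by (simp add: lessThan_empty_iff)
      moreover have "\<bar>u (N (r n)) i\<bar> \<le> G + d" if "i < N (r n)" for i
        using elim[rule_format, OF that] G[of "x i"] by linarith
      ultimately show ?case unfolding M_def by (subst Max_le_iff) auto
    qed
    from tendsto_upperbound[OF MNr this] show "F \<le> G + d" by simp
  qed
  have "f l \<noteq> (\<lambda>x. 0)" using f[OF l] unfolding eigenfunction_def by blast
  then obtain z0 where z0: "f l z0 \<noteq> 0" by auto
  obtain Bf where "\<And>y. \<bar>f l y\<bar> \<le> Bf" using compact_bounded_real[OF compact_space f_continuous[OF l]] by blast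
  then have f_le: "\<bar>f l y\<bar> \<le> F" for y unfolding F_def by (intro cSUP_upper bdd_aboveI2[of _ _ Bf]) auto
  have F: "F > 0" using f_le[of z0] z0 by linarith
  have "\<exists>z. \<psi> z \<noteq> 0"
  proof (rule ccontr)
    assume "\<nexists>z. \<psi> z \<noteq> 0"
    then have "F \<le> 0" by (intro F_le) (simp add: g_def)
    then show False using F by simp
  qed
  then obtain z where "\<psi> z \<noteq> 0" by blast
  from eigenfunction_of_ker_int[OF \<psi>(1) this \<psi>(3)]
  have "eigenfunction (limit_operator \<eta> \<mu>) g (\<sigma> l)" unfolding g_def \<theta>_def by simp
  then obtain c where c: "g = (\<lambda>y. c * f l y)" by (rule eigenspace_f[OF l])
  have "F \<le> \<bar>c\<bar> * F" by (rule F_le) (simp add: c abs_mult mult_left_mono f_le)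
  then have "\<bar>c\<bar> \<ge> 1" using F by simp
  moreover have "\<bar>c\<bar> \<le> 1"
  proof -
    have "F \<le> F / \<bar>c\<bar>"
      unfolding F_def
    proof (rule cSUP_least)
      fix y
      have "\<bar>c\<bar> * \<bar>f l y\<bar> \<le> F" using g_le[of y] by (simp add: c abs_mult)
      then show "\<bar>f l y\<bar> \<le> (SUP y. \<bar>f l y\<bar>) / \<bar>c\<bar>"
        using \<open>\<bar>c\<bar> \<ge> 1\<close> unfolding F_def[symmetric] by (simp add: pos_le_divide_eq mult.commute)
    qed simp
    then show ?thesis using F \<open>\<bar>c\<bar> \<ge> 1\<close> by (simp add: pos_le_divide_eq)
  qed
  ultimately have c1: "\<bar>c\<bar> = 1" by simp
  from usl[OF e] obtain n where "\<forall>j<N (r n). \<bar>u (N (r n)) j - g (x j)\<bar> < e"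
    unfolding eventually_sequentially by blast
  then show False using far[of "r n"] c1 unfolding c by blast
qed

end

section \<open>Convergence of barycenters\<close>

lemma continuous_on_Min:
  fixes h :: "'i \<Rightarrow> 'a::topological_space \<Rightarrow> real"
  assumes "finite I" "I \<noteq> {}" "\<And>i. i \<in> I \<Longrightarrow> continuous_on S (h i)"
  shows "continuous_on S (\<lambda>y. Min ((\<lambda>i. h i y) ` I))"
  using assms
proof (induction rule: finite_ne_induct)
  case (insert i I)
  have "continuous_on S (\<lambda>y. min (h i y) (Min ((\<lambda>i. h i y) ` I)))"
    using insert by (intro continuous_on_min) auto
  then show ?case using insert(1,2) by simp
qed simp

lemma abs_Min_diff_le:
  fixes g h :: "'i \<Rightarrow> real"
  assumes I: "finite I" "I \<noteq> {}" and close: "\<And>i. i \<in> I \<Longrightarrow> \<bar>g i - h i\<bar> \<le> e"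
  shows "\<bar>Min (g ` I) - Min (h ` I)\<bar> \<le> e"
proof -
  have "Min (g ` I) \<in> g ` I" using I by (intro Min_in) auto
  then obtain i where i: "i \<in> I" "Min (g ` I) = g i" by auto
  have "Min (h ` I) \<in> h ` I" using I by (intro Min_in) auto
  then obtain j where j: "j \<in> I" "Min (h ` I) = h j" by auto
  have "Min (g ` I) \<le> g j" "Min (h ` I) \<le> h i" using I i(1) j(1) by (auto intro: Min_le)
  then show ?thesis using close[OF i(1)] close[OF j(1)] unfolding i(2) j(2) by linarith
qed

text \<open>Repetitions are allowed, so each candidate set is given by exactly \<open>k\<close>
  points and a sequence of sets becomes \<open>k\<close> sequences of points.\<close>

lemma finite_nonempty_enumeration:
  assumes "finite S" "S \<noteq> {}" "card S \<le> k"
  obtains a :: "nat \<Rightarrow> 'a" where "S = a ` {..<k}"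
proof -
  obtain h where h: "bij_betw h {0..<card S} S" using ex_bij_betw_nat_finite[OF assms(1)] by blast
  have c: "card S > 0" using assms by (simp add: card_gt_0_iff)
  have "S = (\<lambda>i. if i < card S then h i else h 0) ` {..<k}"
  proof
    show "S \<subseteq> (\<lambda>i. if i < card S then h i else h 0) ` {..<k}"
    proof
      fix y assume "y \<in> S"
      then have "y \<in> h ` {0..<card S}" using bij_betw_imp_surj_on[OF h] by simp
      then obtain i where "i < card S" "y = h i" by auto
      then show "y \<in> (\<lambda>i. if i < card S then h i else h 0) ` {..<k}" using assms(3) by (intro image_eqI[of _ _ i]) auto
    qed
    show "(\<lambda>i. if i < card S then h i else h 0) ` {..<k} \<subseteq> S"
      using h c unfolding bij_betw_def by auto
  qed
  then show ?thesis by (rule that)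
qed

lemma hausdorff_dist_le:
  fixes r :: "'m \<Rightarrow> 'm \<Rightarrow> real" and k :: nat
  assumes k: "k > 0" and ab: "\<And>i. i < k \<Longrightarrow> r (a i) (b i) \<le> e" "\<And>i. i < k \<Longrightarrow> r (b i) (a i) \<le> e"
  shows "hausdorff_dist r (a ` {..<k}) (b ` {..<k}) \<le> e"
proof -
  have *: "Max ((\<lambda>a. Min ((\<lambda>b. r a b) ` (b ` {..<k}))) ` (a ` {..<k})) \<le> e"
    if ab: "\<And>i. i < k \<Longrightarrow> r (a i) (b i) \<le> e" for a b :: "nat \<Rightarrow> 'm"
  proof -
    have "Min ((\<lambda>b. r (a i) b) ` (b ` {..<k})) \<le> e" if "i < k" for i
      using that ab[OF that] by (intro order_trans[OF Min_le]) auto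
    then show ?thesis using k by (subst Max_le_iff) (auto simp: lessThan_empty_iff)
  qed
  show ?thesis unfolding hausdorff_dist_def using *[of a b, OF ab(1)] *[of b a, OF ab(2)] by simp
qed

text \<open>The measure is pushed forward from the uniform distribution on indices, so repeated
  sample points count with multiplicity.\<close>

lemma kmeans_cost_empirical:
  assumes "n > 0"
  shows "kmeans_cost r (empirical_measure n x) p S = (\<Sum>j<n. Min ((\<lambda>z. r (x j) z powr p) ` S)) / real n"
  using assms unfolding kmeans_cost_def empirical_measure_def
  by (subst integral_map_pmf, subst integral_pmf_of_set) (auto simp: lessThan_empty_iff)

lemma powr_uniformly_continuous:
  fixes p R :: real
  assumes "p > 0" "e > 0"
  obtains d where "d > 0" "\<And>a b. 0 \<le> a \<Longrightarrow> a \<le> R \<Longrightarrow> 0 \<le> b \<Longrightarrow> b \<le> R \<Longrightarrow> \<bar>a - b\<bar> < d \<Longrightarrow> \<bar>a powr p - b powr p\<bar> < e"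
proof -
  have "continuous_on {0..R} (\<lambda>a. a powr p)"
    using assms(1) by (intro continuous_on_powr' continuous_intros) auto
  then have "uniformly_continuous_on {0..R} (\<lambda>a. a powr p)"
    by (intro compact_uniformly_continuous) auto
  then obtain d where "d > 0" "\<forall>a\<in>{0..R}. \<forall>b\<in>{0..R}. dist b a < d \<longrightarrow> dist (b powr p) (a powr p) < e"
    using assms(2) unfolding uniformly_continuous_on_def by meson
  then show ?thesis by (intro that[of d]) (auto simp: dist_real_def)
qed

section \<open>Consistency of k-means under uniform convergence of distances on the sample\<close>

context sample_kernel begin

text \<open>The integrands converge uniformly on the sample: the distances and the centres do,
  powers are uniformly continuous on a bounded range, and a minimum moves by at most the largest
  change of its entries. The limit centres \<open>b i\<close> may lie outside the sample.\<close>

lemma kmeans_cost_tendsto: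
  fixes \<delta> :: "'m \<Rightarrow> 'm \<Rightarrow> real" and \<delta>\<^sub>n :: "nat \<Rightarrow> 'm \<Rightarrow> 'm \<Rightarrow> real" and k :: nat
  assumes cont: "\<And>a. continuous_on UNIV (\<lambda>y. \<delta> y a)" and nonneg: "\<And>y z. \<delta> y z \<ge> 0" "\<And>n y z. \<delta>\<^sub>n n y z \<ge> 0"
    and sym: "\<And>y z. \<delta> y z = \<delta> z y" and tri: "\<And>y z w. \<delta> y w \<le> \<delta> y z + \<delta> z w"
    and conv: "\<And>e. e > 0 \<Longrightarrow> \<forall>\<^sub>F n in sequentially. \<forall>y\<in>x ` {..<n}. \<forall>z\<in>x ` {..<n}. \<bar>\<delta>\<^sub>n n y z - \<delta> y z\<bar> < e"
    and p: "p > 0" and k: "k > 0" and N: "filterlim N at_top sequentially" and N0: "\<And>n. N n > 0"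
    and a: "\<And>n i. i < k \<Longrightarrow> a n i \<in> x ` {..<N n}" and ab: "\<And>i. i < k \<Longrightarrow> (\<lambda>n. \<delta> (a n i) (b i)) \<longlonglongrightarrow> 0"
  shows "(\<lambda>n. kmeans_cost (\<delta>\<^sub>n (N n)) (empirical_measure (N n) x) p (a n ` {..<k})) \<longlonglongrightarrow> kmeans_cost \<delta> \<mu> p (b ` {..<k})"
proof -
  have I: "finite {..<k}" "{..<k} \<noteq> {}" using k by auto
  define z0 :: 'm where "z0 = x 0"
  obtain B where B: "B > 0" "\<And>y. \<bar>\<delta> y z0\<bar> \<le> B" using compact_bounded_real[OF compact_space cont] by blast
  have \<delta>_le: "\<delta> y z \<le> 2 * B" for y z using tri[of y z z0] B(2)[of y] B(2)[of z] sym[of z0 z] by linarith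
  have "sample_limit N (\<lambda>n j. Min ((\<lambda>i. \<delta>\<^sub>n (N n) (x j) (a n i) powr p) ` {..<k})) (\<lambda>y. Min ((\<lambda>i. \<delta> y (b i) powr p) ` {..<k}))"
    unfolding sample_limit_def
  proof (intro allI impI)
    fix e :: real assume "e > 0"
    then have "e / 2 > 0" by simp
    obtain d where d: "d > 0"
      "\<And>v w. 0 \<le> v \<Longrightarrow> v \<le> 2 * B + 1 \<Longrightarrow> 0 \<le> w \<Longrightarrow> w \<le> 2 * B + 1 \<Longrightarrow> \<bar>v - w\<bar> < d \<Longrightarrow> \<bar>v powr p - w powr p\<bar> < e / 2"
      by (rule powr_uniformly_continuous[OF p \<open>e / 2 > 0\<close>, of "2 * B + 1"]) blast
    \<comment> \<open>Changing the distance and moving the centre cost less than \<open>h\<close>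
      each, hence less than \<open>d\<close> together; the bound 1 keeps the values of
      \<open>\<delta>\<^sub>n\<close> below \<open>2 * B + 1\<close>.\<close>
    define h where "h = min (d / 2) 1"
    have h: "h > 0" "h \<le> d / 2" "h \<le> 1" unfolding h_def using d(1) by auto
    have "\<forall>\<^sub>F n in sequentially. \<forall>i\<in>{..<k}. \<delta> (a n i) (b i) < h"
      using order_tendstoD(2)[OF ab h(1)] by (intro eventually_ball_finite) auto
    moreover have "\<forall>\<^sub>F n in sequentially. \<forall>y\<in>x ` {..<N n}. \<forall>z\<in>x ` {..<N n}. \<bar>\<delta>\<^sub>n (N n) y z - \<delta> y z\<bar> < h"
      using eventually_compose_filterlim[OF conv[OF h(1)] N] .
    ultimately show "\<forall>\<^sub>F n in sequentially. \<forall>j<N n. \<bar>Min ((\<lambda>i. \<delta>\<^sub>n (N n) (x j) (a n i) powr p) ` {..<k}) - Min ((\<lambda>i. \<delta> (x j) (b i) powr p) ` {..<k})\<bar> < e"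
    proof eventually_elim
      case (elim n)
      show ?case
      proof (intro allI impI)
        fix j assume j: "j < N n"
        have "\<bar>\<delta>\<^sub>n (N n) (x j) (a n i) powr p - \<delta> (x j) (b i) powr p\<bar> \<le> e / 2" if i: "i \<in> {..<k}" for i
        proof (rule less_imp_le, rule d(2))
          have 1: "\<bar>\<delta>\<^sub>n (N n) (x j) (a n i) - \<delta> (x j) (a n i)\<bar> < h" using elim(2) a[of i n] i j by auto
          have 2: "\<delta> (a n i) (b i) < h" using elim(1) i by blast
          show "\<bar>\<delta>\<^sub>n (N n) (x j) (a n i) - \<delta> (x j) (b i)\<bar> < d"
            using 1 2 h tri[of "x j" "b i" "a n i"] tri[of "x j" "a n i" "b i"] sym[of "b i" "a n i"] by linarith
          show "\<delta>\<^sub>n (N n) (x j) (a n i) \<le> 2 * B + 1" using 1 h \<delta>_le[of "x j" "a n i"] by linarith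
          show "\<delta> (x j) (b i) \<le> 2 * B + 1" using \<delta>_le[of "x j" "b i"] by linarith
        qed (rule nonneg)+
        then have "\<bar>Min ((\<lambda>i. \<delta>\<^sub>n (N n) (x j) (a n i) powr p) ` {..<k}) - Min ((\<lambda>i. \<delta> (x j) (b i) powr p) ` {..<k})\<bar> \<le> e / 2"
          by (rule abs_Min_diff_le[OF I])
        then show "\<bar>Min ((\<lambda>i. \<delta>\<^sub>n (N n) (x j) (a n i) powr p) ` {..<k}) - Min ((\<lambda>i. \<delta> (x j) (b i) powr p) ` {..<k})\<bar> < e"
          using \<open>e > 0\<close> by linarith
      qed
    qed
  qed
  moreover have "continuous_on UNIV (\<lambda>y. Min ((\<lambda>i. \<delta> y (b i) powr p) ` {..<k}))"
    using I p nonneg by (intro continuous_on_Min continuous_on_powr' cont continuous_on_const) auto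
  ultimately have "(\<lambda>n. (\<Sum>j<N n. Min ((\<lambda>i. \<delta>\<^sub>n (N n) (x j) (a n i) powr p) ` {..<k})) / real (N n))
    \<longlonglongrightarrow> (\<integral>y. Min ((\<lambda>i. \<delta> y (b i) powr p) ` {..<k}) \<partial>\<mu>)"
    by (rule average_sample_limit[OF N])
  then show ?thesis
    unfolding kmeans_cost_empirical[OF N0] unfolding kmeans_cost_def image_image .
qed

lemma sample_approximation:
  fixes \<delta> :: "'m \<Rightarrow> 'm \<Rightarrow> real"
  assumes cont: "continuous_on UNIV (\<lambda>y. \<delta> y b)" and nonneg: "\<And>y. \<delta> y b \<ge> 0" and refl: "\<delta> b b = 0"
    and N: "filterlim N at_top sequentially" and N0: "\<And>n. N n > 0"
  obtains a where "\<And>n. a n \<in> x ` {..<N n}" "(\<lambda>n. \<delta> (a n) b) \<longlonglongrightarrow> 0"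
proof -
  \<comment> \<open>A nearest sample point: once any sample point is within \<open>e\<close> of
    \<open>b\<close>, all later nearest points are too.\<close>
  define a where "a n = arg_min_on (\<lambda>y. \<delta> y b) (x ` {..<N n})" for n
  have fin: "finite (x ` {..<N n})" "x ` {..<N n} \<noteq> {}" for n using N0[of n] by (auto simp: lessThan_empty_iff)
  have a: "a n \<in> x ` {..<N n}" for n unfolding a_def using fin by (rule arg_min_if_finite(1))
  have "(\<lambda>n. \<delta> (a n) b) \<longlonglongrightarrow> 0"
  proof (rule tendstoI)
    fix e :: real assume "e > 0"
    have "continuous_on UNIV (\<lambda>y. e - \<delta> y b)" by (intro continuous_intros cont)
    then obtain j where j: "e - \<delta> (x j) b > 0"
      by (rule sample_meets_positive[of _ b]) (use \<open>e > 0\<close> refl in auto)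
    show "\<forall>\<^sub>F n in sequentially. dist (\<delta> (a n) b) 0 < e"
      using filterlim_at_top[THEN iffD1, OF N, rule_format, of "Suc j"]
    proof eventually_elim
      case (elim n)
      then have "\<delta> (a n) b \<le> \<delta> (x j) b" unfolding a_def using fin by (intro arg_min_least) auto
      then show ?case using j nonneg[of "a n"] by simp
    qed
  qed
  with a show ?thesis by (rule that)
qed

text \<open>Different subsequences may approach different barycenters of the limit, so no target set
  can be fixed beforehand. A sequence of sets that stays away from all of them is refuted by one
  convergent subsequence.\<close>

lemma kmeans_consistency:
  fixes \<delta> :: "'m \<Rightarrow> 'm \<Rightarrow> real" and \<delta>\<^sub>n :: "nat \<Rightarrow> 'm \<Rightarrow> 'm \<Rightarrow> real" and k :: nat
  assumes cont: "\<And>a. continuous_on UNIV (\<lambda>y. \<delta> y a)" and nonneg: "\<And>y z. \<delta> y z \<ge> 0" "\<And>n y z. \<delta>\<^sub>n n y z \<ge> 0"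
    and refl: "\<And>y. \<delta> y y = 0"
    and sym: "\<And>y z. \<delta> y z = \<delta> z y" and tri: "\<And>y z w. \<delta> y w \<le> \<delta> y z + \<delta> z w"
    and conv: "\<And>e. e > 0 \<Longrightarrow> \<forall>\<^sub>F n in sequentially. \<forall>y\<in>x ` {..<n}. \<forall>z\<in>x ` {..<n}. \<bar>\<delta>\<^sub>n n y z - \<delta> y z\<bar> < e"
    and p: "p > 0" and e: "e > 0"
  shows "\<forall>\<^sub>F n in sequentially. \<forall>S \<in> barycenters (x ` {..<n}) (\<delta>\<^sub>n n) (empirical_measure n x) p k.
    \<exists>S' \<in> barycenters UNIV \<delta> \<mu> p k. hausdorff_dist \<delta> S S' \<le> e" (is "eventually ?Q _")
proof (rule ccontr)
  assume neg: "\<not> eventually ?Q sequentially"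
  from not_eventually_sequentiallyD[OF neg]
  obtain N :: "nat \<Rightarrow> nat" where N: "strict_mono N" and "\<forall>n. \<not> ?Q (N n)" by blast
  then have "\<forall>n. \<exists>S. S \<in> barycenters (x ` {..<N n}) (\<delta>\<^sub>n (N n)) (empirical_measure (N n) x) p k \<and>
    (\<forall>S' \<in> barycenters UNIV \<delta> \<mu> p k. \<not> hausdorff_dist \<delta> S S' \<le> e)" by blast
  from choice[OF this] obtain S
    where S: "\<And>n. S n \<in> barycenters (x ` {..<N n}) (\<delta>\<^sub>n (N n)) (empirical_measure (N n) x) p k"
      and far: "\<And>n S'. S' \<in> barycenters UNIV \<delta> \<mu> p k \<Longrightarrow> \<not> hausdorff_dist \<delta> (S n) S' \<le> e" by blast
  have cand: "S n \<subseteq> x ` {..<N n}" "S n \<noteq> {}" "finite (S n)" "card (S n) \<le> k" for n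
    using S[of n] unfolding barycenters_def candidate_sets_def by auto
  have min: "kmeans_cost (\<delta>\<^sub>n (N n)) (empirical_measure (N n) x) p (S n) \<le> kmeans_cost (\<delta>\<^sub>n (N n)) (empirical_measure (N n) x) p S'"
    if "S' \<in> candidate_sets (x ` {..<N n}) k" for n S'
    using S[of n] that unfolding barycenters_def by blast
  have N0: "N n > 0" for n using cand[of n] by (cases "N n = 0") auto
  \<comment> \<open>For \<open>k = 0\<close> there are no candidate sets at all, so a bad sequence
    could not exist.\<close>
  have k: "k > 0" using cand(2,3,4)[of 0] by (cases "k = 0") auto
  have "\<forall>n. \<exists>a. S n = a ` {..<k}"
    using finite_nonempty_enumeration[OF cand(3,2,4)] by metis
  from choice[OF this] obtain a where a: "\<And>n. S n = a n ` {..<k}" by blast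
  \<comment> \<open>Convergence is extracted in the topology of the manifold, since
    \<open>\<delta>\<close> need not separate points; continuity of \<open>\<delta>\<close> then
    gives convergence in \<open>\<delta>\<close>.\<close>
  have "\<exists>r. strict_mono r \<and> (\<forall>i<k. \<exists>b. (\<lambda>n. a ((id \<circ> r) n) i) \<longlonglongrightarrow> b)"
  proof (rule common_subsequence)
    fix i and s :: "nat \<Rightarrow> nat"
    have "\<forall>n. a (s n) i \<in> UNIV" by simp
    with compact_imp_seq_compact[OF compact_space]
    obtain b r where "b \<in> (UNIV :: 'm set)" "strict_mono r" "((\<lambda>n. a (s n) i) \<circ> r) \<longlonglongrightarrow> b" by (rule seq_compactE)
    then show "\<exists>r. strict_mono r \<and> (\<exists>b. (\<lambda>n. a ((s \<circ> r) n) i) \<longlonglongrightarrow> b)" by (auto simp: comp_def)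
  next
    fix i and s r :: "nat \<Rightarrow> nat" assume r: "strict_mono r" and "\<exists>b. (\<lambda>n. a (s n) i) \<longlonglongrightarrow> b"
    then obtain b where "(\<lambda>n. a (s n) i) \<longlonglongrightarrow> b" by blast
    from LIMSEQ_subseq_LIMSEQ[OF this r]
    show "\<exists>b. (\<lambda>n. a ((s \<circ> r) n) i) \<longlonglongrightarrow> b" by (auto simp: comp_def)
  qed (rule strict_mono_id)
  then obtain r where r: "strict_mono r" and "\<forall>i<k. \<exists>b. (\<lambda>n. a (r n) i) \<longlonglongrightarrow> b" by auto
  then have "\<forall>i. \<exists>b. i < k \<longrightarrow> (\<lambda>n. a (r n) i) \<longlonglongrightarrow> b" by blast
  from choice[OF this] obtain b where b: "\<And>i. i < k \<Longrightarrow> (\<lambda>n. a (r n) i) \<longlonglongrightarrow> b i" by blast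
  have \<delta>b: "(\<lambda>n. \<delta> (a (r n) i) (b i)) \<longlonglongrightarrow> 0" if "i < k" for i
  proof -
    have "(\<lambda>n. \<delta> (a (r n) i) (b i)) \<longlonglongrightarrow> \<delta> (b i) (b i)"
      by (rule continuous_on_tendsto_compose[OF cont b[OF that]]) auto
    then show ?thesis by (simp add: refl)
  qed
  have Nr: "filterlim (\<lambda>n. N (r n)) at_top sequentially"
    using filterlim_compose[OF filterlim_subseq[OF N] filterlim_subseq[OF r]] .
  note cost = kmeans_cost_tendsto[OF cont nonneg sym tri conv p k Nr N0]
  have aS: "a (r n) i \<in> x ` {..<N (r n)}" if "i < k" for n i using a[of "r n"] cand(1)[of "r n"] that by auto
  have lim: "(\<lambda>n. kmeans_cost (\<delta>\<^sub>n (N (r n))) (empirical_measure (N (r n)) x) p (S (r n))) \<longlonglongrightarrow> kmeans_cost \<delta> \<mu> p (b ` {..<k})"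
    unfolding a by (rule cost[where a = "\<lambda>n. a (r n)"]) (auto intro: aS \<delta>b)
  have bary: "b ` {..<k} \<in> barycenters UNIV \<delta> \<mu> p k"
    unfolding barycenters_def
  proof (intro CollectI conjI ballI)
    show "b ` {..<k} \<in> candidate_sets UNIV k"
      unfolding candidate_sets_def using k card_image_le[of "{..<k}" b] by (auto simp: lessThan_empty_iff)
    fix S' :: "'m set" assume "S' \<in> candidate_sets UNIV k"
    then have S': "finite S'" "S' \<noteq> {}" "card S' \<le> k" unfolding candidate_sets_def by auto
    then obtain b' where b': "S' = b' ` {..<k}" by (rule finite_nonempty_enumeration)
    \<comment> \<open>Empirical minimality compares only with subsets of the sample, so the
      competitor is first moved to sample points, at a cost that vanishes in the limit.\<close>
    have "\<forall>i. \<exists>a'. (\<forall>n. a' n \<in> x ` {..<N (r n)}) \<and> (\<lambda>n. \<delta> (a' n) (b' i)) \<longlonglongrightarrow> 0"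
    proof
      fix i
      obtain a' where "\<And>n. a' n \<in> x ` {..<N (r n)}" "(\<lambda>n. \<delta> (a' n) (b' i)) \<longlonglongrightarrow> 0"
        using sample_approximation[of \<delta> "b' i", OF cont nonneg(1) refl Nr N0] by blast
      then show "\<exists>a'. (\<forall>n. a' n \<in> x ` {..<N (r n)}) \<and> (\<lambda>n. \<delta> (a' n) (b' i)) \<longlonglongrightarrow> 0" by blast
    qed
    from choice[OF this] obtain a' where a': "\<And>i n. a' i n \<in> x ` {..<N (r n)}" "\<And>i. (\<lambda>n. \<delta> (a' i n) (b' i)) \<longlonglongrightarrow> 0" by blast
    have "(\<lambda>n. kmeans_cost (\<delta>\<^sub>n (N (r n))) (empirical_measure (N (r n)) x) p ((\<lambda>i. a' i n) ` {..<k})) \<longlonglongrightarrow> kmeans_cost \<delta> \<mu> p S'"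
      unfolding b' by (rule cost[where a = "\<lambda>n i. a' i n"]) (auto intro: a')
    moreover have "(\<lambda>i. a' i n) ` {..<k} \<in> candidate_sets (x ` {..<N (r n)}) k" for n
      unfolding candidate_sets_def using a'(1) k card_image_le[of "{..<k}" "\<lambda>i. a' i n"] by (auto simp: lessThan_empty_iff)
    ultimately show "kmeans_cost \<delta> \<mu> p (b ` {..<k}) \<le> kmeans_cost \<delta> \<mu> p S'"
      using min by (intro LIMSEQ_le[OF lim]) auto
  qed
  have "\<forall>\<^sub>F n in sequentially. \<forall>i\<in>{..<k}. \<delta> (a (r n) i) (b i) < e"
    using order_tendstoD(2)[OF \<delta>b e] by (intro eventually_ball_finite) auto
  then obtain n where "\<forall>i\<in>{..<k}. \<delta> (a (r n) i) (b i) < e"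
    unfolding eventually_sequentially by blast
  then have "hausdorff_dist \<delta> (S (r n)) (b ` {..<k}) \<le> e"
    unfolding a using sym by (intro hausdorff_dist_le[OF k]) (auto simp: less_imp_le)
  with far[OF bary] show False by blast
qed

end

section \<open>Convergence of the diffusion distances\<close>

text \<open>This is the Euclidean distance between images under the diffusion map, whose coordinates
  are the functions \<open>g l\<close> scaled by \<open>(1 - s l) powr t\<close>. The triangle
  inequality and the comparison of two such distances follow from this form.\<close>

lemma spectral_dist_eq_L2_set:
  "spectral_dist k t s g a b = L2_set (\<lambda>l. (1 - s l) powr t * (g l a - g l b)) {..<k}"
proof -
  have "(1 - s l) powr (2 * t) * (g l a - g l b)\<^sup>2 = ((1 - s l) powr t * (g l a - g l b))\<^sup>2" for l
    using powr_add[of "1 - s l" t t] by (simp add: power_mult_distrib power2_eq_square)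
  then show ?thesis unfolding spectral_dist_def L2_set_def by simp
qed

lemma spectral_dist_nonneg: "spectral_dist k t s g a b \<ge> 0"
  unfolding spectral_dist_eq_L2_set by (rule L2_set_nonneg)

lemma spectral_dist_refl: "spectral_dist k t s g a a = 0"
  by (simp add: spectral_dist_def)

lemma spectral_dist_sym: "spectral_dist k t s g a b = spectral_dist k t s g b a"
  by (simp add: spectral_dist_def power2_commute)

lemma spectral_dist_triangle:
  "spectral_dist k t s g a c \<le> spectral_dist k t s g a b + spectral_dist k t s g b c"
proof -
  have "spectral_dist k t s g a c =
    L2_set (\<lambda>l. (1 - s l) powr t * (g l a - g l b) + (1 - s l) powr t * (g l b - g l c)) {..<k}"
    unfolding spectral_dist_eq_L2_set by (simp add: algebra_simps)
  also have "\<dots> \<le> spectral_dist k t s g a b + spectral_dist k t s g b c"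
    unfolding spectral_dist_eq_L2_set by (rule L2_set_triangle_ineq)
  finally show ?thesis .
qed

lemma spectral_dist_continuous:
  assumes "\<And>l. l < k \<Longrightarrow> continuous_on S (g l)"
  shows "continuous_on S (\<lambda>y. spectral_dist k t s g y a)"
  unfolding spectral_dist_def using assms by (intro continuous_intros) auto

lemma abs_L2_set_diff_le:
  "\<bar>L2_set f A - L2_set g A\<bar> \<le> (\<Sum>l\<in>A. \<bar>f l - g l\<bar>)"
proof -
  have *: "L2_set f A \<le> L2_set g A + (\<Sum>l\<in>A. \<bar>f l - g l\<bar>)" for f g :: "'a \<Rightarrow> real"
    using L2_set_triangle_ineq[of g "\<lambda>l. f l - g l" A] L2_set_le_sum_abs[of "\<lambda>l. f l - g l" A] by simp
  show ?thesis using *[of f g] *[of g f] by (simp add: abs_minus_commute abs_le_iff)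
qed

context spectral_limit begin

text \<open>The base of the weight tends to \<open>1 - \<sigma> l > 0\<close>, where
  \<open>powr\<close> is continuous. Multiplying by \<open>s\<close> cancels the sign of the
  eigenvector because \<open>s * s = 1\<close>.\<close>

lemma weighted_difference_tendsto:
  fixes u :: "nat \<Rightarrow> nat \<Rightarrow> real"
  assumes l: "l < k"
    and u: "\<And>n. n \<ge> k \<Longrightarrow> eigenvector (laplacian \<eta> n x) (Matrix.vec n (u n)) (laplacian_eigenvalue \<eta> n x l)"
    and scaling: "(\<lambda>n. Max ((\<lambda>i. \<bar>u n i\<bar>) ` {..<n})) \<longlonglongrightarrow> (SUP y. \<bar>f l y\<bar>)"
    and e: "e > 0"
  shows "\<forall>\<^sub>F n in sequentially. \<exists>s. \<bar>s\<bar> = 1 \<and> (\<forall>i<n. \<forall>j<n.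
    \<bar>s * ((1 - laplacian_eigenvalue \<eta> n x l) powr t * (u n i - u n j)) - (1 - \<sigma> l) powr t * (f l (x i) - f l (x j))\<bar> < e)"
proof -
  define \<alpha> where "\<alpha> = (1 - \<sigma> l) powr t"
  define A where "A n = (1 - laplacian_eigenvalue \<eta> n x l) powr t" for n
  have "(\<lambda>n. A n) \<longlonglongrightarrow> \<alpha>"
    unfolding A_def \<alpha>_def using \<sigma>_less_1[OF l]
    by (intro tendsto_powr tendsto_intros laplacian_eigenvalue_tendsto[OF l]) auto
  note A = tendstoD[OF this]
  obtain F where F: "F > 0" "\<And>y. \<bar>f l y\<bar> \<le> F"
    using compact_bounded_real[OF compact_space f_continuous[OF l]] by blast
  have \<alpha>0: "\<alpha> \<ge> 0" unfolding \<alpha>_def by simp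
  \<comment> \<open>The weight is eventually at most \<open>\<alpha> + 1\<close> and a difference of
    two eigenvector errors at most \<open>2 * h\<close>, giving \<open>e / 2\<close>. The tolerance
    \<open>e / (4 * F)\<close> for the weight, times the bound \<open>2 * F\<close> for differences
    of \<open>f l\<close>, gives the other half.\<close>
  define h where "h = e / (4 * (\<alpha> + 1))"
  have h: "h > 0" "(\<alpha> + 1) * (2 * h) = e / 2" unfolding h_def using e \<alpha>0 by (auto simp: field_simps)
  have h': "e / (4 * F) > 0" using e F(1) by simp
  have one: "(1 :: real) > 0" by simp
  have ev: "\<forall>\<^sub>F n in sequentially. \<exists>s. \<bar>s\<bar> = 1 \<and> (\<forall>j<n. \<bar>u n j - s * f l (x j)\<bar> < h)"
    by (rule eigenvector_tendsto_eigenfunction[OF l _ scaling h(1)]) (rule u)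
  show ?thesis
    using ev A[OF one] A[OF h']
    unfolding A_def[symmetric] \<alpha>_def[symmetric]
  proof eventually_elim
    case (elim n)
    then obtain s where s: "\<bar>s\<bar> = 1" "\<And>j. j < n \<Longrightarrow> \<bar>u n j - s * f l (x j)\<bar> < h" by blast
    have ss: "s * s = 1" using s(1) by (metis abs_mult_self_eq mult_1)
    have A1: "\<bar>A n\<bar> \<le> \<alpha> + 1" using elim(2) \<alpha>0 by (simp add: dist_real_def)
    have A2: "\<bar>A n - \<alpha>\<bar> < e / (4 * F)" using elim(3) by (simp add: dist_real_def)
    have "\<bar>s * (A n * (u n i - u n j)) - \<alpha> * (f l (x i) - f l (x j))\<bar> < e" if ij: "i < n" "j < n" for i j
    proof -
      let ?v = "\<lambda>i. u n i - s * f l (x i)"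
      have "s * (A n * (u n i - u n j)) - \<alpha> * (f l (x i) - f l (x j))
        = s * (A n * (?v i - ?v j)) + (s * s * A n - \<alpha>) * (f l (x i) - f l (x j))"
        by (simp add: algebra_simps)
      also have "\<dots> = s * (A n * (?v i - ?v j)) + (A n - \<alpha>) * (f l (x i) - f l (x j))" unfolding ss by simp
      also have "\<bar>\<dots>\<bar> \<le> \<bar>A n\<bar> * \<bar>?v i - ?v j\<bar> + \<bar>A n - \<alpha>\<bar> * \<bar>f l (x i) - f l (x j)\<bar>"
        using s(1) by (intro order_trans[OF abs_triangle_ineq]) (simp add: abs_mult)
      also have "\<dots> \<le> (\<alpha> + 1) * (2 * h) + \<bar>A n - \<alpha>\<bar> * (2 * F)"
      proof (intro add_mono mult_mono A1)
        show "\<bar>?v i - ?v j\<bar> \<le> 2 * h" using s(2)[OF ij(1)] s(2)[OF ij(2)] by linarith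
        show "\<bar>f l (x i) - f l (x j)\<bar> \<le> 2 * F" using F(2)[of "x i"] F(2)[of "x j"] by linarith
      qed (use \<alpha>0 in auto)
      also have "\<bar>A n - \<alpha>\<bar> * (2 * F) < e / (4 * F) * (2 * F)" using A2 F(1) by (intro mult_strict_right_mono) auto
      also have "e / (4 * F) * (2 * F) = e / 2" using F(1) by simp
      finally show ?thesis using h(2) by simp
    qed
    then show ?case using s(1) by blast
  qed
qed

text \<open>The signs found for different \<open>l\<close> are unrelated. As an L2 norm over
  \<open>l\<close>, the distance allows every coordinate to be multiplied by its own sign before the
  two norms are compared.\<close>

lemma diffusion_dist_uniform:
  fixes u :: "nat \<Rightarrow> nat \<Rightarrow> nat \<Rightarrow> real"
  assumes u: "\<And>n l. n \<ge> k \<Longrightarrow> l < k \<Longrightarrow>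
      eigenvector (laplacian \<eta> n x) (Matrix.vec n (u n l)) (laplacian_eigenvalue \<eta> n x l)"
    and scaling: "compatible_scaling k u f"
    and e: "e > 0"
  shows "\<forall>\<^sub>F n in sequentially. \<forall>y\<in>x ` {..<n}. \<forall>z\<in>x ` {..<n}.
    \<bar>diffusion_dist \<eta> n x k t (u n) y z - spectral_dist k t \<sigma> f y z\<bar> < e"
proof -
  \<comment> \<open>The difference of the norms is at most the sum of the \<open>k\<close>
    coordinate errors, that is, at most \<open>real k * h < e\<close>.\<close>
  define h where "h = e / (2 * (real k + 1))"
  have h: "h > 0" "real k * h < e" unfolding h_def using e by (auto simp: field_simps intro: add_strict_increasing2)
  define R where "R n l s \<longleftrightarrow> \<bar>s\<bar> = 1 \<and> (\<forall>i<n. \<forall>j<n.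
    \<bar>s * ((1 - laplacian_eigenvalue \<eta> n x l) powr t * (u n l i - u n l j)) - (1 - \<sigma> l) powr t * (f l (x i) - f l (x j))\<bar> < h)" for n l s
  have "\<forall>\<^sub>F n in sequentially. \<forall>l\<in>{..<k}. \<exists>s. R n l s"
  proof (intro eventually_ball_finite ballI)
    fix l assume "l \<in> {..<k}"
    then have l: "l < k" by simp
    show "\<forall>\<^sub>F n in sequentially. \<exists>s. R n l s"
      unfolding R_def
    proof (rule weighted_difference_tendsto[OF l _ _ h(1)])
      show "eigenvector (laplacian \<eta> n x) (Matrix.vec n (u n l)) (laplacian_eigenvalue \<eta> n x l)" if "n \<ge> k" for n
        by (rule u[OF that l])
      show "(\<lambda>n. Max ((\<lambda>i. \<bar>u n l i\<bar>) ` {..<n})) \<longlonglongrightarrow> (SUP y. \<bar>f l y\<bar>)"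
        using scaling l unfolding compatible_scaling_def by blast
    qed
  qed simp
  then show ?thesis
  proof eventually_elim
    case (elim n)
    from bchoice[OF elim] obtain s where R: "\<forall>l\<in>{..<k}. R n l (s l)" by blast
    have s: "\<bar>s l\<bar> = 1" "\<And>i j. i < n \<Longrightarrow> j < n \<Longrightarrow>
      \<bar>s l * ((1 - laplacian_eigenvalue \<eta> n x l) powr t * (u n l i - u n l j)) - (1 - \<sigma> l) powr t * (f l (x i) - f l (x j))\<bar> < h"
      if "l < k" for l
    proof -
      have R: "R n l (s l)" using R that by simp
      show "\<bar>s l\<bar> = 1" using R unfolding R_def by (rule conjunct1)
      fix i j assume "i < n" "j < n"
      then show "\<bar>s l * ((1 - laplacian_eigenvalue \<eta> n x l) powr t * (u n l i - u n l j)) - (1 - \<sigma> l) powr t * (f l (x i) - f l (x j))\<bar> < h"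
        using R[unfolded R_def, THEN conjunct2, rule_format] by blast
    qed
    show ?case
    proof (intro ballI)
      fix y z assume yz: "y \<in> x ` {..<n}" "z \<in> x ` {..<n}"
      define i where "i = sample_index n x y"
      define j where "j = sample_index n x z"
      have idx: "sample_index n x w < n \<and> x (sample_index n x w) = w" if "w \<in> x ` {..<n}" for w
      proof -
        have "\<exists>i. i < n \<and> x i = w" using that by blast
        then show ?thesis unfolding sample_index_def by (rule LeastI_ex)
      qed
      have i: "i < n" "x i = y" and j: "j < n" "x j = z" unfolding i_def j_def using idx yz by auto
      let ?a = "\<lambda>l. (1 - laplacian_eigenvalue \<eta> n x l) powr t * (u n l i - u n l j)"
      let ?b = "\<lambda>l. (1 - \<sigma> l) powr t * (f l y - f l z)"
      have "diffusion_dist \<eta> n x k t (u n) y z = L2_set ?a {..<k}"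
        unfolding diffusion_dist_def spectral_dist_eq_L2_set i_def j_def ..
      also have "\<dots> = L2_set (\<lambda>l. s l * ?a l) {..<k}"
      proof -
        have "(s l)\<^sup>2 = 1" if "l < k" for l using s(1)[OF that] by (metis abs_1 one_power2 power2_abs)
        then show ?thesis unfolding L2_set_def by (intro arg_cong[of _ _ sqrt] sum.cong refl) (simp add: power_mult_distrib)
      qed
      finally have "\<bar>diffusion_dist \<eta> n x k t (u n) y z - spectral_dist k t \<sigma> f y z\<bar>
        \<le> (\<Sum>l<k. \<bar>s l * ?a l - ?b l\<bar>)"
        unfolding spectral_dist_eq_L2_set by (simp only: abs_L2_set_diff_le)
      also have "\<dots> \<le> (\<Sum>l<k. h)"
        using s(2)[OF _ i(1) j(1)] unfolding i(2) j(2) by (intro sum_mono less_imp_le) auto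
      also have "\<dots> < e" using h(2) by simp
      finally show "\<bar>diffusion_dist \<eta> n x k t (u n) y z - spectral_dist k t \<sigma> f y z\<bar> < e" .
    qed
  qed
qed

end

section \<open>From almost every outcome to the deterministic statements\<close>

theorem proposition3p11:
  fixes P :: "'w measure"
    and X :: "nat \<Rightarrow> 'w \<Rightarrow> 'm::{t2_space,second_countable_topology}"
    and \<mu> :: "'m measure"
    and \<eta> :: "'m \<Rightarrow> 'm \<Rightarrow> real"
    and k :: nat and p t :: real
    and \<sigma> :: "nat \<Rightarrow> real" and f :: "nat \<Rightarrow> 'm \<Rightarrow> real"
    and u :: "nat \<Rightarrow> 'w \<Rightarrow> nat \<Rightarrow> nat \<Rightarrow> real"
  assumes manifold: "compact_manifold TYPE('m)"
    and prob: "prob_space P"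
    and indep: "prob_space.indep_vars P (\<lambda>_. borel) X UNIV"
    and distr: "\<And>i. distr P borel (X i) = \<mu>"
    and full_support: "\<And>U. open U \<Longrightarrow> U \<noteq> {} \<Longrightarrow> emeasure \<mu> U > 0"
    and eta_sym: "\<And>x y. \<eta> x y = \<eta> y x"
    and eta_cont: "continuous_on UNIV (\<lambda>(x, y). \<eta> x y)"
    and eta_pos: "\<And>x y. \<eta> x y > 0"
    and k: "k \<ge> 1" and p: "p \<ge> 1" and t: "t \<ge> 0"
    and sigma_bounds: "\<And>l. l < k \<Longrightarrow> 0 \<le> \<sigma> l \<and> \<sigma> l \<le> 1"
    and sigma_simple: "first_eigenvalues_simple (limit_operator \<eta> \<mu>) k \<sigma>"
    and sigma_last: "\<sigma> (k - 1) \<noteq> 1"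
    and f: "\<And>l. l < k \<Longrightarrow> eigenfunction (limit_operator \<eta> \<mu>) (f l) (\<sigma> l)"
    and u: "\<And>n \<omega> l. n \<ge> k \<Longrightarrow> \<omega> \<in> space P \<Longrightarrow> l < k \<Longrightarrow>
       eigenvector (laplacian \<eta> n (\<lambda>i. X i \<omega>)) (Matrix.vec n (u n \<omega> l))
         (laplacian_eigenvalue \<eta> n (\<lambda>i. X i \<omega>) l)"
    and scaling: "AE \<omega> in P. compatible_scaling k (\<lambda>n. u n \<omega>) f"
  shows "AE \<omega> in P. \<forall>\<epsilon>>0. \<exists>N. \<forall>n\<ge>N.
    \<forall>S\<^sub>n \<in> barycenters ((\<lambda>i. X i \<omega>) ` {..<n}) (diffusion_dist \<eta> n (\<lambda>i. X i \<omega>) k t (u n \<omega>))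
            (empirical_measure n (\<lambda>i. X i \<omega>)) p k.
    \<exists>S \<in> barycenters UNIV (spectral_dist k t \<sigma> f) \<mu> p k.
      hausdorff_dist (spectral_dist k t \<sigma> f) S\<^sub>n S \<le> \<epsilon>"
proof -
  interpret prob_space P by (rule prob)
  have cpt: "compact (UNIV :: 'm set)" using manifold unfolding compact_manifold_def by blast
  have X: "X i \<in> borel_measurable P" for i using indep unfolding indep_vars_def by auto
  have \<mu>: "prob_space \<mu>" "sets \<mu> = sets borel"
    unfolding distr[of 0, symmetric] using X by (auto intro: prob_space_distr)
  \<comment> \<open>Only the last eigenvalue is assumed different from 1; monotonicity of the list
    passes this on to all earlier ones.\<close>
  have \<sigma>_less_1: "\<sigma> l < 1" if "l < k" for l
  proof -
    have "\<sigma> l \<le> \<sigma> (k - 1)"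
    proof (cases "l = k - 1")
      case False
      then show ?thesis using sigma_simple that unfolding first_eigenvalues_simple_def strict_mono_on_def
        by (intro less_imp_le) auto
    qed simp
    moreover have "\<sigma> (k - 1) \<le> 1" using sigma_bounds[of "k - 1"] k by simp
    ultimately show ?thesis using sigma_last by linarith
  qed
  show ?thesis
    \<comment> \<open>The eigenvectors are prescribed only for outcomes in \<open>space P\<close>,
      hence \<open>AE_space\<close>. On the intersection of the three events the outcome is fixed,
      and the tolerance is quantified inside.\<close>
    using scaling AE_equidistributed[OF cpt indep distr] AE_space
  proof eventually_elim
    case (elim \<omega>)
    have "sample_kernel (\<lambda>i. X i \<omega>) \<mu> \<eta>"
      by (rule sample_kernel.intro[OF cpt \<mu> full_support eta_sym eta_cont eta_pos elim(2)])
    then interpret spectral_limit "\<lambda>i. X i \<omega>" \<mu> \<eta> k \<sigma> f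
      by (rule spectral_limit.intro[OF _ spectral_limit_axioms.intro[OF sigma_simple f \<sigma>_less_1]])
    show ?case
    proof (intro allI impI)
      fix \<epsilon> :: real assume "\<epsilon> > 0"
      have "\<forall>\<^sub>F n in sequentially. \<forall>S\<^sub>n \<in> barycenters ((\<lambda>i. X i \<omega>) ` {..<n}) (diffusion_dist \<eta> n (\<lambda>i. X i \<omega>) k t (u n \<omega>))
            (empirical_measure n (\<lambda>i. X i \<omega>)) p k.
        \<exists>S \<in> barycenters UNIV (spectral_dist k t \<sigma> f) \<mu> p k. hausdorff_dist (spectral_dist k t \<sigma> f) S\<^sub>n S \<le> \<epsilon>"
      proof (rule kmeans_consistency)
        show "continuous_on UNIV (\<lambda>y. spectral_dist k t \<sigma> f y a)" for a
          by (intro spectral_dist_continuous f_continuous)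
        show "diffusion_dist \<eta> n (\<lambda>i. X i \<omega>) k t (u n \<omega>) y z \<ge> 0" for n y z
          unfolding diffusion_dist_def by (rule spectral_dist_nonneg)
        show "\<forall>\<^sub>F n in sequentially. \<forall>y\<in>(\<lambda>i. X i \<omega>) ` {..<n}. \<forall>z\<in>(\<lambda>i. X i \<omega>) ` {..<n}.
          \<bar>diffusion_dist \<eta> n (\<lambda>i. X i \<omega>) k t (u n \<omega>) y z - spectral_dist k t \<sigma> f y z\<bar> < e" if "e > 0" for e
          using u elim that by (intro diffusion_dist_uniform) auto
      qed (use p \<open>\<epsilon> > 0\<close> in \<open>auto simp: spectral_dist_nonneg spectral_dist_refl intro: spectral_dist_sym spectral_dist_triangle\<close>)
      then show "\<exists>N. \<forall>n\<ge>N. \<forall>S\<^sub>n \<in> barycenters ((\<lambda>i. X i \<omega>) ` {..<n}) (diffusion_dist \<eta> n (\<lambda>i. X i \<omega>) k t (u n \<omega>))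
            (empirical_measure n (\<lambda>i. X i \<omega>)) p k.
        \<exists>S \<in> barycenters UNIV (spectral_dist k t \<sigma> f) \<mu> p k. hausdorff_dist (spectral_dist k t \<sigma> f) S\<^sub>n S \<le> \<epsilon>"
        unfolding eventually_sequentially .
    qed
  qed
qed

end
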